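(* Let $S$ be a simply connected square tiled surface in which every interior vertex is surrounded by exactly four squares, and suppose that $S$ is domino tileable. Let $T,T'$ be two domino tilings of $S$, let $\mathcal{C}(T,T')$ be the associated collection of disjoint oriented cycles in the dual graph $S^*$, and let $\nu$ be the associated value function on the vertex set $V(S)$. Then $$d_{\mathcal{F}_S}(T,T') = \sum_{v \in V(S)} \nu(v).$$
   Context: A square tiled surface $S$ is a (compact) surface with boundary obtained by pasting together finitely many $1\times 1$ Euclidean squares along edges. $V(S)$ is the set of images of the corners of the squares. The standing assumption is that $S$ is simply connected and that every vertex in the interior of $S$ is surrounded by exactly four squares; $S$ need not be embeddable in the plane. Consequently $S$ carries a chessboard (black/white) coloring of its squares (squares sharing an edge have different colors) and an orientation inherited from an immersion in the chessboard-colored Euclidean plane; both are fixed. The dual graph $S^*$ has the squares of $S$ as vertices, drawn at the centers of the squares, with an edge between two squares that share an edge. A domino tiling of $S$ is a tiling of $S$ by $2\times 1$ rectangles (dominos), equivalently a perfect matching of $S^*$. If two dominos of a tiling share a long edge, they fill a $2\times 2$ square, and rotating this square by a quarter turn yields a new tiling; this operation is a flip. The flip graph $\mathcal{F}_S$ has the domino tilings of $S$ as vertices, with an edge between two tilings related by a single flip. $d_{\mathcal{F}_S}$ is the graph distance on its vertices, all edges having length $1$. Given an ordered pair $T,T'$ of tilings, superimpose the corresponding perfect matchings in $S^*$ and erase all edges belonging to both. The remaining edges form a collection $\mathcal{C}(T,T')$ of disjoint cycles, whose edges alternate between $T$ and $T'$. Each cycle is oriented so that its edges belonging to $T$ are traversed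 from black to white. A cycle is positive if it is oriented counterclockwise and negative otherwise. A cycle surrounds a vertex $v$ of $S$ if $v$ lies in the region enclosed by the cycle. For $v\in V(S)$, let $\nu^+(v)$ (resp. $\nu^-(v)$) be the number of positive (resp. negative) cycles of $\mathcal{C}(T,T')$ surrounding $v$, and put $\nu(v) := |\nu^+(v)-\nu^-(v)|$. *)

theory Defs
  imports "HOL-Analysis.Analysis" "HOL-Library.Extended_Nat"
begin

section \<open>Square tiled surfaces\<close>

text \<open>
  Every square is an oriented copy of the unit square centred at \<open>0\<close> in the complex plane.
  Its corners and sides are numbered \<open>0, 1, 2, 3\<close> counterclockwise: side \<open>i\<close> runs from
  corner \<open>i\<close> to corner \<open>i + 1\<close> (modulo 4), corner \<open>0\<close> is the lower left one, and multiplication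
  by the imaginary unit takes side \<open>i\<close> to side \<open>i + 1\<close>.
  A pair \<open>((q, i), (r, j))\<close> in \<open>glue\<close> says that side \<open>i\<close> of \<open>q\<close> is pasted to side \<open>j\<close> of \<open>r\<close>, the
  two sides being traversed in opposite directions, so that the orientations of the squares fit
  together to an orientation of the surface. Since simply connected surfaces are orientable,
  this presents precisely the simply connected surfaces pasted from squares, together
  with a choice of orientation.
\<close>

type_synonym 's side = "'s \<times> nat"

record 's square_complex =
  squares :: "'s set"
  glue :: "('s side \<times> 's side) set"

definition sides :: "'s square_complex \<Rightarrow> 's side set" where
  "sides S = squares S \<times> {..<4}"

definition square_tiled_surface :: "'s square_complex \<Rightarrow> bool" where
  "square_tiled_surface S \<longleftrightarrow>
     finite (squares S) \<and> glue S \<subseteq> sides S \<times> sides S \<and>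
     sym (glue S) \<and> irrefl (glue S) \<and> single_valued (glue S)"

definition unit_square :: "complex set" where
  "unit_square = {z. \<bar>Re z\<bar> \<le> 1/2 \<and> \<bar>Im z\<bar> \<le> 1/2}"

definition side_point :: "nat \<Rightarrow> real \<Rightarrow> complex" where
  "side_point i t = \<i> ^ i * Complex (t - 1/2) (- 1/2)"

abbreviation corner :: "nat \<Rightarrow> complex" where
  "corner i \<equiv> side_point i 0"

abbreviation side_midpoint :: "nat \<Rightarrow> complex" where
  "side_midpoint i \<equiv> side_point i (1/2)"

lemma side_point_1: "side_point i 1 = corner (Suc i)"
  by (simp add: side_point_def complex_eq_iff algebra_simps)

lemma side_point_add_4: "side_point (i + 4) t = side_point i t"
  by (simp add: side_point_def power_add)

definition pasting :: "'s square_complex \<Rightarrow> (('s \<times> complex) \<times> ('s \<times> complex)) set" where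
  "pasting S = {((q, side_point i t), (r, side_point j (1 - t))) | q i r j t.
                  ((q, i), (r, j)) \<in> glue S \<and> t \<in> {0..1}}"

text \<open>
  The relation \<open>pasting S\<close> is symmetric, so \<open>paste S x\<close> is the class of \<open>x\<close> in the
  generated equivalence relation. The points of the surface are these classes.
\<close>

lemma sym_pasting:
  assumes "sym (glue S)"
  shows "sym (pasting S)"
proof (rule symI)
  fix x y assume "(x, y) \<in> pasting S"
  then obtain q i r j t where xy: "x = (q, side_point i t)" "y = (r, side_point j (1 - t))"
    and g: "((q, i), (r, j)) \<in> glue S" and t: "t \<in> {0..1}"
    unfolding pasting_def by blast
  have "((r, j), (q, i)) \<in> glue S"
    using assms g by (rule symD)
  moreover have "x = (q, side_point i (1 - (1 - t)))" "1 - t \<in> {0..1}"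
    using xy t by auto
  ultimately show "(y, x) \<in> pasting S"
    unfolding pasting_def using xy(2) by blast
qed

definition paste :: "'s square_complex \<Rightarrow> 's \<times> complex \<Rightarrow> ('s \<times> complex) set" where
  "paste S x = (pasting S)\<^sup>* `` {x}"

definition pieces :: "'s square_complex \<Rightarrow> ('s \<times> complex) topology" where
  "pieces S = prod_topology (discrete_topology (squares S)) (top_of_set unit_square)"

definition surface :: "'s square_complex \<Rightarrow> ('s \<times> complex) set topology" where
  "surface S = topology (\<lambda>U. U \<subseteq> paste S ` topspace (pieces S) \<and>
                             openin (pieces S) {x \<in> topspace (pieces S). paste S x \<in> U})"

lemma openin_surface:
  "openin (surface S) U \<longleftrightarrow>
     U \<subseteq> paste S ` topspace (pieces S) \<and>
     openin (pieces S) {x \<in> topspace (pieces S). paste S x \<in> U}"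
proof -
  let ?P = "\<lambda>U. {x \<in> topspace (pieces S). paste S x \<in> U}"
  have "istopology (\<lambda>U. U \<subseteq> paste S ` topspace (pieces S) \<and> openin (pieces S) (?P U))"
    unfolding istopology_def
  proof (intro conjI allI impI)
    fix U V
    assume U: "U \<subseteq> paste S ` topspace (pieces S) \<and> openin (pieces S) (?P U)"
      and V: "V \<subseteq> paste S ` topspace (pieces S) \<and> openin (pieces S) (?P V)"
    then show "U \<inter> V \<subseteq> paste S ` topspace (pieces S)" by blast
    have "?P (U \<inter> V) = ?P U \<inter> ?P V" by blast
    with U V show "openin (pieces S) (?P (U \<inter> V))" by (simp add: openin_Int)
  next
    fix \<U>
    assume *: "\<forall>U\<in>\<U>. U \<subseteq> paste S ` topspace (pieces S) \<and> openin (pieces S) (?P U)"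
    then show "\<Union>\<U> \<subseteq> paste S ` topspace (pieces S)" by blast
    have "?P (\<Union>\<U>) = (\<Union>U\<in>\<U>. ?P U)" by blast
    with * show "openin (pieces S) (?P (\<Union>\<U>))" by (simp add: openin_clauses(3))
  qed
  then show ?thesis
    unfolding surface_def by (simp add: topology_inverse')
qed

lemma topspace_surface: "topspace (surface S) = paste S ` topspace (pieces S)"
proof
  show "topspace (surface S) \<subseteq> paste S ` topspace (pieces S)"
    using openin_surface openin_topspace by blast
  have "{x \<in> topspace (pieces S). paste S x \<in> paste S ` topspace (pieces S)} = topspace (pieces S)"
    by blast
  then have "openin (surface S) (paste S ` topspace (pieces S))"
    by (simp add: openin_surface)
  then show "paste S ` topspace (pieces S) \<subseteq> topspace (surface S)"
    by (rule openin_subset)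
qed

lemma quotient_map_paste: "quotient_map (pieces S) (surface S) (paste S)"
  by (simp add: quotient_map_def topspace_surface openin_surface)

definition surface_vertices :: "'s square_complex \<Rightarrow> ('s \<times> complex) set set" where
  "surface_vertices S = {paste S (q, corner i) | q i. q \<in> squares S \<and> i < 4}"

definition surface_boundary :: "'s square_complex \<Rightarrow> ('s \<times> complex) set set" where
  "surface_boundary S =
     {paste S (q, side_point i t) | q i t. (q, i) \<in> sides S - Domain (glue S) \<and> t \<in> {0..1}}"

text \<open>The squares around a vertex, counted with the corner by which they meet it.\<close>

definition corners_at :: "'s square_complex \<Rightarrow> ('s \<times> complex) set \<Rightarrow> 's side set" where
  "corners_at S v = {(q, i). q \<in> squares S \<and> i < 4 \<and> paste S (q, corner i) = v}"

definition interior_vertices_have_four_squares :: "'s square_complex \<Rightarrow> bool" where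
  "interior_vertices_have_four_squares S \<longleftrightarrow>
     (\<forall>v \<in> surface_vertices S - surface_boundary S. card (corners_at S v) = 4)"

text \<open>The counterpart of \<^const>\<open>simply_connected\<close> for abstract topologies.\<close>

definition simply_connected_space :: "'a topology \<Rightarrow> bool" where
  "simply_connected_space X \<longleftrightarrow>
     (\<forall>p q. pathin X p \<and> p 1 = p 0 \<and> pathin X q \<and> q 1 = q 0 \<longrightarrow>
            homotopic_with (\<lambda>r. r 1 = r 0) (top_of_set {0..1::real}) X p q)"

definition chessboard_coloring :: "'s square_complex \<Rightarrow> ('s \<Rightarrow> bool) \<Rightarrow> bool" where
  "chessboard_coloring S black \<longleftrightarrow>
     (\<forall>q i r j. ((q, i), (r, j)) \<in> glue S \<longrightarrow> black q \<noteq> black r)"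


section \<open>Domino tilings and flips\<close>

definition dual_edges :: "'s square_complex \<Rightarrow> 's set set" where
  "dual_edges S = {{q, r} | q r. q \<noteq> r \<and> (\<exists>i j. ((q, i), (r, j)) \<in> glue S)}"

definition domino_tiling :: "'s square_complex \<Rightarrow> 's set set \<Rightarrow> bool" where
  "domino_tiling S T \<longleftrightarrow> T \<subseteq> dual_edges S \<and> (\<forall>q \<in> squares S. \<exists>!d. d \<in> T \<and> q \<in> d)"

text \<open>
  Corner \<open>i\<close> of a square is the end of its side \<open>i + 3\<close> (modulo 4). Turning counterclockwise around it
  one leaves the square through that side; if the side is pasted to side \<open>j\<close> of \<open>r\<close>,
  then one arrives at corner \<open>j\<close> of \<open>r\<close>. Thus \<open>a, b, c, d\<close> are the squares of a \<open>2 \<times> 2\<close> square,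
  in counterclockwise order around its centre.
\<close>

definition two_by_two :: "'s square_complex \<Rightarrow> 's \<Rightarrow> 's \<Rightarrow> 's \<Rightarrow> 's \<Rightarrow> bool" where
  "two_by_two S a b c d \<longleftrightarrow>
     distinct [a, b, c, d] \<and>
     (\<exists>i j k l. ((a, (i + 3) mod 4), (b, j)) \<in> glue S \<and> ((b, (j + 3) mod 4), (c, k)) \<in> glue S \<and>
                ((c, (k + 3) mod 4), (d, l)) \<in> glue S \<and> ((d, (l + 3) mod 4), (a, i)) \<in> glue S)"

text \<open>
  In the configuration below the dominos \<open>{a, b}\<close> and \<open>{c, d}\<close> share the long edge formed
  by the side between \<open>b\<close> and \<open>c\<close> and the side between \<open>d\<close> and \<open>a\<close>.
\<close>

definition flip :: "'s square_complex \<Rightarrow> 's set set \<Rightarrow> 's set set \<Rightarrow> bool" where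
  "flip S T T' \<longleftrightarrow>
     (\<exists>a b c d. two_by_two S a b c d \<and> {a, b} \<in> T \<and> {c, d} \<in> T \<and>
                T' = T - {{a, b}, {c, d}} \<union> {{b, c}, {d, a}})"

definition flip_graph :: "'s square_complex \<Rightarrow> ('s set set \<times> 's set set) set" where
  "flip_graph S = {(T, T'). domino_tiling S T \<and> domino_tiling S T' \<and> flip S T T'}"

text \<open>The distance is infinite for points not joined by a path, as \<open>Inf {} = \<infinity>\<close> in \<^typ>\<open>enat\<close>.\<close>

definition graph_dist :: "('a \<times> 'a) set \<Rightarrow> 'a \<Rightarrow> 'a \<Rightarrow> enat" where
  "graph_dist E x y = (INF n \<in> {n. (x, y) \<in> E ^^ n}. enat n)"


section \<open>The cycles of a pair of tilings\<close>

text \<open>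
  A cycle is represented by its set of edges; the cycles are the connected components of
  the graph formed by the edges that belong to exactly one of the two tilings.
\<close>

definition tiling_cycles :: "'s set set \<Rightarrow> 's set set \<Rightarrow> 's set set set" where
  "tiling_cycles T T' =
     (let D = (T - T') \<union> (T' - T) in D // {(d, e). d \<in> D \<and> e \<in> D \<and> d \<inter> e \<noteq> {}}\<^sup>*)"

text \<open>
  The edges of \<open>T\<close> are traversed from black to white, hence those of \<open>T'\<close> from white to black.
\<close>

definition cycle_arcs :: "('s \<Rightarrow> bool) \<Rightarrow> 's set set \<Rightarrow> 's set set \<Rightarrow> ('s \<times> 's) set" where
  "cycle_arcs black T C = {(q, r). {q, r} \<in> C \<and> q \<noteq> r \<and> ({q, r} \<in> T \<longleftrightarrow> black q)}"

text \<open>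
  The cycle as a closed curve in the surface: an edge of the dual graph is drawn as the segment from
  the center of a square through the midpoint of the common side to the center of the other square.
\<close>

definition cycle_curve :: "'s square_complex \<Rightarrow> 's set set \<Rightarrow> ('s \<times> complex) set set" where
  "cycle_curve S C =
     {paste S (q, z) | q i r j z.
        ((q, i), (r, j)) \<in> glue S \<and> {q, r} \<in> C \<and> z \<in> closed_segment 0 (side_midpoint i)}"

text \<open>
  The region enclosed by a cycle consists of the components of its complement that do not reach
  the boundary of the surface.
\<close>

definition enclosed_region :: "'s square_complex \<Rightarrow> 's set set \<Rightarrow> ('s \<times> complex) set set" where
  "enclosed_region S C =
     (let X = subtopology (surface S) (topspace (surface S) - cycle_curve S C)
      in {x \<in> topspace X. connected_component_of_set X x \<inter> surface_boundary S = {}})"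

text \<open>
  A cycle is counterclockwise if the region it encloses lies to its left. Leaving the square
  \<open>q\<close> through side \<open>i\<close>, the end point of this side to the left is corner \<open>i + 1\<close>.
\<close>

definition counterclockwise ::
  "'s square_complex \<Rightarrow> ('s \<Rightarrow> bool) \<Rightarrow> 's set set \<Rightarrow> 's set set \<Rightarrow> bool" where
  "counterclockwise S black T C \<longleftrightarrow>
     (\<forall>(q, r) \<in> cycle_arcs black T C. \<forall>i j. ((q, i), (r, j)) \<in> glue S \<longrightarrow>
        paste S (q, corner ((i + 1) mod 4)) \<in> enclosed_region S C)"

definition nu_pos ::
  "'s square_complex \<Rightarrow> ('s \<Rightarrow> bool) \<Rightarrow> 's set set \<Rightarrow> 's set set \<Rightarrow> ('s \<times> complex) set \<Rightarrow> nat" where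
  "nu_pos S black T T' v =
     card {C \<in> tiling_cycles T T'. counterclockwise S black T C \<and> v \<in> enclosed_region S C}"

definition nu_neg ::
  "'s square_complex \<Rightarrow> ('s \<Rightarrow> bool) \<Rightarrow> 's set set \<Rightarrow> 's set set \<Rightarrow> ('s \<times> complex) set \<Rightarrow> nat" where
  "nu_neg S black T T' v =
     card {C \<in> tiling_cycles T T'. \<not> counterclockwise S black T C \<and> v \<in> enclosed_region S C}"

definition nu ::
  "'s square_complex \<Rightarrow> ('s \<Rightarrow> bool) \<Rightarrow> 's set set \<Rightarrow> 's set set \<Rightarrow> ('s \<times> complex) set \<Rightarrow> nat" where
  "nu S black T T' v = nat \<bar>int (nu_pos S black T T' v) - int (nu_neg S black T T' v)\<bar>"

end

theory Submission
  imports Defs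
begin

text \<open>
  The proof compares tilings by height functions. Traverse the edges of \<open>T\<close> from black to white and
  those of \<open>T'\<close> from white to black. Every square lies on one edge of each kind, so this is a flow on
  the dual graph without sources or sinks. As the surface is simply connected, the flow across a side
  is the difference of an integer function \<open>h\<close> at the two ends of the side, and \<open>h\<close> is constant on the
  boundary because the boundary is connected; it is normalised to vanish there (\<open>height_of\<close>).
  The flow is the sum of the flows along the single cycles, and the height function of a single cycle
  is, up to the sign given by the orientation, the indicator function of the region that the cycle
  encloses (\<open>cycle_height\<close>). Hence \<open>\<nu>(v) = \<bar>h v\<bar>\<close> (\<open>nu_eq_height\<close>).

  A flip changes \<open>h\<close> by one at a single vertex (\<open>flip_graph_height\<close>), so at least \<open>\<Sum>\<^sub>v \<bar>h v\<bar>\<close> flips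
  are needed. Conversely, suppose that \<open>h\<close> is positive somewhere. A single tiling also has a height
  function, taken relative to the chessboard coloring. Among the vertices at which \<open>h\<close> is
  maximal choose one at which the height function of \<open>T\<close> is minimal: two parallel dominos of \<open>T\<close>
  meet there, and flipping them decreases \<open>\<Sum>\<^sub>v \<bar>h v\<bar>\<close> by one (\<open>flip_at_maximum\<close>). If \<open>h\<close> is
  negative somewhere, the same is done with \<open>T\<close> and \<open>T'\<close> exchanged.

  Topology enters in two places. Apart from connectedness, simple connectivity is used only through maps to the circle.
  Integers at the corners of the squares whose jump is constant along every pasted side
  define, by bilinear interpolation and exponentiation, a map of the surface to the
  circle; its logarithm along a loop closes up, and so the jumps are the differences of an integer
  function on the squares (\<open>integral_jumps_exact\<close>). Everything else about the shape of the surface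
  follows from this: sourceless integer flows are differences of functions on the
  vertices, there is a developing map to the square lattice, two squares share at most one
  side, the boundary is nonempty and connected. The second place is the enclosed region, which is
  defined by connected components. Cutting each square into its four quadrants shows that a property of
  vertices which is preserved along all sides not crossed by the cycle is constant on the vertices of
  each component (\<open>vertices_in_component\<close>).
\<close>

section \<open>Corners and sides\<close>

text \<open>
  A pair \<open>(q, i)\<close> denotes both the side \<open>i\<close> of \<open>q\<close> and the corner \<open>i\<close> of \<open>q\<close>, at which this side starts.
\<close>

definition next_side :: "'s side \<Rightarrow> 's side" where
  "next_side c = (fst c, (snd c + 1) mod 4)"

definition prev_side :: "'s side \<Rightarrow> 's side" where
  "prev_side c = (fst c, (snd c + 3) mod 4)"

definition vertex_of :: "'s square_complex \<Rightarrow> 's side \<Rightarrow> ('s \<times> complex) set" where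
  "vertex_of S c = paste S (fst c, corner (snd c))"

definition mate :: "'s square_complex \<Rightarrow> 's side \<Rightarrow> 's side" where
  "mate S s = (THE t. (s, t) \<in> glue S)"

lemma fst_next_side [simp]: "fst (next_side c) = fst c"
  and fst_prev_side [simp]: "fst (prev_side c) = fst c"
  by (simp_all add: next_side_def prev_side_def)

lemma less_4_cases:
  assumes "i < (4::nat)"
  obtains "i = 0" | "i = 1" | "i = 2" | "i = 3"
  using assms by linarith

lemma lessThan_4: "{..<4} = {0, 1, 2, 3 :: nat}"
  by auto

lemma side_point_explicit:
  "side_point 0 t = Complex (t - 1/2) (- 1/2)"
  "side_point (Suc 0) t = Complex (1/2) (t - 1/2)"
  "side_point 2 t = Complex (1/2 - t) (1/2)"
  "side_point 3 t = Complex (- 1/2) (1/2 - t)"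
  by (simp_all add: side_point_def complex_eq_iff numeral_eq_Suc)

lemma side_point_in_unit_square:
  assumes "i < 4" "t \<in> {0..1}"
  shows "side_point i t \<in> unit_square"
  using assms by (cases rule: less_4_cases[OF assms(1)]) (auto simp: unit_square_def side_point_explicit abs_if)

lemma side_point_eq_corner_iff:
  assumes "i < 4" "k < 4" "t \<in> {0..1}"
  shows "side_point i t = corner k \<longleftrightarrow> t = 0 \<and> k = i \<or> t = 1 \<and> k = (i + 1) mod 4"
  using assms
  by (cases rule: less_4_cases[OF assms(1)]; cases rule: less_4_cases[OF assms(2)])
     (auto simp: side_point_explicit)

lemma side_point_1': "side_point i 1 = corner ((i + 1) mod 4)" if "i < 4"
  using side_point_eq_corner_iff[of i "(i+1) mod 4" 1] that by simp

lemma paste_eq_iff: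
  assumes "sym (glue S)"
  shows "paste S x = paste S y \<longleftrightarrow> (x, y) \<in> (pasting S)\<^sup>*"
proof
  assume "paste S x = paste S y"
  moreover have "y \<in> paste S y" by (simp add: paste_def)
  ultimately show "(x, y) \<in> (pasting S)\<^sup>*" by (metis Image_singleton_iff paste_def)
next
  assume *: "(x, y) \<in> (pasting S)\<^sup>*"
  have "sym ((pasting S)\<^sup>*)" by (intro sym_rtrancl sym_pasting assms)
  then have "(y, x) \<in> (pasting S)\<^sup>*" using * by (rule symD)
  with * show "paste S x = paste S y" unfolding paste_def by (auto intro: rtrancl_trans)
qed

lemma paste_invariant:
  assumes "sym (glue S)" "paste S x = paste S y" "P x"
    and "\<And>q i r j t. ((q, i), (r, j)) \<in> glue S \<Longrightarrow> t \<in> {0..1} \<Longrightarrow> P (q, side_point i t) \<Longrightarrow>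
           P (r, side_point j (1 - t))"
  shows "P y"
proof -
  have "(x, y) \<in> (pasting S)\<^sup>*" using assms paste_eq_iff by metis
  then show ?thesis
  proof (induction rule: rtrancl_induct)
    case (step y z)
    then show ?case using assms(4) unfolding pasting_def by blast
  qed (rule assms(3))
qed

lemma vertex_of_in_surface_vertices: "c \<in> sides S \<Longrightarrow> vertex_of S c \<in> surface_vertices S"
  unfolding vertex_of_def surface_vertices_def sides_def by fastforce

lemma surface_vertices_eq: "surface_vertices S = vertex_of S ` sides S"
  unfolding vertex_of_def surface_vertices_def sides_def by force

lemma corners_at_eq: "corners_at S v = {c \<in> sides S. vertex_of S c = v}"
  unfolding vertex_of_def corners_at_def sides_def by force

lemma next_side_in_sides [simp]: "next_side c \<in> sides S \<longleftrightarrow> fst c \<in> squares S"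
  and prev_side_in_sides [simp]: "prev_side c \<in> sides S \<longleftrightarrow> fst c \<in> squares S"
  by (auto simp: next_side_def prev_side_def sides_def)

lemma next_prev_side [simp]: "c \<in> sides S \<Longrightarrow> next_side (prev_side c) = c"
  and prev_next_side [simp]: "c \<in> sides S \<Longrightarrow> prev_side (next_side c) = c"
  by (cases c; simp add: next_side_def prev_side_def sides_def mod_simps)+

locale tiled_surface =
  fixes S :: "'s square_complex"
  assumes tiled: "square_tiled_surface S"
begin

abbreviation "vert \<equiv> vertex_of S"

lemma finite_squares: "finite (squares S)"
  and sym_glue: "sym (glue S)"
  and glue_irrefl: "(s, s) \<notin> glue S"
  and single_valued_glue: "single_valued (glue S)"
  using tiled by (cases s; auto simp: square_tiled_surface_def irrefl_def)+

lemma finite_sides: "finite (sides S)"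
  using finite_squares by (simp add: sides_def)

lemma finite_vertices: "finite (surface_vertices S)"
  using finite_sides by (simp add: surface_vertices_eq)

lemma glue_sym: "(s, t) \<in> glue S \<Longrightarrow> (t, s) \<in> glue S"
  using sym_glue by (rule symD)

lemma glue_unique: "(s, t) \<in> glue S \<Longrightarrow> (s, t') \<in> glue S \<Longrightarrow> t = t'"
  using single_valued_glue by (rule single_valuedD)

lemma glue_in_sides: "(s, t) \<in> glue S \<Longrightarrow> s \<in> sides S" "(s, t) \<in> glue S \<Longrightarrow> t \<in> sides S"
  using tiled by (auto simp: square_tiled_surface_def)

lemma side_lt_4: "c \<in> sides S \<Longrightarrow> snd c < 4" and fst_side: "c \<in> sides S \<Longrightarrow> fst c \<in> squares S"
  by (auto simp: sides_def)

lemma next_side_cycle: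
  assumes "c \<in> sides S"
  shows "next_side (next_side (next_side (next_side c))) = c"
    "distinct [c, next_side c, next_side (next_side c), next_side (next_side (next_side c))]"
proof -
  obtain q i where "c = (q, i)" "i < 4" using assms unfolding sides_def by blast
  then show "next_side (next_side (next_side (next_side c))) = c"
    "distinct [c, next_side c, next_side (next_side c), next_side (next_side (next_side c))]"
    by (cases rule: less_4_cases[OF \<open>i < 4\<close>]; simp add: next_side_def)+
qed

lemma same_square_cases:
  assumes "c \<in> sides S" "d \<in> sides S" "fst d = fst c"
  obtains "d = c" | "d = next_side c" | "d = next_side (next_side c)"
    | "d = next_side (next_side (next_side c))"
proof -
  have "snd d = snd c \<or> snd d = (snd c + 1) mod 4 \<or> snd d = ((snd c + 1) mod 4 + 1) mod 4 \<or>
      snd d = (((snd c + 1) mod 4 + 1) mod 4 + 1) mod 4"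
    by (cases rule: less_4_cases[OF side_lt_4[OF assms(1)]];
        cases rule: less_4_cases[OF side_lt_4[OF assms(2)]]) simp_all
  then have "d = c \<or> d = next_side c \<or> d = next_side (next_side c) \<or>
      d = next_side (next_side (next_side c))"
    using assms(3) by (simp add: next_side_def prod_eq_iff)
  then show ?thesis using that by blast
qed

lemma glue_mate: "(s, t) \<in> glue S \<Longrightarrow> mate S s = t"
  unfolding mate_def using glue_unique by blast

lemma mate_glue: "s \<in> Domain (glue S) \<Longrightarrow> (s, mate S s) \<in> glue S"
  using glue_mate by blast

lemma mate_mate: "s \<in> Domain (glue S) \<Longrightarrow> mate S (mate S s) = s"
  using glue_mate glue_sym mate_glue by blast

lemma mate_in_Domain: "s \<in> Domain (glue S) \<Longrightarrow> mate S s \<in> Domain (glue S)"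
  using glue_sym mate_glue by blast

lemma Domain_glue_sides: "Domain (glue S) \<subseteq> sides S"
  using glue_in_sides by blast

lemma paste_glue:
  assumes "((q, i), (r, j)) \<in> glue S" "t \<in> {0..1}"
  shows "paste S (q, side_point i t) = paste S (r, side_point j (1 - t))"
  unfolding paste_eq_iff[OF sym_glue] using assms unfolding pasting_def by blast

lemma vert_glue:
  assumes "(s, t) \<in> glue S"
  shows "vert s = vert (next_side t)" "vert (next_side s) = vert t"
proof -
  have *: "vert s = vert (next_side t)" if "(s, t) \<in> glue S" for s t
  proof -
    have "snd t < 4" using that glue_in_sides side_lt_4 by blast
    then show ?thesis
      using paste_glue[of "fst s" "snd s" "fst t" "snd t" 0] that
      by (simp add: vertex_of_def next_side_def side_point_1')
  qed
  show "vert s = vert (next_side t)" "vert (next_side s) = vert t"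
    using *[OF assms] *[OF glue_sym[OF assms]] by auto
qed

text \<open>
  Corners are pasted to corners only, so the class of a corner is exhausted by
  turning from one square to the next one around the vertex, in both senses.
\<close>

lemma paste_corner_induct:
  assumes eq: "vert c = paste S (r, z)" and "c \<in> sides S" and "P c"
    and step: "\<And>s t. (s, t) \<in> glue S \<Longrightarrow> P s \<Longrightarrow> P (next_side t)"
              "\<And>s t. (s, t) \<in> glue S \<Longrightarrow> P (next_side s) \<Longrightarrow> P t"
  shows "\<exists>k<4. z = corner k \<and> P (r, k) \<and> r \<in> squares S"
proof -
  define Q where "Q = (\<lambda>(r, z). \<exists>k<4. z = corner k \<and> P (r, k) \<and> r \<in> squares S)"
  have "Q (r, z)"
  proof (rule paste_invariant[OF sym_glue eq[unfolded vertex_of_def]])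
    show "Q (fst c, corner (snd c))"
      using assms side_lt_4[of c] fst_side[of c] unfolding Q_def by auto
    fix q i r j t
    assume g: "((q, i), (r, j)) \<in> glue S" and t: "t \<in> {0..1::real}" and "Q (q, side_point i t)"
    then obtain k where k: "k < 4" "side_point i t = corner k" "P (q, k)"
      unfolding Q_def by auto
    have ij: "i < 4" "j < 4" "r \<in> squares S" using glue_in_sides[OF g] by (auto simp: sides_def)
    consider "t = 0" "k = i" | "t = 1" "k = (i + 1) mod 4"
      using side_point_eq_corner_iff[of i k t] ij k t by blast
    then show "Q (r, side_point j (1 - t))"
    proof cases
      case 1
      then have "P (next_side (r, j))" using step(1)[OF g] k by simp
      then show ?thesis using 1 ij by (auto simp: Q_def next_side_def side_point_1' intro!: exI[of _ "(j+1) mod 4"])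
    next
      case 2
      then have "P (next_side (q, i))" using k by (simp add: next_side_def)
      then have "P (r, j)" using step(2)[OF g] by simp
      then show ?thesis using 2 ij by (auto simp: Q_def)
    qed
  qed
  then show ?thesis by (simp add: Q_def)
qed

lemma corner_inj: "corner k = corner l \<Longrightarrow> k < 4 \<Longrightarrow> l < 4 \<Longrightarrow> k = l"
  using side_point_eq_corner_iff[of k l 0] by auto

lemma vert_induct [consumes 3, case_names base forward backward]:
  assumes eq: "vert c = vert d" and "c \<in> sides S" "d \<in> sides S" and "P c"
    and "\<And>s t. (s, t) \<in> glue S \<Longrightarrow> P s \<Longrightarrow> P (next_side t)"
        "\<And>s t. (s, t) \<in> glue S \<Longrightarrow> P (next_side s) \<Longrightarrow> P t"
  shows "P d"
proof -
  obtain k where "k < 4" "corner (snd d) = corner k" "P (fst d, k)"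
    using paste_corner_induct[of c "fst d" "corner (snd d)" P] assms unfolding vertex_of_def by blast
  then show ?thesis
    using corner_inj[of "snd d" k] side_lt_4[OF assms(3)] by (metis prod.collapse)
qed

lemma unglued_point_in_boundary:
  assumes "c \<in> sides S" "c \<notin> Domain (glue S)" "t \<in> {0..1}"
  shows "paste S (fst c, side_point (snd c) t) \<in> surface_boundary S"
proof -
  obtain q i where c: "c = (q, i)" by fastforce
  have "(q, i) \<in> sides S - Domain (glue S)" using assms c by simp
  then show ?thesis unfolding surface_boundary_def c fst_conv snd_conv using assms(3) by blast
qed

text \<open>
  A boundary point is given by a parameter on an unpasted side; at a vertex this parameter must be one
  of the ends, and then the vertex is the start or the end of the side.
\<close>

lemma vert_in_boundary_iff:
  assumes "c \<in> sides S"
  shows "vert c \<in> surface_boundary S \<longleftrightarrow>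
    (\<exists>d \<in> sides S. vert d = vert c \<and> (d \<notin> Domain (glue S) \<or> prev_side d \<notin> Domain (glue S)))"
proof
  assume "vert c \<in> surface_boundary S"
  then obtain q i t where *: "vert c = paste S (q, side_point i t)" "(q, i) \<in> sides S"
    "(q, i) \<notin> Domain (glue S)" "t \<in> {0..1}"
    unfolding surface_boundary_def by blast
  obtain k where k: "k < 4" "side_point i t = corner k"
    using paste_corner_induct[OF *(1) assms, of "\<lambda>_. True"] by auto
  then have "vert (q, k) = vert c" using * by (simp add: vertex_of_def)
  moreover have "t = 0 \<and> k = i \<or> t = 1 \<and> k = (i + 1) mod 4"
    using side_point_eq_corner_iff[of i k t] k * side_lt_4 by fastforce
  moreover have "prev_side (q, (i + 1) mod 4) = (q, i)"
    using prev_next_side[OF *(2)] by (simp add: next_side_def)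
  ultimately show "\<exists>d \<in> sides S. vert d = vert c \<and> (d \<notin> Domain (glue S) \<or> prev_side d \<notin> Domain (glue S))"
    using * k by (intro bexI[of _ "(q, k)"]) (auto simp: sides_def)
next
  assume "\<exists>d \<in> sides S. vert d = vert c \<and> (d \<notin> Domain (glue S) \<or> prev_side d \<notin> Domain (glue S))"
  then obtain d where d: "d \<in> sides S" "vert d = vert c" "d \<notin> Domain (glue S) \<or> prev_side d \<notin> Domain (glue S)"
    by blast
  from d(3) show "vert c \<in> surface_boundary S"
  proof
    assume "d \<notin> Domain (glue S)"
    moreover have "vert c = paste S (fst d, side_point (snd d) 0)" using d by (simp add: vertex_of_def)
    ultimately show ?thesis using unglued_point_in_boundary[of d 0] d(1) by simp
  next
    let ?e = "prev_side d"
    assume "?e \<notin> Domain (glue S)"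
    moreover have "?e \<in> sides S" using d by (simp add: fst_side)
    moreover have "vert c = paste S (fst ?e, side_point (snd ?e) 1)"
    proof -
      have "next_side ?e = d" using d by simp
      then have "snd d = (snd ?e + 1) mod 4" by (metis next_side_def snd_conv)
      moreover have "snd ?e < 4" using \<open>?e \<in> sides S\<close> side_lt_4 by blast
      ultimately have "side_point (snd ?e) 1 = corner (snd d)" by (simp add: side_point_1')
      then show ?thesis using d(2) by (simp add: vertex_of_def)
    qed
    ultimately show ?thesis using unglued_point_in_boundary[of ?e 1] by simp
  qed
qed

end

section \<open>Continuous logarithms along paths of a simply connected space\<close>

lemma pathin_join:
  assumes "pathin X p" "pathin X p'" "p 1 = p' 0"
  shows "pathin X (\<lambda>t. if t \<le> 1/2 then p (2 * t) else p' (2 * t - 1))"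
  unfolding pathin_def
proof (rule continuous_map_cases_le)
  have p: "continuous_map (top_of_set {0..1}) X p" "continuous_map (top_of_set {0..1}) X p'"
    using assms by (auto simp: pathin_def)
  show "continuous_map (subtopology (top_of_set {0..1}) {t \<in> topspace (top_of_set {0..1}). t \<le> 1/2}) X
          (\<lambda>t. p (2 * t))"
    by (rule continuous_map_compose[OF _ p(1), unfolded o_def])
       (auto simp: subtopology_subtopology intro!: continuous_intros)
  show "continuous_map (subtopology (top_of_set {0..1}) {t \<in> topspace (top_of_set {0..1}). 1/2 \<le> t}) X
          (\<lambda>t. p' (2 * t - 1))"
    by (rule continuous_map_compose[OF _ p(2), unfolded o_def])
       (auto simp: subtopology_subtopology intro!: continuous_intros)
qed (use assms(3) in \<open>auto simp: field_simps dest: arg_cong[of _ _ p]\<close>)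

lemma pathin_reverse:
  assumes "pathin X p"
  shows "pathin X (\<lambda>t. p (1 - t))"
proof -
  have p: "continuous_map (top_of_set {0..1}) X p" using assms by (simp add: pathin_def)
  show ?thesis unfolding pathin_def
    by (rule continuous_map_compose[OF _ p, unfolded o_def]) (auto intro!: continuous_intros)
qed

lemma pathin_euclidean: "pathin euclidean g \<longleftrightarrow> continuous_on {0..1} g"
  by (simp add: pathin_def)

text \<open>
  The difference takes values in the discrete set of the multiples of \<open>2 \<pi> \<i>\<close>.
\<close>

lemma continuous_logarithms_differ_by_constant:
  fixes f g :: "'a::topological_space \<Rightarrow> complex"
  assumes "connected A" "continuous_on A f" "continuous_on A g"
    and eq: "\<And>x. x \<in> A \<Longrightarrow> exp (f x) = exp (g x)" and "x \<in> A" "y \<in> A"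
  shows "f x - g x = f y - g y"
proof -
  have "(\<lambda>x. f x - g x) constant_on A"
  proof (rule continuous_discrete_range_constant[OF assms(1)])
    show "continuous_on A (\<lambda>x. f x - g x)" using assms by (intro continuous_intros)
    fix x assume "x \<in> A"
    have "2 * pi \<le> norm ((f y - g y) - (f x - g x))" if y: "y \<in> A" "f y - g y \<noteq> f x - g x" for y
    proof -
      obtain m n :: int where "f y = g y + (of_int (2 * m) * pi) * \<i>" "f x = g x + (of_int (2 * n) * pi) * \<i>"
        using eq[OF y(1)] eq[OF \<open>x \<in> A\<close>] exp_eq by metis
      then have *: "(f y - g y) - (f x - g x) = of_int (m - n) * (2 * pi) * \<i>"
        by (simp add: algebra_simps)
      with y have "m - n \<noteq> 0" by auto
      then have "1 \<le> \<bar>real_of_int (m - n)\<bar>" by linarith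
      then have "2 * pi \<le> \<bar>real_of_int (m - n)\<bar> * (2 * pi)" by simp
      also have "\<dots> = norm ((f y - g y) - (f x - g x))"
        unfolding * by (simp add: norm_mult del: of_int_diff)
      finally show ?thesis .
    qed
    then show "\<exists>e>0. \<forall>y. y \<in> A \<and> f y - g y \<noteq> f x - g x \<longrightarrow> e \<le> norm ((f y - g y) - (f x - g x))"
      by (intro exI[of _ "2 * pi"]) auto
  qed
  then show ?thesis using assms(5,6) unfolding constant_on_def by metis
qed

text \<open>
  The homotopy from the loop to a constant loop is a map of a square; \<open>F\<close> has a continuous logarithm
  on this contractible square, whose increment along the rows is constant and vanishes in the last row.
\<close>

lemma logarithm_along_loop:
  fixes F :: "'a \<Rightarrow> complex"
  assumes X: "simply_connected_space X" and F: "continuous_map X euclidean F"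
    and nz: "\<And>x. x \<in> topspace X \<Longrightarrow> F x \<noteq> 0"
    and p: "pathin X p" "p 1 = p 0"
    and g: "continuous_on {0..1} g" "\<And>t. t \<in> {0..1} \<Longrightarrow> F (p t) = exp (g t)"
  shows "g 1 = g 0"
proof -
  let ?I = "{0..1::real}"
  have p0: "p 0 \<in> topspace X"
    using p(1) by (auto simp: pathin_def continuous_map_def)
  then have "pathin X (\<lambda>_. p 0)" by (simp add: pathin_def)
  with X p obtain h where
    h: "continuous_map (prod_topology (top_of_set ?I) (top_of_set ?I)) X h"
    and h0: "\<And>x. h (0, x) = p x" and h1: "\<And>x. h (1, x) = p 0"
    and hl: "\<And>t. t \<in> ?I \<Longrightarrow> h (t, 1) = h (t, 0)"
    unfolding simply_connected_space_def homotopic_with_def by blast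
  have "prod_topology (top_of_set ?I) (top_of_set ?I) = top_of_set (?I \<times> ?I)"
    by (simp add: subtopology_Times)
  then have h: "continuous_map (top_of_set (?I \<times> ?I)) X h" using h by simp
  have cont: "continuous_on (?I \<times> ?I) (F \<circ> h)"
    using continuous_map_compose[OF h F] by simp
  have "(F \<circ> h) z \<noteq> 0" if "z \<in> ?I \<times> ?I" for z
    using continuous_map_image_subset_topspace[OF h] that nz by auto
  then obtain G where G: "continuous_on (?I \<times> ?I) G" "\<And>z. z \<in> ?I \<times> ?I \<Longrightarrow> (F \<circ> h) z = exp (G z)"
    using continuous_logarithm_on_contractible[OF cont] convex_imp_contractible[of "?I \<times> ?I"]
    by (metis convex_Times convex_real_interval(5))
  have row: "continuous_on ?I (\<lambda>x. G (t, x))" if "t \<in> ?I" for t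
    by (rule continuous_on_compose2[OF G(1)]) (use that in \<open>auto intro!: continuous_intros\<close>)
  have col: "continuous_on ?I (\<lambda>t. G (t, x))" if "x \<in> ?I" for x
    by (rule continuous_on_compose2[OF G(1)]) (use that in \<open>auto intro!: continuous_intros\<close>)
  have Gexp: "exp (G (t, x)) = F (h (t, x))" if "t \<in> ?I" "x \<in> ?I" for t x
    using G(2)[of "(t, x)"] that by simp
  have "g 1 - G (0, 1) = g 0 - G (0, 0)"
    by (rule continuous_logarithms_differ_by_constant[of ?I g "\<lambda>x. G (0, x)"])
       (use g row h0 Gexp in auto)
  moreover have "G (0, 1) - G (0, 0) = G (1, 1) - G (1, 0)"
    by (rule continuous_logarithms_differ_by_constant[of ?I "\<lambda>t. G (t, 1)" "\<lambda>t. G (t, 0)"])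
       (use col Gexp hl in auto)
  moreover have "G (1, 1) - G (1, 0) = G (1, 0) - G (1, 0)"
    by (rule continuous_logarithms_differ_by_constant[of ?I "\<lambda>x. G (1, x)" "\<lambda>x. G (1, 0)"])
       (use row h1 Gexp in auto)
  ultimately show ?thesis by (simp add: algebra_simps)
qed

text \<open>
  The value \<open>a\<close> of a logarithm of \<open>F\<close> at \<open>x\<close> is continued along some path to the value \<open>b\<close> at \<open>y\<close>.
\<close>

definition continues_logarithm ::
  "'a topology \<Rightarrow> ('a \<Rightarrow> complex) \<Rightarrow> 'a \<times> complex \<Rightarrow> 'a \<times> complex \<Rightarrow> bool" where
  "continues_logarithm X F = (\<lambda>(x, a) (y, b). \<exists>p g. pathin X p \<and> p 0 = x \<and> p 1 = y \<and>
     continuous_on {0..1} g \<and> g 0 = a \<and> g 1 = b \<and> (\<forall>t\<in>{0..1}. F (p t) = exp (g t)))"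

lemma continues_logarithm_trans:
  assumes "continues_logarithm X F (x, a) (y, b)" "continues_logarithm X F (y, b) (z, c)"
  shows "continues_logarithm X F (x, a) (z, c)"
proof -
  obtain p g where 1: "pathin X p" "p 0 = x" "p 1 = y" "continuous_on {0..1} g" "g 0 = a" "g 1 = b"
    "\<And>t. t\<in>{0..1} \<Longrightarrow> F (p t) = exp (g t)"
    using assms(1) by (auto simp: continues_logarithm_def)
  obtain p' g' where 2: "pathin X p'" "p' 0 = y" "p' 1 = z" "continuous_on {0..1} g'" "g' 0 = b" "g' 1 = c"
    "\<And>t. t\<in>{0..1} \<Longrightarrow> F (p' t) = exp (g' t)"
    using assms(2) by (auto simp: continues_logarithm_def)
  show ?thesis unfolding continues_logarithm_def prod.case
  proof (intro exI conjI)
    show "pathin X (\<lambda>t. if t \<le> 1/2 then p (2 * t) else p' (2 * t - 1))"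
      using 1 2 by (intro pathin_join) auto
    show "continuous_on {0..1} (\<lambda>t. if t \<le> 1/2 then g (2 * t) else g' (2 * t - 1))"
      unfolding pathin_euclidean[symmetric]
      using 1 2 by (intro pathin_join) (auto simp: pathin_euclidean)
    show "\<forall>t\<in>{0..1}. F (if t \<le> 1/2 then p (2 * t) else p' (2 * t - 1)) =
        exp (if t \<le> 1/2 then g (2 * t) else g' (2 * t - 1))"
    proof
      fix t :: real assume "t \<in> {0..1}"
      then show "F (if t \<le> 1/2 then p (2 * t) else p' (2 * t - 1)) =
          exp (if t \<le> 1/2 then g (2 * t) else g' (2 * t - 1))"
        using 1(7)[of "2 * t"] 2(7)[of "2 * t - 1"] by (cases "t \<le> 1/2") simp_all
    qed
  qed (simp_all add: 1 2)
qed

text \<open>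
  Going forth along one path and back along the other one gives a loop.
\<close>

lemma continues_logarithm_unique:
  assumes X: "simply_connected_space X" and F: "continuous_map X euclidean F"
    and nz: "\<And>x. x \<in> topspace X \<Longrightarrow> F x \<noteq> 0"
    and 1: "continues_logarithm X F (x, a) (y, b)" and 2: "continues_logarithm X F (x, a) (y, c)"
  shows "b = c"
proof -
  obtain p g where g: "pathin X p" "p 0 = x" "p 1 = y" "continuous_on {0..1} g" "g 0 = a" "g 1 = c"
    "\<And>t. t\<in>{0..1} \<Longrightarrow> F (p t) = exp (g t)"
    using 2 by (auto simp: continues_logarithm_def)
  obtain p' g' where g': "p' (1::real) = y" "g' (1::real) = b" "F (p' 1) = exp (g' 1)"
    using 1 unfolding continues_logarithm_def by (auto dest: bspec[of _ _ 1])
  have bc: "exp b = exp c" using g(3,6) g(7)[of 1] g' by simp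
  have rev: "continues_logarithm X F (y, b) (x, a + (b - c))"
    unfolding continues_logarithm_def prod.case
  proof (intro exI conjI ballI)
    show "pathin X (\<lambda>t. p (1 - t))" using g(1) by (rule pathin_reverse)
    show "continuous_on {0..1} (\<lambda>t. g (1 - t) + (b - c))"
    proof -
      have "continuous_on {0..1} (\<lambda>t. g (1 - t))"
        by (rule continuous_on_compose2[OF g(4)]) (auto intro!: continuous_intros)
      then show ?thesis by (intro continuous_intros)
    qed
    show "F (p (1 - t)) = exp (g (1 - t) + (b - c))" if "t \<in> {0..1}" for t
      using g(7)[of "1 - t"] that bc by (simp add: exp_add exp_diff)
  qed (simp_all add: g)
  obtain q h where "pathin X q" "q 0 = x" "q 1 = x" "continuous_on {0..1} h" "h 0 = a" "h 1 = a + (b - c)"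
    "\<And>t. t\<in>{0..1} \<Longrightarrow> F (q t) = exp (h t)"
    using continues_logarithm_trans[OF 1 rev] by (auto simp: continues_logarithm_def)
  then show ?thesis using logarithm_along_loop[OF X F nz, of q h] by simp
qed

lemma continues_logarithm_exists:
  assumes F: "continuous_map X euclidean F" and nz: "\<And>x. x \<in> topspace X \<Longrightarrow> F x \<noteq> 0"
    and p: "pathin X p" "p 0 = x" "p 1 = y" and a: "F x = exp a"
  shows "\<exists>b. continues_logarithm X F (x, a) (y, b)"
proof -
  have pc: "continuous_map (top_of_set {0..1}) X p" using p by (simp add: pathin_def)
  have c: "continuous_on {0..1} (F \<circ> p)" using continuous_map_compose[OF pc F] by simp
  have "(F \<circ> p) t \<noteq> 0" if "t \<in> {0..1}" for t
    using continuous_map_image_subset_topspace[OF pc] that nz by (auto simp: image_subset_iff)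
  then obtain g where g: "continuous_on {0..1} g" "\<And>t. t \<in> {0..1} \<Longrightarrow> (F \<circ> p) t = exp (g t)"
    using continuous_logarithm_on_contractible[OF c] convex_imp_contractible[of "{0..1::real}"]
    by (metis convex_real_interval(5))
  have e: "exp (g 0) = exp a" using g(2)[of 0] p a by simp
  have "continues_logarithm X F (x, a) (y, g 1 + (a - g 0))"
    unfolding continues_logarithm_def prod.case
    by (intro exI[of _ p] exI[of _ "\<lambda>t. g t + (a - g 0)"] conjI ballI)
       (use p g e in \<open>auto simp: exp_add exp_diff intro!: continuous_intros\<close>)
  then show ?thesis ..
qed

text \<open>
  A free homotopy between two constant loops contains a path between their base points.
\<close>

lemma simply_connected_imp_path_connected_space:
  assumes "simply_connected_space X"
  shows "path_connected_space X"
  unfolding path_connected_space_def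
proof (intro ballI)
  fix x y assume xy: "x \<in> topspace X" "y \<in> topspace X"
  let ?I = "{0..1::real}"
  have "pathin X (\<lambda>_. x)" "pathin X (\<lambda>_. y)" using xy by (simp_all add: pathin_def)
  with assms have "homotopic_with (\<lambda>r. r 1 = r 0) (top_of_set ?I) X (\<lambda>_. x) (\<lambda>_. y)"
    unfolding simply_connected_space_def by blast
  then obtain h where
    h: "continuous_map (prod_topology (top_of_set ?I) (top_of_set ?I)) X h"
    and h0: "\<And>t. h (0, t) = x" and h1: "\<And>t. h (1, t) = y"
    unfolding homotopic_with_def by blast
  have "continuous_map (top_of_set ?I) X (\<lambda>t. h (t, 0))"
    by (rule continuous_map_compose[OF _ h, unfolded o_def])
       (auto intro!: continuous_map_pairedI continuous_intros)
  then show "\<exists>g. pathin X g \<and> g 0 = x \<and> g 1 = y" using h0 h1 unfolding pathin_def by blast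
qed

section \<open>Simple connectivity and integral jumps\<close>

definition bilinear_interpolation :: "(nat \<Rightarrow> real) \<Rightarrow> complex \<Rightarrow> real" where
  "bilinear_interpolation a z =
     (1/2 - Re z) * (1/2 - Im z) * a 0 + (1/2 + Re z) * (1/2 - Im z) * a 1 +
     (1/2 + Re z) * (1/2 + Im z) * a 2 + (1/2 - Re z) * (1/2 + Im z) * a 3"

text \<open>
  On each side the interpolation is affine, so interpolations on two pasted squares differ by a constant
  along the common side as soon as they do so at its ends.
\<close>

lemma bilinear_interpolation_side:
  assumes "i < 4"
  shows "bilinear_interpolation a (side_point i t) = (1 - t) * a i + t * a ((i + 1) mod 4)"
  using assms
  by (cases rule: less_4_cases)
     (simp_all add: bilinear_interpolation_def side_point_explicit numeral_2_eq_2[symmetric])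

lemma continuous_on_bilinear_interpolation [continuous_intros]:
  "continuous_on A f \<Longrightarrow> continuous_on A (\<lambda>x. bilinear_interpolation a (f x))"
  unfolding bilinear_interpolation_def by (intro continuous_intros)

lemma openin_pieces_Sigma:
  assumes "\<And>q. q \<in> squares S \<Longrightarrow> openin (top_of_set unit_square) (U q)"
  shows "openin (pieces S) (Sigma (squares S) U)"
proof -
  have "Sigma (squares S) U = (\<Union>q \<in> squares S. {q} \<times> U q)" by auto
  moreover have "openin (pieces S) ({q} \<times> U q)" if "q \<in> squares S" for q
    using that assms by (simp add: pieces_def openin_prod_Times_iff)
  ultimately show ?thesis by auto
qed

lemma topspace_pieces: "topspace (pieces S) = squares S \<times> unit_square"
  by (simp add: pieces_def)

lemma closedin_pieces_Sigma:
  assumes "\<And>q. q \<in> squares S \<Longrightarrow> closed (K q) \<and> K q \<subseteq> unit_square"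
  shows "closedin (pieces S) (Sigma (squares S) K)"
proof -
  have "openin (pieces S) (Sigma (squares S) (\<lambda>q. unit_square - K q))"
    by (intro openin_pieces_Sigma) (use assms in \<open>auto simp: openin_open intro!: exI[of _ "- K _"]\<close>)
  moreover have "topspace (pieces S) - Sigma (squares S) K = Sigma (squares S) (\<lambda>q. unit_square - K q)"
    by (auto simp: topspace_pieces)
  ultimately show ?thesis using assms unfolding closedin_def by (auto simp: topspace_pieces)
qed

lemma continuous_map_pieces:
  fixes f :: "'s \<times> complex \<Rightarrow> 'b::topological_space"
  assumes "\<And>q. q \<in> squares S \<Longrightarrow> continuous_on unit_square (\<lambda>z. f (q, z))"
  shows "continuous_map (pieces S) euclidean f"
  unfolding continuous_map
proof (intro conjI allI impI)
  fix U :: "'b set" assume U: "openin euclidean U"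
  have "{x \<in> topspace (pieces S). f x \<in> U} = Sigma (squares S) (\<lambda>q. unit_square \<inter> (\<lambda>z. f (q, z)) -` U)"
    by (auto simp: topspace_pieces)
  moreover have "openin (top_of_set unit_square) (unit_square \<inter> (\<lambda>z. f (q, z)) -` U)" if "q \<in> squares S" for q
    using continuous_openin_preimage_gen[OF assms[OF that]] U by simp
  ultimately show "openin (pieces S) {x \<in> topspace (pieces S). f x \<in> U}"
    using openin_pieces_Sigma[of S "\<lambda>q. unit_square \<inter> (\<lambda>z. f (q, z)) -` U"] by simp
qed auto

lemma unit_square_convex: "convex unit_square" and unit_square_closed: "closed unit_square"
proof -
  have eq: "unit_square = {z. Re z \<ge> -1/2} \<inter> {z. Re z \<le> 1/2} \<inter> {z. Im z \<ge> -1/2} \<inter> {z. Im z \<le> 1/2}"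
    by (auto simp: unit_square_def abs_le_iff)
  show "convex unit_square" unfolding eq
    by (intro convex_Int convex_halfspace_Re_ge convex_halfspace_Re_le convex_halfspace_Im_ge
        convex_halfspace_Im_le)
  show "closed unit_square" unfolding eq
    by (intro closed_Int closed_halfspace_Re_ge closed_halfspace_Re_le
        closed_halfspace_Im_ge closed_halfspace_Im_le)
qed

lemma pathin_paste:
  assumes "q \<in> squares S" "continuous_on {0..1} w" "\<And>t. t \<in> {0..1} \<Longrightarrow> w t \<in> unit_square"
  shows "pathin (surface S) (\<lambda>t. paste S (q, w t))"
proof -
  have "continuous_map (top_of_set {0..1}) (pieces S) (\<lambda>t. (q, w t))"
    unfolding pieces_def using assms
    by (intro continuous_map_pairedI) (auto simp: continuous_map_in_subtopology)
  then show ?thesis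
    unfolding pathin_def
    using continuous_map_compose[OF _ quotient_imp_continuous_map[OF quotient_map_paste[of S]]]
    by (auto simp: o_def)
qed

context tiled_surface
begin

text \<open>
  The only use of simple connectivity besides connectedness. The interpolation of \<open>a\<close> is well
  defined on the surface modulo integers, so \<open>exp (2 \<pi> \<i> a)\<close> is a continuous map \<open>F\<close> to the circle.
  Continuing a logarithm of \<open>F\<close> from a base point gives a function on the surface that
  differs from \<open>2 \<pi> \<i> a\<close> by a constant \<open>2 \<pi> \<i> n q\<close> on every square \<open>q\<close>.
\<close>

lemma integral_jumps_exact:
  fixes a :: "'s side \<Rightarrow> int"
  assumes sc: "simply_connected_space (surface S)"
    and jump: "\<And>s t. (s, t) \<in> glue S \<Longrightarrow> a s - a (next_side t) = a (next_side s) - a t"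
  shows "\<exists>n :: 's \<Rightarrow> int. \<forall>(s, t) \<in> glue S. a s + n (fst s) = a (next_side t) + n (fst t)"
proof (cases "squares S = {}")
  case True
  then have "glue S = {}" using glue_in_sides by (fastforce simp: sides_def)
  then show ?thesis by simp
next
  case False
  then obtain q0 where q0: "q0 \<in> squares S" by blast
  define \<theta> where "\<theta> q = bilinear_interpolation (\<lambda>i. real_of_int (a (q, i)))" for q
  define c where "c = 2 * of_real pi * \<i>"
  define L where "L q z n = c * of_real (\<theta> q z + real_of_int n)" for q z n
  define F0 where "F0 = (\<lambda>(q, z). exp (L q z 0))"
  have exp_c: "exp (c * (x + of_int n)) = exp (c * x)" for x n
    using exp_integer_2pi[of "of_int n"] by (simp add: c_def exp_add algebra_simps)
  have L_exp: "exp (L q z n) = F0 (q, z)" for q z n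
    unfolding L_def F0_def using exp_c by simp
  have side: "\<theta> q (side_point i t) + a (r, (j + 1) mod 4) = \<theta> r (side_point j (1 - t)) + a (q, i)"
    if g: "((q, i), (r, j)) \<in> glue S" for q i r j t
  proof -
    have ij: "i < 4" "j < 4" using glue_in_sides[OF g] by (auto simp: sides_def)
    have "real_of_int (a (q, i) - a (r, (j + 1) mod 4)) = real_of_int (a (q, (i + 1) mod 4) - a (r, j))"
      using jump[OF g] by (simp add: next_side_def)
    then have "real_of_int (a (q, (i + 1) mod 4)) = a (q, i) - a (r, (j + 1) mod 4) + a (r, j)" by simp
    then show ?thesis using ij
      by (simp add: \<theta>_def bilinear_interpolation_side) (simp add: algebra_simps)
  qed
  have F0_paste: "F0 x = F0 y" if "paste S x = paste S y" for x y
  proof (rule paste_invariant[OF sym_glue that, of "\<lambda>y. F0 x = F0 y"])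
    fix q i r j t
    assume g: "((q, i), (r, j)) \<in> glue S" and "F0 x = F0 (q, side_point i t)"
    moreover have "\<theta> q (side_point i t) = \<theta> r (side_point j (1 - t)) + of_int (a (q, i) - a (r, (j + 1) mod 4))"
      using side[OF g, of t] by simp
    then have "L q (side_point i t) 0 = L r (side_point j (1 - t)) (a (q, i) - a (r, (j + 1) mod 4))"
      unfolding L_def by simp
    then have "F0 (q, side_point i t) = F0 (r, side_point j (1 - t))"
      using L_exp by metis
    ultimately show "F0 x = F0 (r, side_point j (1 - t))" by simp
  qed simp
  have "continuous_map (pieces S) euclidean F0"
    by (rule continuous_map_pieces) (auto simp: F0_def L_def \<theta>_def intro!: continuous_intros)
  then obtain F where F: "continuous_map (surface S) euclidean F"
    "\<And>x. x \<in> topspace (pieces S) \<Longrightarrow> F (paste S x) = F0 x"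
    using quotient_map_lift_exists[OF quotient_map_paste[of S], of euclidean F0] F0_paste by metis
  have F_nz: "F x \<noteq> 0" if x: "x \<in> topspace (surface S)" for x
  proof -
    obtain y where "y \<in> topspace (pieces S)" "x = paste S y" using x unfolding topspace_surface by blast
    then show ?thesis using F(2) by (cases y) (simp add: F0_def)
  qed
  define lift where "lift = continues_logarithm (surface S) F (paste S (q0, 0), L q0 0 0)"
  have zero: "0 \<in> unit_square" by (simp add: unit_square_def)
  have FL: "F (paste S (q, z)) = exp (L q z n)" if "q \<in> squares S" "z \<in> unit_square" for q z n
    using F(2)[of "(q, z)"] L_exp that by (simp add: topspace_pieces)
  have centre: "\<exists>n. lift (paste S (q, 0), L q 0 n)" if q: "q \<in> squares S" for q
  proof -
    have "paste S (q, 0) \<in> topspace (surface S)" "paste S (q0, 0) \<in> topspace (surface S)"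
      using q q0 zero by (auto simp: topspace_surface topspace_pieces)
    then obtain p where "pathin (surface S) p" "p 0 = paste S (q0, 0)" "p 1 = paste S (q, 0)"
      using simply_connected_imp_path_connected_space[OF sc] unfolding path_connected_space_def by blast
    then obtain b where b: "lift (paste S (q, 0), b)"
      using continues_logarithm_exists[OF F(1) F_nz, of p _ _ "L q0 0 0"] FL[OF q0 zero, of 0]
      unfolding lift_def by blast
    then have "exp b = F (paste S (q, 0))"
      unfolding lift_def continues_logarithm_def by (auto dest: bspec[of _ _ 1])
    then have "exp b = exp (L q 0 0)" using FL[OF q zero] by simp
    then obtain n :: int where "b = L q 0 0 + (of_int (2 * n) * pi) * \<i>" using exp_eq by blast
    then have "b = L q 0 n" by (simp add: L_def c_def algebra_simps)
    with b show ?thesis by blast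
  qed
  then obtain n where n: "\<And>q. q \<in> squares S \<Longrightarrow> lift (paste S (q, 0), L q 0 (n q))" by metis
  have ext: "lift (paste S (q, z), L q z (n q))" if q: "q \<in> squares S" and z: "z \<in> unit_square" for q z
  proof -
    have tz: "of_real t * z \<in> unit_square" if "t \<in> {0..1}" for t
      using convexD_alt[OF unit_square_convex zero z, of t] that by (simp add: scaleR_conv_of_real)
    have "continues_logarithm (surface S) F (paste S (q, 0), L q 0 (n q)) (paste S (q, z), L q z (n q))"
      unfolding continues_logarithm_def prod.case
    proof (intro exI conjI ballI)
      show "pathin (surface S) (\<lambda>t. paste S (q, of_real t * z))"
        using q tz by (intro pathin_paste) (auto intro!: continuous_intros)
      show "continuous_on {0..1} (\<lambda>t. L q (of_real t * z) (n q))"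
        unfolding L_def \<theta>_def by (intro continuous_intros)
      show "F (paste S (q, of_real t * z)) = exp (L q (of_real t * z) (n q))" if "t \<in> {0..1}" for t
        using FL[OF q tz[OF that]] .
    qed auto
    then show ?thesis using continues_logarithm_trans n[OF q] unfolding lift_def by metis
  qed
  have "a s + n (fst s) = a (next_side t) + n (fst t)" if g: "(s, t) \<in> glue S" for s t
  proof -
    obtain q i r j where st: "s = (q, i)" "t = (r, j)" by fastforce
    have *: "q \<in> squares S" "r \<in> squares S" "i < 4" "j < 4"
      using glue_in_sides[OF g] st by (auto simp: sides_def)
    have g': "((q, i), (r, j)) \<in> glue S" using g st by simp
    have "paste S (q, side_point i 0) = paste S (r, side_point j (1 - 0))"
      by (rule paste_glue[OF g']) simp
    moreover have "lift (paste S (q, side_point i 0), L q (side_point i 0) (n q))"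
      "lift (paste S (r, side_point j (1 - 0)), L r (side_point j (1 - 0)) (n r))"
      using * by (auto intro!: ext side_point_in_unit_square)
    ultimately have "L q (side_point i 0) (n q) = L r (side_point j (1 - 0)) (n r)"
      using continues_logarithm_unique[OF sc F(1) F_nz] unfolding lift_def by metis
    then have "c * complex_of_real (\<theta> q (side_point i 0) + n q) = c * complex_of_real (\<theta> r (side_point j (1 - 0)) + n r)"
      unfolding L_def .
    then have "\<theta> q (side_point i 0) + n q = \<theta> r (side_point j (1 - 0)) + n r"
      by (simp only: mult_cancel_left of_real_eq_iff) (simp add: c_def)
    then have "real_of_int (a s + n q) = real_of_int (a (next_side t) + n r)"
      using side[OF g', of 0] st by (simp add: next_side_def)
    then show ?thesis using st by (simp only: of_int_eq_iff) simp
  qed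
  then show ?thesis by blast
qed

end

section \<open>Connectedness\<close>

definition turn :: "'s square_complex \<Rightarrow> 's side \<Rightarrow> 's side" where
  "turn S c = mate S (prev_side c)"

context tiled_surface
begin

text \<open>
  A set of squares that is closed under pasting and its complement both form open subsets of the surface.
\<close>

lemma squares_induct [consumes 3, case_names base step]:
  assumes sc: "simply_connected_space (surface S)" and q: "q \<in> squares S" and r: "r \<in> squares S"
    and "P q" and step: "\<And>s t. (s, t) \<in> glue S \<Longrightarrow> P (fst s) \<Longrightarrow> P (fst t)"
  shows "P r"
proof (rule ccontr)
  assume "\<not> P r"
  define W where "W b = paste S ` ({q \<in> squares S. P q = b} \<times> unit_square)" for b
  have P_iff: "P (fst s) \<longleftrightarrow> P (fst t)" if "(s, t) \<in> glue S" for s t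
    using step that glue_sym by blast
  have same: "P (fst x) = P (fst y)" if "paste S x = paste S y" for x y
    by (rule paste_invariant[OF sym_glue that]) (use P_iff in auto)
  have W_iff: "paste S x \<in> W b \<longleftrightarrow> P (fst x) = b" if x: "x \<in> topspace (pieces S)" for x b
  proof
    assume "paste S x \<in> W b"
    then obtain y where "paste S x = paste S y" "P (fst y) = b" unfolding W_def by auto
    then show "P (fst x) = b" using same[of x y] by simp
  next
    assume "P (fst x) = b"
    then have "x \<in> {q \<in> squares S. P q = b} \<times> unit_square" using x by (cases x) (simp add: topspace_pieces)
    then show "paste S x \<in> W b" unfolding W_def by (rule imageI)
  qed
  have openW: "openin (surface S) (W b)" for b
  proof -
    have "{x \<in> topspace (pieces S). paste S x \<in> W b} = {x \<in> topspace (pieces S). P (fst x) = b}"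
      using W_iff by blast
    also have "\<dots> = Sigma (squares S) (\<lambda>q. if P q = b then unit_square else {})"
      unfolding topspace_pieces by (auto split: if_splits)
    moreover have "openin (pieces S) (Sigma (squares S) (\<lambda>q. if P q = b then unit_square else {}))"
      by (rule openin_pieces_Sigma) auto
    ultimately have "openin (pieces S) {x \<in> topspace (pieces S). paste S x \<in> W b}" by simp
    moreover have "W b \<subseteq> paste S ` topspace (pieces S)" unfolding W_def topspace_pieces by blast
    ultimately show ?thesis unfolding openin_surface by blast
  qed
  have cover: "topspace (surface S) \<subseteq> W True \<union> W False"
    unfolding topspace_surface using W_iff by blast
  have disj: "W True \<inter> W False = {}"
  proof -
    have False if p: "p \<in> W True" "p \<in> W False" for p
    proof -
      obtain x where x: "x \<in> topspace (pieces S)" "p = paste S x"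
        using p(1) unfolding W_def topspace_pieces by blast
      show False using W_iff[OF x(1), of True] W_iff[OF x(1), of False] p x(2) by simp
    qed
    then show ?thesis by (metis disjoint_iff)
  qed
  have zero: "0 \<in> unit_square" by (simp add: unit_square_def)
  have "paste S (q, 0) \<in> W True" "paste S (r, 0) \<in> W False"
    using W_iff q r zero \<open>P q\<close> \<open>\<not> P r\<close> by (simp_all add: topspace_pieces)
  moreover have "connected_space (surface S)"
    using simply_connected_imp_path_connected_space[OF sc] path_connected_imp_connected_space by blast
  ultimately show False
    unfolding connected_space_def using openW cover disj by blast
qed

lemma square_corners_induct:
  assumes "c \<in> sides S" "d \<in> sides S" "fst d = fst c" "P c"
    and step: "\<And>c. c \<in> sides S \<Longrightarrow> P c \<Longrightarrow> P (next_side c)"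
  shows "P d"
proof -
  let ?n = "next_side :: 's side \<Rightarrow> 's side"
  have in_sides: "?n c \<in> sides S" "?n (?n c) \<in> sides S"
    using fst_side[OF assms(1)] by simp_all
  have 1: "P (?n c)" by (rule step[OF assms(1,4)])
  have 2: "P (?n (?n c))" by (rule step[OF in_sides(1) 1])
  have 3: "P (?n (?n (?n c)))" by (rule step[OF in_sides(2) 2])
  show ?thesis
    by (cases rule: same_square_cases[OF assms(1,2,3)]) (simp_all only: assms(4) 1 2 3)
qed

lemma vertices_induct [consumes 3, case_names base step]:
  assumes sc: "simply_connected_space (surface S)" and c: "c \<in> sides S" and d: "d \<in> sides S"
    and "P (vert c)" and step: "\<And>c. c \<in> sides S \<Longrightarrow> P (vert c) \<Longrightarrow> P (vert (next_side c))"
  shows "P (vert d)"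
proof -
  define Q where "Q q \<longleftrightarrow> (\<forall>c \<in> sides S. fst c = q \<longrightarrow> P (vert c))" for q
  have all: "Q (fst c)" if "c \<in> sides S" "P (vert c)" for c
    unfolding Q_def
  proof (intro ballI impI)
    fix d assume "d \<in> sides S" "fst d = fst c"
    then show "P (vert d)"
      using square_corners_induct[of c d "\<lambda>c. P (vert c)"] that step by blast
  qed
  have "Q (fst d)"
    using sc fst_side[OF c] fst_side[OF d]
  proof (induction rule: squares_induct)
    case base
    then show ?case using all c \<open>P (vert c)\<close> by blast
  next
    case (step s t)
    then have "P (vert s)" using glue_in_sides(1)[OF step(1)] unfolding Q_def by blast
    then have "P (vert (next_side t))" unfolding vert_glue(1)[OF step(1)] .
    then show ?case using all[of "next_side t"] glue_in_sides[OF step(1)] by (simp add: fst_side)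
  qed
  then show ?thesis using d by (simp add: Q_def)
qed

section \<open>Turning around a vertex\<close>

lemma vert_turn:
  assumes "c \<in> sides S" "prev_side c \<in> Domain (glue S)"
  shows "vert (turn S c) = vert c" "turn S c \<in> sides S" "turn S c \<in> Domain (glue S)"
  using vert_glue(2)[OF mate_glue[OF assms(2)]] glue_in_sides[OF mate_glue[OF assms(2)]]
    mate_in_Domain[OF assms(2)] assms(1) by (simp_all add: turn_def)

lemma turn_inj:
  assumes "c \<in> sides S" "prev_side c \<in> Domain (glue S)" "d \<in> sides S" "prev_side d \<in> Domain (glue S)"
    "turn S c = turn S d"
  shows "c = d"
  using assms by (metis mate_mate next_prev_side turn_def)

lemma turn_next_side: "(s, t) \<in> glue S \<Longrightarrow> turn S (next_side s) = t"
  by (metis glue_mate glue_in_sides(1) prev_next_side turn_def)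

lemma interior_corner_glued:
  assumes "c \<in> sides S" "vert c \<notin> surface_boundary S"
  shows "c \<in> Domain (glue S)" "prev_side c \<in> Domain (glue S)"
  using assms vert_in_boundary_iff[OF assms(1)] by blast+

lemma finite_corners_at: "finite (corners_at S v)"
  using finite_sides by (simp add: corners_at_eq)

text \<open>
  At a boundary vertex the corners form a chain under turning, so the prescribed differences
  can be summed up to the end of the chain.
\<close>

lemma boundary_vertex_potential:
  fixes u :: "'s side \<Rightarrow> int"
  assumes "v \<in> surface_boundary S"
  shows "\<exists>a. \<forall>c \<in> corners_at S v. prev_side c \<in> Domain (glue S) \<longrightarrow> a c - a (turn S c) = u c"
proof -
  define R where "R = {(c, turn S c) | c. c \<in> corners_at S v \<and> prev_side c \<in> Domain (glue S)}"
  have R_iff: "(c, d) \<in> R \<longleftrightarrow> c \<in> sides S \<and> vert c = v \<and> prev_side c \<in> Domain (glue S) \<and> d = turn S c" for c d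
    by (auto simp: R_def corners_at_eq simp del: split_paired_Ex)
  have acyclic: "(c, c) \<notin> R\<^sup>+" for c
  proof
    assume "(c, c) \<in> R\<^sup>+"
    then have c: "c \<in> sides S" "vert c = v" by (auto elim: converse_tranclE simp: R_iff)
    have loop: "(d, d) \<in> R\<^sup>+" if d: "d \<in> sides S" "vert d = v" for d
    proof (rule vert_induct[of c d "\<lambda>d. (d, d) \<in> R\<^sup>+"])
      show "vert c = vert d" using c d by simp
      fix s t assume g: "(s, t) \<in> glue S"
      {
        assume "(s, s) \<in> R\<^sup>+"
        then obtain x where x: "(s, x) \<in> R\<^sup>*" "(x, s) \<in> R" by (meson tranclD2)
        have "turn S (next_side t) = s" using turn_next_side[OF glue_sym[OF g]] .
        moreover have "next_side t \<in> sides S" "prev_side (next_side t) \<in> Domain (glue S)"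
          using glue_in_sides[OF g] glue_sym[OF g] by (auto simp: fst_side)
        ultimately have "x = next_side t"
          using turn_inj[of x "next_side t"] x(2) by (simp add: R_iff)
        then show "(next_side t, next_side t) \<in> R\<^sup>+" using x by auto
      }
      {
        assume "(next_side s, next_side s) \<in> R\<^sup>+"
        then obtain y where "(next_side s, y) \<in> R" "(y, next_side s) \<in> R\<^sup>*" by (meson tranclD)
        moreover from this(1) have "y = t" using turn_next_side[OF g] by (simp add: R_iff)
        ultimately show "(t, t) \<in> R\<^sup>+" by auto
      }
    qed (use c d \<open>(c, c) \<in> R\<^sup>+\<close> in auto)
    have "d \<in> Domain (glue S) \<and> prev_side d \<in> Domain (glue S)" if d: "d \<in> sides S" "vert d = v" for d
    proof
      obtain x y where "(d, x) \<in> R" "(y, d) \<in> R" using loop[OF d] by (meson tranclD tranclD2)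
      then show "d \<in> Domain (glue S)" "prev_side d \<in> Domain (glue S)"
        using vert_turn(3)[of y] by (auto simp: R_iff)
    qed
    then show False using vert_in_boundary_iff[OF c(1)] c assms by auto
  qed
  \<comment> \<open>The weight zero at the end of the chain fixes the value of the potential there.\<close>
  define u' where "u' d = (if prev_side d \<in> Domain (glue S) then u d else 0)" for d
  define a where "a c = sum u' (R\<^sup>* `` {c})" for c
  have "a c - a (turn S c) = u c" if c: "c \<in> corners_at S v" "prev_side c \<in> Domain (glue S)" for c
  proof -
    have cR: "(c, turn S c) \<in> R" using c unfolding R_def by blast
    have "R\<^sup>* `` {c} = insert c (R\<^sup>* `` {turn S c})"
    proof -
      have "(turn S c, d) \<in> R\<^sup>*" if "(c, d) \<in> R\<^sup>*" "c \<noteq> d" for d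
        using that by (metis R_iff converse_rtranclE)
      then show ?thesis using cR by (auto intro: converse_rtrancl_into_rtrancl)
    qed
    moreover have "c \<notin> R\<^sup>* `` {turn S c}"
      using acyclic[of c] cR by (auto intro: rtrancl_into_trancl2)
    moreover have "finite (R\<^sup>* `` {turn S c})"
    proof -
      have "d \<in> insert (turn S c) (sides S)" if "(turn S c, d) \<in> R\<^sup>*" for d
        using that by (cases rule: rtranclE) (simp_all add: R_iff vert_turn)
      then have "R\<^sup>* `` {turn S c} \<subseteq> insert (turn S c) (sides S)" by blast
      then show ?thesis using finite_sides finite_subset by blast
    qed
    ultimately show ?thesis using c(2) by (simp add: a_def u'_def)
  qed
  then show ?thesis by blast
qed

section \<open>Closed integer functions on the sides are exact\<close>

lemma sum_sides: "(\<Sum>c \<in> sides S. f c) = (\<Sum>q \<in> squares S. \<Sum>i<4. f (q, i))"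
  by (simp add: sides_def sum.cartesian_product)

lemma sum_sides_by_vertex:
  "(\<Sum>c \<in> sides S. f c) = (\<Sum>v \<in> surface_vertices S. \<Sum>c \<in> corners_at S v. f c)"
  unfolding corners_at_eq
  by (rule sum.group[symmetric]) (use finite_sides finite_vertices vertex_of_in_surface_vertices in auto)

text \<open>
  The hypothesis for all pasted pairs covers both ends of each side, as pasting is symmetric.
\<close>

lemma vertex_function_exists:
  assumes "\<And>s t. (s, t) \<in> glue S \<Longrightarrow> b s = b (next_side t)"
  shows "\<exists>h. \<forall>c \<in> sides S. h (vert c) = b c"
proof -
  have "b c = b d" if "vert c = vert d" "c \<in> sides S" "d \<in> sides S" for c d
    using that
  proof (induction rule: vert_induct)
    case (forward s t) then show ?case using assms by simp
  next
    case (backward s t) then show ?case using assms[OF glue_sym] by simp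
  qed simp
  then have "\<forall>c \<in> sides S. b (SOME d. d \<in> sides S \<and> vert d = vert c) = b c"
    by (metis (mono_tags, lifting) someI_ex)
  then show ?thesis by (intro exI[of _ "\<lambda>v. b (SOME d. d \<in> sides S \<and> vert d = v)"])
qed

text \<open>
  Summing \<open>w\<close> along the boundary of each square gives corner values with constant jumps across the
  sides; subtracting the jumps makes them functions of the vertex.
\<close>

lemma exact_on_vertices:
  fixes w :: "'s side \<Rightarrow> int"
  assumes sc: "simply_connected_space (surface S)"
    and anti: "\<And>s t. (s, t) \<in> glue S \<Longrightarrow> w t = - w s"
    and closed: "\<And>q. q \<in> squares S \<Longrightarrow> (\<Sum>i<4. w (q, i)) = 0"
  shows "\<exists>h. \<forall>c \<in> sides S. h (vert (next_side c)) - h (vert c) = w c"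
proof -
  define a where "a = (\<lambda>(q, i). \<Sum>k<i. w (q, k))"
  have a: "a (next_side c) - a c = w c" if cs: "c \<in> sides S" for c
  proof -
    obtain q i where qi: "c = (q, i)" "i < 4" "q \<in> squares S" using cs unfolding sides_def by blast
    then have "w (q, 0) + w (q, 1) + w (q, 2) + w (q, 3) = 0"
      using closed[of q] by (simp add: lessThan_4)
    moreover have "{..<1} = {0::nat}" "{..<2} = {0, 1::nat}" "{..<3} = {0, 1, 2::nat}" by auto
    ultimately show ?thesis using qi(1)
      by (cases rule: less_4_cases[OF qi(2)]) (simp_all add: a_def next_side_def)
  qed
  have jump: "a s - a (next_side t) = a (next_side s) - a t" if "(s, t) \<in> glue S" for s t
    using a[of s] a[of t] anti[OF that] glue_in_sides[OF that] by simp
  obtain n :: "'s \<Rightarrow> int" where n: "\<And>s t. (s, t) \<in> glue S \<Longrightarrow> a s + n (fst s) = a (next_side t) + n (fst t)"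
    using integral_jumps_exact[OF sc, of a, OF jump] by auto
  obtain h where h: "\<And>c. c \<in> sides S \<Longrightarrow> h (vert c) = a c + n (fst c)"
    using vertex_function_exists[of "\<lambda>c. a c + n (fst c)"] n by (metis fst_next_side)
  have "h (vert (next_side c)) - h (vert c) = w c" if "c \<in> sides S" for c
    using h[OF that] h[of "next_side c"] a[OF that] that by (simp add: fst_side)
  then show ?thesis by blast
qed

text \<open>
  A unit can be moved from one corner of a square to the next one without changing the sum over the
  square, hence from any vertex to any other one.
\<close>

lemma transfer_between_vertices:
  assumes sc: "simply_connected_space (surface S)"
    and x: "x \<in> surface_vertices S" and y: "y \<in> surface_vertices S"
  shows "\<exists>k :: 's side \<Rightarrow> int. (\<forall>q \<in> squares S. (\<Sum>i<4. k (q, i)) = 0) \<and>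
           (\<forall>v. (\<Sum>c \<in> corners_at S v. k c) = of_bool (v = x) - of_bool (v = y))"
proof -
  obtain cx cy where c: "cx \<in> sides S" "cy \<in> sides S" "x = vert cx" "y = vert cy"
    using x y unfolding surface_vertices_eq by blast
  show ?thesis unfolding \<open>y = vert cy\<close>
    using sc c(1,2)
  proof (induction rule: vertices_induct)
    case base
    then show ?case using c by (intro exI[of _ "\<lambda>_. 0"]) auto
  next
    case (step c)
    then obtain k :: "'s side \<Rightarrow> int" where k: "\<And>q. q \<in> squares S \<Longrightarrow> (\<Sum>i<4. k (q, i)) = 0"
      "\<And>v. (\<Sum>c \<in> corners_at S v. k c) = of_bool (v = x) - of_bool (v = vert c)" by blast
    define k' where "k' d = k d + of_bool (d = c) - of_bool (d = next_side c)" for d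
    have nc: "next_side c \<in> sides S" using step by (simp add: fst_side)
    have one: "(\<Sum>d \<in> corners_at S v. of_bool (d = e)) = (of_bool (v = vert e) :: int)"
      if "e \<in> sides S" for e v
      using that finite_corners_at[of v] by (auto simp: of_bool_def sum.delta' corners_at_eq)
    have row: "(\<Sum>i<4. of_bool ((q, i) = e)) = (of_bool (q = fst e) :: int)" if "e \<in> sides S" for e q
    proof -
      have "(\<Sum>i<4. of_bool ((q, i) = e)) = (\<Sum>i<4. if i = snd e then of_bool (q = fst e) else (0::int))"
        by (intro sum.cong) (cases e, auto)+
      then show ?thesis using side_lt_4[OF that] by simp
    qed
    have "(\<Sum>i<4. k' (q, i)) = 0" if "q \<in> squares S" for q
      using k(1)[OF that] row[OF step(1)] row[OF nc] by (simp add: k'_def sum.distrib sum_subtractf)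
    moreover have "(\<Sum>c \<in> corners_at S v. k' c) = of_bool (v = x) - of_bool (v = vert (next_side c))" for v
      using k(2)[of v] one[OF step(1)] one[OF nc] by (simp add: k'_def sum.distrib sum_subtractf)
    ultimately show ?case by blast
  qed
qed

end

locale coloured_surface = tiled_surface S for S :: "'s square_complex" +
  fixes black :: "'s \<Rightarrow> bool"
  assumes coloring: "chessboard_coloring S black"
begin

lemma glue_black: "(s, t) \<in> glue S \<Longrightarrow> black (fst t) \<longleftrightarrow> \<not> black (fst s)"
  using coloring unfolding chessboard_coloring_def by (metis prod.collapse)

definition colour_sign :: "'s \<Rightarrow> int" where
  "colour_sign q = (if black q then 1 else -1)"

lemma colour_sign_glue: "(s, t) \<in> glue S \<Longrightarrow> colour_sign (fst t) = - colour_sign (fst s)"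
  using glue_black by (auto simp: colour_sign_def)

end

locale simply_connected_surface = coloured_surface S black for S :: "'s square_complex" and black +
  assumes simply_connected: "simply_connected_space (surface S)"
    and four_squares: "interior_vertices_have_four_squares S"
begin

text \<open>
  Turning permutes the four corners at an interior vertex transitively. Since it changes the color, its
  only possible cycle lengths are two and four, and length two would leave only two corners.
\<close>

lemma interior_vertex_cycle:
  assumes c: "c \<in> sides S" "vert c = v" and v: "v \<notin> surface_boundary S"
  defines "c1 \<equiv> turn S c"
  defines "c2 \<equiv> turn S c1"
  defines "c3 \<equiv> turn S c2"
  shows "corners_at S v = {c, c1, c2, c3}" "distinct [c, c1, c2, c3]" "turn S c3 = c"
    "colour_sign (fst c1) = - colour_sign (fst c)" "colour_sign (fst c2) = colour_sign (fst c)"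
    "colour_sign (fst c3) = - colour_sign (fst c)"
proof -
  have A: "d \<in> corners_at S v \<longleftrightarrow> d \<in> sides S \<and> vert d = v" for d by (auto simp: corners_at_eq)
  have card: "card (corners_at S v) = 4"
    using four_squares c v vertex_of_in_surface_vertices
    unfolding interior_vertices_have_four_squares_def by blast
  have dom: "prev_side d \<in> Domain (glue S)" if "d \<in> corners_at S v" for d
    using interior_corner_glued(2)[of d] that v unfolding A by blast
  have turn: "turn S d \<in> corners_at S v" if "d \<in> corners_at S v" for d
    using vert_turn(1,2)[of d] dom[OF that] that unfolding A by simp
  have inj: "d = e" if "d \<in> corners_at S v" "e \<in> corners_at S v" "turn S d = turn S e" for d e
    using turn_inj[of d e] dom[OF that(1)] dom[OF that(2)] that unfolding A by blast
  have col: "colour_sign (fst (turn S d)) = - colour_sign (fst d)" if "d \<in> corners_at S v" for d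
    using colour_sign_glue[OF mate_glue[OF dom[OF that]]] by (simp add: turn_def)
  have nz: "colour_sign q \<noteq> - colour_sign q" for q by (simp add: colour_sign_def)
  have c_in: "c \<in> corners_at S v" using c A by simp
  then have in_A: "c \<in> corners_at S v" "c1 \<in> corners_at S v" "c2 \<in> corners_at S v" "c3 \<in> corners_at S v"
    unfolding c1_def c2_def c3_def by (simp_all only: turn)
  show cols: "colour_sign (fst c1) = - colour_sign (fst c)" "colour_sign (fst c2) = colour_sign (fst c)"
    "colour_sign (fst c3) = - colour_sign (fst c)"
    using col in_A by (simp_all add: c1_def c2_def c3_def)
  have "c2 \<noteq> c"
  proof
    assume "c2 = c"
    have "d \<in> {c, c1}" if "d \<in> corners_at S v" for d
    proof (rule vert_induct[of c d])
      fix s t assume g: "(s, t) \<in> glue S"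
      show "next_side t \<in> {c, c1}" if s: "s \<in> {c, c1}"
      proof -
        have "vert s = v" using s in_A A by blast
        then have "next_side t \<in> corners_at S v"
          using vert_glue(1)[OF g] glue_in_sides[OF g] A by (simp add: fst_side)
        moreover have "turn S (next_side t) = s" using turn_next_side[OF glue_sym[OF g]] .
        moreover have "s = turn S c1 \<or> s = turn S c" using s \<open>c2 = c\<close> c1_def c2_def by blast
        ultimately show ?thesis using inj in_A by blast
      qed
      show "t \<in> {c, c1}" if "next_side s \<in> {c, c1}"
        using that turn_next_side[OF g] \<open>c2 = c\<close> c1_def c2_def by auto
    qed (use that A c in auto)
    then have "corners_at S v \<subseteq> {c, c1}" by blast
    then have "card (corners_at S v) \<le> card {c, c1}" by (intro card_mono) auto
    also have "\<dots> \<le> 2" by (simp add: card_insert_if)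
    finally show False using card by simp
  qed
  moreover have "c3 \<noteq> c1" using \<open>c2 \<noteq> c\<close> inj in_A by (metis c1_def c2_def c3_def)
  ultimately show d: "distinct [c, c1, c2, c3]"
    using cols nz by auto
  have "{c, c1, c2, c3} \<subseteq> corners_at S v" using in_A by blast
  moreover have "card {c, c1, c2, c3} = 4" using d by simp
  ultimately show eq: "corners_at S v = {c, c1, c2, c3}"
    using card finite_corners_at card_subset_eq by (metis)
  have "turn S c3 \<in> {c, c1, c2, c3}" using turn in_A eq by blast
  moreover have "turn S c3 \<noteq> c1" "turn S c3 \<noteq> c3"
    using col[OF in_A(4)] cols nz by metis+
  moreover have "turn S c3 \<noteq> c2" using inj[of c3 c1] in_A \<open>c3 \<noteq> c1\<close> by (metis c2_def)
  ultimately show "turn S c3 = c" by blast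
qed

lemma interior_vertex_cases:
  assumes "v \<in> surface_vertices S" "v \<notin> surface_boundary S"
  obtains c where "c \<in> sides S" "vert c = v"
  using assms unfolding surface_vertices_eq by blast

lemma sum_corners_turn:
  assumes "v \<in> surface_vertices S" "v \<notin> surface_boundary S"
  shows "(\<Sum>c \<in> corners_at S v. f (turn S c)) = (\<Sum>c \<in> corners_at S v. f c :: int)"
proof -
  obtain c where c: "c \<in> sides S" "vert c = v" using assms interior_vertex_cases by blast
  show ?thesis using interior_vertex_cycle[OF c assms(2)] by simp
qed

lemma sum_colour_sign:
  assumes "v \<in> surface_vertices S" "v \<notin> surface_boundary S"
  shows "(\<Sum>c \<in> corners_at S v. colour_sign (fst c)) = 0"
proof -
  obtain c where c: "c \<in> sides S" "vert c = v" using assms interior_vertex_cases by blast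
  show ?thesis using interior_vertex_cycle[OF c assms(2)] by simp
qed

text \<open>
  The vertices can be treated separately. Around an interior vertex turning is cyclic, and the prescribed
  differences must add up to zero.
\<close>

lemma vertex_potential:
  fixes u :: "'s side \<Rightarrow> int"
  assumes "\<And>v. v \<in> surface_vertices S - surface_boundary S \<Longrightarrow> (\<Sum>c \<in> corners_at S v. u c) = 0"
  shows "\<exists>a. \<forall>c \<in> sides S. prev_side c \<in> Domain (glue S) \<longrightarrow> a c - a (turn S c) = u c"
proof -
  have "\<exists>a. \<forall>c \<in> corners_at S v. prev_side c \<in> Domain (glue S) \<longrightarrow> a c - a (turn S c) = u c"
    if v: "v \<in> surface_vertices S" for v
  proof (cases "v \<in> surface_boundary S")
    case True
    then show ?thesis by (rule boundary_vertex_potential)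
  next
    case False
    then obtain c where c: "c \<in> sides S" "vert c = v" using v interior_vertex_cases by blast
    note cyc = interior_vertex_cycle[OF c False]
    let ?c1 = "turn S c" let ?c2 = "turn S ?c1" let ?c3 = "turn S ?c2"
    have sum: "u c + u ?c1 + u ?c2 + u ?c3 = 0"
      using assms[of v] v False cyc(1,2) by simp
    define a where "a d = (if d = c then 0 else if d = ?c1 then - u c else
       if d = ?c2 then - u c - u ?c1 else - u c - u ?c1 - u ?c2)" for d
    show ?thesis
      by (rule exI[of _ a]) (use cyc sum in \<open>auto simp: a_def\<close>)
  qed
  then obtain A where A: "\<And>v c. v \<in> surface_vertices S \<Longrightarrow> c \<in> corners_at S v \<Longrightarrow>
      prev_side c \<in> Domain (glue S) \<Longrightarrow> A v c - A v (turn S c) = u c" by metis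
  have "A (vert c) c - A (vert (turn S c)) (turn S c) = u c"
    if "c \<in> sides S" "prev_side c \<in> Domain (glue S)" for c
    using A[of "vert c" c] vert_turn[OF that] that vertex_of_in_surface_vertices[OF that(1)]
    by (simp add: corners_at_eq)
  then show ?thesis by (intro exI[of _ "\<lambda>c. A (vert c) c"]) blast
qed

text \<open>
  The dual of \<open>exact_on_vertices\<close>: local potentials around the vertices serve as
  corner values, whose jump across a side is the prescribed difference.
\<close>

lemma exact_on_squares:
  fixes w :: "'s side \<Rightarrow> int"
  assumes anti: "\<And>s t. (s, t) \<in> glue S \<Longrightarrow> w t = - w s"
    and closed: "\<And>v. v \<in> surface_vertices S - surface_boundary S \<Longrightarrow>
                  (\<Sum>c \<in> corners_at S v. w (prev_side c)) = 0"
  shows "\<exists>n :: 's \<Rightarrow> int. \<forall>(s, t) \<in> glue S. w s = n (fst t) - n (fst s)"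
proof -
  obtain a where a: "\<And>c. c \<in> sides S \<Longrightarrow> prev_side c \<in> Domain (glue S) \<Longrightarrow>
      a c - a (turn S c) = w (prev_side c)"
    using vertex_potential[of "\<lambda>c. w (prev_side c)", OF closed] by blast
  have across: "a (next_side s) - a t = w s" if "(s, t) \<in> glue S" for s t
  proof -
    have s: "s \<in> sides S" "s \<in> Domain (glue S)" using glue_in_sides[OF that] that by auto
    then have "a (next_side s) - a (turn S (next_side s)) = w (prev_side (next_side s))"
      by (intro a) (simp_all add: fst_side)
    then show ?thesis using s turn_next_side[OF that] by simp
  qed
  have jump: "a s - a (next_side t) = a (next_side s) - a t" if "(s, t) \<in> glue S" for s t
    using across[OF that] across[OF glue_sym[OF that]] anti[OF that] by simp
  obtain n :: "'s \<Rightarrow> int" where n: "\<And>s t. (s, t) \<in> glue S \<Longrightarrow> a s + n (fst s) = a (next_side t) + n (fst t)"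
    using integral_jumps_exact[OF simply_connected, of a, OF jump] by auto
  have "w s = n (fst t) - n (fst s)" if "(s, t) \<in> glue S" for s t
    using n[OF that] across[OF that] jump[OF that] by linarith
  then show ?thesis by blast
qed

end

section \<open>The developing map\<close>

text \<open>
  The coordinates of the unit vector in the direction \<open>\<i> ^ k\<close>; directions are integers modulo 4.
\<close>

definition unit_x :: "int \<Rightarrow> int" where
  "unit_x k = (if k mod 4 = 0 then 1 else if k mod 4 = 2 then -1 else 0)"

definition unit_y :: "int \<Rightarrow> int" where
  "unit_y k = (if k mod 4 = 1 then 1 else if k mod 4 = 3 then -1 else 0)"

lemma mod_4_cases:
  fixes k :: int
  obtains "k mod 4 = 0" | "k mod 4 = 1" | "k mod 4 = 2" | "k mod 4 = 3"
proof -
  have "0 \<le> k mod 4" "k mod 4 < 4" by simp_all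
  then show ?thesis using that by linarith
qed

lemma unit_mod: "k mod 4 = l mod 4 \<Longrightarrow> unit_x k = unit_x l" "k mod 4 = l mod 4 \<Longrightarrow> unit_y k = unit_y l"
  by (simp_all add: unit_x_def unit_y_def)

lemma unit_add_2: "unit_x (k + 2) = - unit_x k" "unit_y (k + 2) = - unit_y k"
proof -
  have m: "(k + 2) mod 4 = (k mod 4 + 2) mod 4" by (simp add: mod_add_left_eq)
  show "unit_x (k + 2) = - unit_x k" "unit_y (k + 2) = - unit_y k"
    unfolding unit_x_def unit_y_def m by (cases k rule: mod_4_cases; simp)+
qed

lemma unit_eqD: "unit_x k = unit_x l \<Longrightarrow> unit_y k = unit_y l \<Longrightarrow> k mod 4 = l mod 4"
  by (cases k rule: mod_4_cases; cases l rule: mod_4_cases; simp add: unit_x_def unit_y_def)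

lemma unit_sum_1: "unit_x k \<noteq> 0 \<or> unit_y k \<noteq> 0"
  by (cases k rule: mod_4_cases; simp add: unit_x_def unit_y_def)

lemma unit_sum_2: "unit_x k + unit_x (k + 1) \<noteq> 0 \<or> unit_y k + unit_y (k + 1) \<noteq> 0"
proof -
  have m: "(k + 1) mod 4 = (k mod 4 + 1) mod 4" by (simp add: mod_add_left_eq)
  show ?thesis
    unfolding unit_x_def unit_y_def m by (cases k rule: mod_4_cases; simp)
qed

lemma sum_unit_around:
  "(\<Sum>i<4::nat. unit_x (int i + k)) = 0" "(\<Sum>i<4::nat. unit_y (int i + k)) = 0"
proof -
  have e: "k + 1 + 2 = 3 + k" "k + 2 = 2 + k" "k + 1 = 1 + k" by simp_all
  show "(\<Sum>i<4::nat. unit_x (int i + k)) = 0" "(\<Sum>i<4::nat. unit_y (int i + k)) = 0"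
    using unit_add_2[of k] unit_add_2[of "k + 1"] unfolding e by (simp_all add: lessThan_4)
qed

lemma mod_4_add: "(a + b) mod 4 = (a mod 4 + b) mod (4::int)"
  by (simp add: mod_add_left_eq)

lemma turn_direction:
  fixes a b c :: int
  assumes "a mod 4 = (b + 2) mod 4" "c mod 4 = (b + 1) mod 4"
  shows "a mod 4 = (c + 1) mod 4"
  using assms unfolding mod_4_add[of b] mod_4_add[of c] by (cases b rule: mod_4_cases) simp_all

lemma four_consecutive_mod_4:
  fixes a b c d :: int
  assumes "b mod 4 = (a + 1) mod 4" "c mod 4 = (b + 1) mod 4" "d mod 4 = (c + 1) mod 4"
  shows "a mod 4 = 0 \<or> b mod 4 = 0 \<or> c mod 4 = 0 \<or> d mod 4 = 0"
  using assms unfolding mod_4_add[of a] mod_4_add[of b] mod_4_add[of c]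
  by (cases a rule: mod_4_cases) simp_all

lemma consecutive_mod_4:
  fixes a b c :: int
  assumes "b mod 4 = (a + 1) mod 4"
  shows "b mod 4 \<noteq> a mod 4" "c mod 4 = (b + 1) mod 4 \<Longrightarrow> c mod 4 = (a + 2) mod 4"
    "c mod 4 = (b + 1) mod 4 \<Longrightarrow> c mod 4 \<noteq> a mod 4"
  using assms unfolding mod_4_add[of a] mod_4_add[of b]
  by (cases a rule: mod_4_cases; simp)+

lemma opposite_direction_next:
  fixes a b c :: int
  assumes "a mod 4 = (b + 2) mod 4" "c mod 4 = (a + 1) mod 4"
  shows "c mod 4 = (b + 1 + 2) mod 4"
  using assms unfolding mod_4_add[of b] mod_4_add[of a] add.assoc
  by (cases b rule: mod_4_cases) simp_all

context simply_connected_surface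
begin

text \<open>
  On average each corner gets the weight \<open>1/4\<close>; the point is that the weights can be chosen
  integral. Start with weight one at corner 0 of every square and transfer the excess at
  each vertex to a root. The root may be a boundary vertex. If there is none, then all vertices have four
  corners, so there are as many vertices as squares and the excess at the root vanishes as well.
\<close>

lemma corner_weights_exist:
  "\<exists>m :: 's side \<Rightarrow> int. (\<forall>q \<in> squares S. (\<Sum>i<4. m (q, i)) = 1) \<and>
     (\<forall>v \<in> surface_vertices S - surface_boundary S. (\<Sum>c \<in> corners_at S v. m c) = 1)"
proof (cases "squares S = {}")
  case True
  then show ?thesis by (auto simp: surface_vertices_eq sides_def)
next
  case False
  then obtain q0 where q0: "q0 \<in> squares S" by blast
  let ?V = "surface_vertices S"
  define m0 :: "'s side \<Rightarrow> int" where "m0 c = of_bool (snd c = 0)" for c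
  define f where "f v = 1 - (\<Sum>c \<in> corners_at S v. m0 c)" for v
  have sum_m0: "(\<Sum>c \<in> sides S. m0 c) = int (card (squares S))"
    unfolding sum_sides by (simp add: m0_def lessThan_4)
  obtain root where root: "root \<in> ?V" "root \<in> surface_boundary S \<or> (\<Sum>v \<in> ?V. f v) = 0"
  proof (cases "\<exists>v \<in> ?V. v \<in> surface_boundary S")
    case True
    then show ?thesis using that by blast
  next
    case False
    then have "card (corners_at S v) = 4" if "v \<in> ?V" for v
      using four_squares that unfolding interior_vertices_have_four_squares_def by blast
    then have "(\<Sum>c \<in> sides S. 1) = (\<Sum>v \<in> ?V. 4::int)"
      unfolding sum_sides_by_vertex by simp
    then have "4 * int (card (squares S)) = 4 * int (card ?V)"
      unfolding sum_sides by simp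
    moreover have "(\<Sum>v \<in> ?V. f v) = int (card ?V) - (\<Sum>c \<in> sides S. m0 c)"
      unfolding f_def sum_sides_by_vertex by (simp add: sum_subtractf)
    ultimately have "(\<Sum>v \<in> ?V. f v) = 0" using sum_m0 by simp
    moreover have "vert (q0, 0) \<in> ?V"
      using q0 by (intro vertex_of_in_surface_vertices) (simp add: sides_def)
    ultimately show ?thesis using that by blast
  qed
  have "\<forall>v \<in> ?V. \<exists>k :: 's side \<Rightarrow> int. (\<forall>q \<in> squares S. (\<Sum>i<4. k (q, i)) = 0) \<and>
           (\<forall>u. (\<Sum>c \<in> corners_at S u. k c) = of_bool (u = v) - of_bool (u = root))"
    using transfer_between_vertices[OF simply_connected _ root(1)] by blast
  then obtain K :: "_ \<Rightarrow> 's side \<Rightarrow> int" where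
    K: "\<And>v q. v \<in> ?V \<Longrightarrow> q \<in> squares S \<Longrightarrow> (\<Sum>i<4. K v (q, i)) = 0"
       "\<And>v u. v \<in> ?V \<Longrightarrow> (\<Sum>c \<in> corners_at S u. K v c) = of_bool (u = v) - of_bool (u = root)"
    by metis
  define m where "m c = m0 c + (\<Sum>v \<in> ?V. f v * K v c)" for c
  have "(\<Sum>i<4. m (q, i)) = 1" if "q \<in> squares S" for q
  proof -
    have "(\<Sum>i<4. \<Sum>v \<in> ?V. f v * K v (q, i)) = (\<Sum>v \<in> ?V. f v * (\<Sum>i<4. K v (q, i)))"
      by (subst sum.swap) (simp add: sum_distrib_left)
    also have "\<dots> = 0" using K(1) that by simp
    finally show ?thesis unfolding m_def sum.distrib by (simp add: m0_def lessThan_4)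
  qed
  moreover have "(\<Sum>c \<in> corners_at S u. m c) = 1" if u: "u \<in> ?V - surface_boundary S" for u
  proof -
    have "(\<Sum>c \<in> corners_at S u. \<Sum>v \<in> ?V. f v * K v c) = (\<Sum>v \<in> ?V. f v * (\<Sum>c \<in> corners_at S u. K v c))"
      by (subst sum.swap) (simp add: sum_distrib_left)
    also have "\<dots> = (\<Sum>v \<in> ?V. f v * of_bool (u = v)) - (\<Sum>v \<in> ?V. f v) * of_bool (u = root)"
      using K(2) by (simp add: right_diff_distrib sum_subtractf sum_distrib_right)
    also have "(\<Sum>v \<in> ?V. f v * of_bool (u = v)) = f u"
    proof -
      have "(\<Sum>v \<in> ?V. f v * of_bool (u = v)) = (\<Sum>v \<in> ?V. if v = u then f v else 0)"
        by (intro sum.cong) auto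
      then show ?thesis using u finite_vertices by simp
    qed
    also have "(\<Sum>v \<in> ?V. f v) * of_bool (u = root) = 0" using root u by auto
    finally show ?thesis unfolding m_def sum.distrib f_def by simp
  qed
  ultimately show ?thesis by blast
qed

text \<open>
  The direction of side \<open>i\<close> in \<open>q\<close> is to be \<open>i + \<delta> q\<close> modulo 4, and pasted sides must have opposite directions.
  Modulo 4 this prescribes the jump of \<open>\<delta>\<close>. To apply \<open>exact_on_squares\<close>, the jumps are lifted to integers that
  add up to zero around interior vertices: the side number \<open>i\<close> is lifted to an
  integer \<open>c\<close> that decreases by one from a corner to the previous side, except for a correction by \<open>4 m\<close>,
  where \<open>m\<close> are the corner weights, and the half turn between opposite directions is lifted to \<open>2\<close> when
  leaving a black square and to \<open>-2\<close> when leaving a white one.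
\<close>

lemma direction_field:
  "\<exists>\<delta> :: 's \<Rightarrow> int. \<forall>(s, t) \<in> glue S.
     (int (snd t) + \<delta> (fst t)) mod 4 = (int (snd s) + \<delta> (fst s) + 2) mod 4"
proof -
  obtain m :: "'s side \<Rightarrow> int" where m: "\<And>q. q \<in> squares S \<Longrightarrow> (\<Sum>i<4. m (q, i)) = 1"
    "\<And>v. v \<in> surface_vertices S - surface_boundary S \<Longrightarrow> (\<Sum>c \<in> corners_at S v. m c) = 1"
    using corner_weights_exist by blast
  define c where "c s = int (snd s) - 4 * (\<Sum>k \<in> {1..snd s}. m (fst s, k))" for s
  have c_prev: "c (prev_side s) - c s = 4 * m s - 1" if s: "s \<in> sides S" for s
  proof -
    obtain q i where qi: "s = (q, i)" "i < 4" "q \<in> squares S" using s unfolding sides_def by blast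
    have "m (q, 0) + m (q, 1) + m (q, 2) + m (q, 3) = 1"
      using m(1)[OF qi(3)] by (simp add: lessThan_4)
    moreover have "{1..1} = {1::nat}" "{1..2} = {1, 2::nat}" "{1..3} = {1, 2, 3::nat}" by auto
    ultimately show ?thesis using qi(1)
      by (cases rule: less_4_cases[OF qi(2)]) (simp_all add: c_def prev_side_def)
  qed
  define w where "w s = c s - c (mate S s) + 2 * colour_sign (fst s)" for s
  have w_glue: "w s = c s - c t + 2 * colour_sign (fst s)" if "(s, t) \<in> glue S" for s t
    using glue_mate[OF that] by (simp add: w_def)
  have anti: "w t = - w s" if "(s, t) \<in> glue S" for s t
    using w_glue[OF that] w_glue[OF glue_sym[OF that]] colour_sign_glue[OF that] by simp
  have closed: "(\<Sum>x \<in> corners_at S v. w (prev_side x)) = 0"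
    if v: "v \<in> surface_vertices S - surface_boundary S" for v
  proof -
    have v': "v \<in> surface_vertices S" "v \<notin> surface_boundary S" using v by auto
    have "(\<Sum>x \<in> corners_at S v. w (prev_side x)) =
        (\<Sum>x \<in> corners_at S v. c (prev_side x)) - (\<Sum>x \<in> corners_at S v. c (turn S x)) +
        2 * (\<Sum>x \<in> corners_at S v. colour_sign (fst x))"
      by (simp add: w_def turn_def sum.distrib sum_subtractf sum_distrib_left)
    also have "\<dots> = (\<Sum>x \<in> corners_at S v. c (prev_side x) - c x)"
      using sum_corners_turn[OF v'] sum_colour_sign[OF v'] by (simp add: sum_subtractf)
    also have "\<dots> = (\<Sum>x \<in> corners_at S v. 4 * m x - 1)"
      by (intro sum.cong) (simp_all add: c_prev corners_at_eq)
    also have "\<dots> = 4 * (\<Sum>x \<in> corners_at S v. m x) - int (card (corners_at S v))"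
      by (simp add: sum_subtractf sum_distrib_left)
    also have "\<dots> = 0"
      using m(2)[OF v] four_squares v unfolding interior_vertices_have_four_squares_def by simp
    finally show ?thesis .
  qed
  obtain n :: "'s \<Rightarrow> int" where n: "\<And>s t. (s, t) \<in> glue S \<Longrightarrow> w s = n (fst t) - n (fst s)"
    using exact_on_squares[of w, OF anti closed] by auto
  have "(int (snd t) + n (fst t)) mod 4 = (int (snd s) + n (fst s) + 2) mod 4" if "(s, t) \<in> glue S" for s t
  proof -
    define A B where "A = (\<Sum>k \<in> {1..snd s}. m (fst s, k))" and "B = (\<Sum>k \<in> {1..snd t}. m (fst t, k))"
    have "c t + n (fst t) = c s + n (fst s) + 2 * colour_sign (fst s)"
      using n[OF that] w_glue[OF that] by simp
    then have "int (snd t) + n (fst t) = int (snd s) + n (fst s) + 2 +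
        4 * (B - A + (if black (fst s) then 0 else -1))"
      by (simp add: c_def A_def B_def colour_sign_def split: if_splits)
    then show ?thesis by (metis mod_mult_self2)
  qed
  then show ?thesis by (intro exI[of _ n]) auto
qed

text \<open>
  Once the sides have directions, each coordinate of the unit vectors along the sides is a sourceless flow.
\<close>

lemma developing_map:
  obtains dir :: "'s side \<Rightarrow> int" and px py :: "('s \<times> complex) set \<Rightarrow> int" where
    "\<And>s t. (s, t) \<in> glue S \<Longrightarrow> dir t mod 4 = (dir s + 2) mod 4"
    "\<And>c. c \<in> sides S \<Longrightarrow> dir (next_side c) mod 4 = (dir c + 1) mod 4"
    "\<And>c. c \<in> sides S \<Longrightarrow> px (vert (next_side c)) = px (vert c) + unit_x (dir c)"
    "\<And>c. c \<in> sides S \<Longrightarrow> py (vert (next_side c)) = py (vert c) + unit_y (dir c)"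
proof -
  obtain \<delta> :: "'s \<Rightarrow> int" where
    \<delta>: "\<And>s t. (s, t) \<in> glue S \<Longrightarrow> (int (snd t) + \<delta> (fst t)) mod 4 = (int (snd s) + \<delta> (fst s) + 2) mod 4"
    using direction_field by auto
  define dir where "dir c = int (snd c) + \<delta> (fst c)" for c
  have glue: "dir t mod 4 = (dir s + 2) mod 4" if "(s, t) \<in> glue S" for s t
    using \<delta>[OF that] by (simp add: dir_def)
  have nxt: "dir (next_side c) mod 4 = (dir c + 1) mod 4" for c
    by (simp add: dir_def next_side_def zmod_int mod_simps algebra_simps)
  have "unit_x (dir t) = - unit_x (dir s)" "unit_y (dir t) = - unit_y (dir s)" if "(s, t) \<in> glue S" for s t
    using unit_mod[OF glue[OF that]] unit_add_2 by simp_all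
  moreover have "(\<Sum>i<4. unit_x (dir (q, i))) = 0" "(\<Sum>i<4. unit_y (dir (q, i))) = 0" for q
    using sum_unit_around[of "\<delta> q"] by (simp_all add: dir_def)
  ultimately obtain px py where
    "\<And>c. c \<in> sides S \<Longrightarrow> px (vert (next_side c)) - px (vert c) = unit_x (dir c)"
    "\<And>c. c \<in> sides S \<Longrightarrow> py (vert (next_side c)) - py (vert c) = unit_y (dir c)"
    using exact_on_vertices[OF simply_connected, of "\<lambda>c. unit_x (dir c)"]
      exact_on_vertices[OF simply_connected, of "\<lambda>c. unit_y (dir c)"] by metis
  then show ?thesis using that[of dir px py] glue nxt by (simp add: algebra_simps)
qed

text \<open>
  At an interior vertex sides start in all four directions, so no interior vertex is rightmost.
\<close>

lemma boundary_vertex_exists: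
  assumes "squares S \<noteq> {}"
  shows "\<exists>v \<in> surface_vertices S. v \<in> surface_boundary S"
proof -
  obtain dir px py where
    glue: "\<And>s t. (s, t) \<in> glue S \<Longrightarrow> dir t mod 4 = (dir s + 2) mod 4" and
    nxt: "\<And>c. c \<in> sides S \<Longrightarrow> dir (next_side c) mod 4 = (dir c + 1) mod 4" and
    px: "\<And>c. c \<in> sides S \<Longrightarrow> px (vert (next_side c)) = px (vert c) + unit_x (dir c)"
    using developing_map by metis
  have "sides S \<noteq> {}" using assms by (auto simp: sides_def lessThan_4)
  then have ne: "surface_vertices S \<noteq> {}" by (simp add: surface_vertices_eq)
  obtain v where v: "v \<in> surface_vertices S" and max: "\<And>u. u \<in> surface_vertices S \<Longrightarrow> px u \<le> px v"
    using Max_in[of "px ` surface_vertices S"] Max_ge[of "px ` surface_vertices S"] finite_vertices ne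
    by (metis (no_types, lifting) finite_imageI image_iff image_is_empty)
  have "v \<in> surface_boundary S"
  proof (rule ccontr)
    assume v': "v \<notin> surface_boundary S"
    then obtain c where c: "c \<in> sides S" "vert c = v" using v interior_vertex_cases by blast
    have no: "dir d mod 4 \<noteq> 0" if d: "d \<in> sides S" "vert d = v" for d
    proof
      assume "dir d mod 4 = 0"
      then have "px (vert (next_side d)) = px v + 1" using px[OF d(1)] d(2) by (simp add: unit_x_def)
      moreover have "vert (next_side d) \<in> surface_vertices S"
        using d by (intro vertex_of_in_surface_vertices) (simp add: fst_side)
      ultimately show False using max by fastforce
    qed
    have turn: "turn S d \<in> sides S \<and> vert (turn S d) = v \<and> dir (turn S d) mod 4 = (dir d + 1) mod 4"
      if d: "d \<in> sides S" "vert d = v" for d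
    proof -
      have p: "prev_side d \<in> Domain (glue S)" using interior_corner_glued d v' by blast
      have "dir (turn S d) mod 4 = (dir (prev_side d) + 2) mod 4"
        unfolding turn_def using glue[OF mate_glue[OF p]] .
      moreover have "dir d mod 4 = (dir (prev_side d) + 1) mod 4"
        using nxt[of "prev_side d"] d by (simp add: fst_side)
      ultimately have "dir (turn S d) mod 4 = (dir d + 1) mod 4" by (rule turn_direction)
      then show ?thesis using vert_turn[OF d(1) p] d(2) by simp
    qed
    define c1 where "c1 = turn S c"
    define c2 where "c2 = turn S c1"
    define c3 where "c3 = turn S c2"
    have t1: "c1 \<in> sides S \<and> vert c1 = v \<and> dir c1 mod 4 = (dir c + 1) mod 4"
      unfolding c1_def using turn[OF c] .
    have t2: "c2 \<in> sides S \<and> vert c2 = v \<and> dir c2 mod 4 = (dir c1 + 1) mod 4"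
      unfolding c2_def using turn[of c1] t1 by simp
    have t3: "c3 \<in> sides S \<and> vert c3 = v \<and> dir c3 mod 4 = (dir c2 + 1) mod 4"
      unfolding c3_def using turn[of c2] t2 by simp
    have "dir c mod 4 \<noteq> 0" "dir c1 mod 4 \<noteq> 0" "dir c2 mod 4 \<noteq> 0" "dir c3 mod 4 \<noteq> 0"
      using no[OF c] no[of c1] no[of c2] no[of c3] t1 t2 t3 by simp_all
    then show False using four_consecutive_mod_4[of "dir c1" "dir c" "dir c2" "dir c3"] t1 t2 t3 by simp
  qed
  with v show ?thesis by blast
qed

text \<open>
  The developing map is injective on the corners of a single square.
\<close>

lemma square_corners_distinct:
  assumes "c \<in> sides S" "d \<in> sides S" "fst c = fst d" "vert c = vert d"
  shows "c = d"
proof -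
  obtain dir px py where
    nxt: "\<And>c. c \<in> sides S \<Longrightarrow> dir (next_side c) mod 4 = (dir c + 1) mod 4" and
    px: "\<And>c. c \<in> sides S \<Longrightarrow> px (vert (next_side c)) = px (vert c) + unit_x (dir c)" and
    py: "\<And>c. c \<in> sides S \<Longrightarrow> py (vert (next_side c)) = py (vert c) + unit_y (dir c)"
    using developing_map by metis
  have one_step: "vert (next_side c) \<noteq> vert c" if "c \<in> sides S" for c
    using px[OF that] py[OF that] unit_sum_1[of "dir c"] by auto
  have two_steps: "vert (next_side (next_side c)) \<noteq> vert c" if c: "c \<in> sides S" for c
  proof -
    have n: "next_side c \<in> sides S" using c by (simp add: fst_side)
    show ?thesis
      using px[OF c] py[OF c] px[OF n] py[OF n] unit_mod[OF nxt[OF c]] unit_sum_2[of "dir c"] by auto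
  qed
  show ?thesis
  proof (cases rule: same_square_cases[OF assms(1,2) assms(3)[symmetric]])
    case 1 then show ?thesis by (rule sym)
  next
    case 2
    have "vert c \<noteq> vert d" unfolding 2 by (rule one_step[OF assms(1), symmetric])
    then show ?thesis using assms(4) by (rule notE)
  next
    case 3
    have "vert c \<noteq> vert d" unfolding 3 by (rule two_steps[OF assms(1), symmetric])
    then show ?thesis using assms(4) by (rule notE)
  next
    case 4
    then have "next_side d = c" using next_side_cycle(1)[OF assms(1)] by simp
    then show ?thesis using one_step[OF assms(2)] assms(4) by simp
  qed
qed

text \<open>
  The sum \<open>C\<close> of the positions of two opposite corners is twice the center of a square. The center of the
  neighbor across a side is determined by the direction of the side.
\<close>

lemma glued_once:
  assumes g: "(s, t) \<in> glue S" "(s', t') \<in> glue S" and eq: "fst s = fst s'" "fst t = fst t'"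
  shows "s = s'"
proof -
  obtain dir px py where
    glue: "\<And>s t. (s, t) \<in> glue S \<Longrightarrow> dir t mod 4 = (dir s + 2) mod 4" and
    nxt: "\<And>c. c \<in> sides S \<Longrightarrow> dir (next_side c) mod 4 = (dir c + 1) mod 4" and
    px: "\<And>c. c \<in> sides S \<Longrightarrow> px (vert (next_side c)) = px (vert c) + unit_x (dir c)" and
    py: "\<And>c. c \<in> sides S \<Longrightarrow> py (vert (next_side c)) = py (vert c) + unit_y (dir c)"
    using developing_map by metis
  have *: "\<exists>C. \<forall>c \<in> sides S. C (fst c) = p (vert c) + p (vert (next_side (next_side c)))"
    if p: "\<And>c. c \<in> sides S \<Longrightarrow> p (vert (next_side c)) = p (vert c) + e (dir c)"
      and e: "\<And>k l. k mod 4 = l mod 4 \<Longrightarrow> e k = e l" "\<And>k. e (k + 2) = - e k"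
    for p :: "_ \<Rightarrow> int" and e :: "int \<Rightarrow> int"
  proof -
    define D where "D c = p (vert c) + p (vert (next_side (next_side c)))" for c
    have step: "D (next_side c) = D c" if c: "c \<in> sides S" for c
    proof -
      have n: "next_side c \<in> sides S" "next_side (next_side c) \<in> sides S" using c by (simp_all add: fst_side)
      have "dir (next_side (next_side c)) mod 4 = (dir c + 2) mod 4"
        using consecutive_mod_4(2)[OF nxt[OF c] nxt[OF n(1)]] .
      then have "e (dir (next_side (next_side c))) = - e (dir c)"
        using e(1)[of "dir (next_side (next_side c))" "dir c + 2"] e(2)[of "dir c"] by simp
      then show ?thesis unfolding D_def using p[OF c] p[OF n(2)] by simp
    qed
    have D_same: "D d = D c" if "c \<in> sides S" "d \<in> sides S" "fst d = fst c" for c d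
      using that by (rule square_corners_induct[of c d "\<lambda>d. D d = D c"]) (simp_all add: step)
    have "D (fst c, 0) = D c" if "c \<in> sides S" for c
      using fst_side[OF that] by (intro D_same[OF that]) (simp_all add: sides_def)
    then show ?thesis unfolding D_def by (intro exI[of _ "\<lambda>q. D (q, 0)"]) (simp add: D_def)
  qed
  obtain Cx where Cx: "\<And>c. c \<in> sides S \<Longrightarrow> Cx (fst c) = px (vert c) + px (vert (next_side (next_side c)))"
    using *[of px unit_x, OF px unit_mod(1) unit_add_2(1)] by metis
  obtain Cy where Cy: "\<And>c. c \<in> sides S \<Longrightarrow> Cy (fst c) = py (vert c) + py (vert (next_side (next_side c)))"
    using *[of py unit_y, OF py unit_mod(2) unit_add_2(2)] by metis
  have centre: "Cx (fst t) - Cx (fst s) = - 2 * unit_x (dir s + 1)"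
    "Cy (fst t) - Cy (fst s) = - 2 * unit_y (dir s + 1)" if g: "(s, t) \<in> glue S" for s t
  proof -
    have st: "s \<in> sides S" "t \<in> sides S" using glue_in_sides[OF g] by auto
    then have n: "next_side s \<in> sides S" "next_side t \<in> sides S" by (simp_all add: fst_side)
    have d: "dir (next_side s) mod 4 = (dir s + 1) mod 4" "dir (next_side t) mod 4 = (dir s + 1 + 2) mod 4"
      "dir t mod 4 = (dir s + 2) mod 4"
      using nxt[OF st(1)] opposite_direction_next[OF glue[OF g] nxt[OF st(2)]] glue[OF g] by simp_all
    note v = vert_glue[OF g]
    show "Cx (fst t) - Cx (fst s) = - 2 * unit_x (dir s + 1)"
      using Cx[OF st(1)] Cx[OF st(2)] px[OF st(1)] px[OF st(2)] px[OF n(1)] px[OF n(2)]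
        unit_mod(1)[OF d(1)] unit_mod(1)[OF d(2)] unit_mod(1)[OF d(3)] unit_add_2(1)[of "dir s"]
        unit_add_2(1)[of "dir s + 1"] unfolding v by linarith
    show "Cy (fst t) - Cy (fst s) = - 2 * unit_y (dir s + 1)"
      using Cy[OF st(1)] Cy[OF st(2)] py[OF st(1)] py[OF st(2)] py[OF n(1)] py[OF n(2)]
        unit_mod(2)[OF d(1)] unit_mod(2)[OF d(2)] unit_mod(2)[OF d(3)] unit_add_2(2)[of "dir s"]
        unit_add_2(2)[of "dir s + 1"] unfolding v by linarith
  qed
  have ss: "s \<in> sides S" "s' \<in> sides S" using glue_in_sides g by blast+
  then have n: "next_side s \<in> sides S" "next_side s' \<in> sides S" by (simp_all add: fst_side)
  have "unit_x (dir s + 1) = unit_x (dir s' + 1)" "unit_y (dir s + 1) = unit_y (dir s' + 1)"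
    using centre[OF g(1)] centre[OF g(2)] eq by simp_all
  then have "(dir s + 1) mod 4 = (dir s' + 1) mod 4" by (rule unit_eqD)
  then have d: "dir s mod 4 = dir s' mod 4" by (metis add_diff_cancel_right' mod_diff_left_eq)
  show ?thesis
  proof (cases rule: same_square_cases[OF ss eq(1)[symmetric]])
    case 2 then show ?thesis using consecutive_mod_4(1)[OF nxt[OF ss(1)]] d by simp
  next
    case 3 then show ?thesis using consecutive_mod_4(3)[OF nxt[OF ss(1)] nxt[OF n(1)]] d by simp
  next
    case 4
    then have "next_side s' = s" using next_side_cycle(1)[OF ss(1)] by simp
    then show ?thesis using consecutive_mod_4(1)[OF nxt[OF ss(2)]] d by simp
  qed simp
qed

section \<open>Functions on the vertices with prescribed differences\<close>

text \<open>
  The boundary of a simply connected surface is connected. The transfer between two boundary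
  vertices is the difference, from each side to the previous one, of a function on the sides. After a correction by
  a function on the squares this function \<open>G\<close> agrees on glued sides, where \<open>w\<close> has opposite signs. Summation by
  parts turns \<open>h x - h y\<close> into the sum of \<open>- G c * w c\<close>, in which glued sides cancel.
\<close>

lemma constant_on_boundary:
  fixes h :: "('s \<times> complex) set \<Rightarrow> int"
  assumes w: "\<And>c. c \<in> sides S \<Longrightarrow> h (vert (next_side c)) - h (vert c) = w c"
    and w0: "\<And>c. c \<in> sides S - Domain (glue S) \<Longrightarrow> w c = 0"
    and x: "x \<in> surface_vertices S" "x \<in> surface_boundary S"
    and y: "y \<in> surface_vertices S" "y \<in> surface_boundary S"
  shows "h x = h y"
proof -
  obtain k :: "'s side \<Rightarrow> int" where k: "\<And>q. q \<in> squares S \<Longrightarrow> (\<Sum>i<4. k (q, i)) = 0"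
    "\<And>v. (\<Sum>c \<in> corners_at S v. k c) = of_bool (v = x) - of_bool (v = y)"
    using transfer_between_vertices[OF simply_connected x(1) y(1)] by blast
  define g where "g c = (\<Sum>l\<le>snd c. k (fst c, l))" for c
  have g: "g c - g (prev_side c) = k c" if c: "c \<in> sides S" for c
  proof -
    obtain q i where qi: "c = (q, i)" "i < 4" "q \<in> squares S" using c unfolding sides_def by blast
    have "k (q, 0) + k (q, 1) + k (q, 2) + k (q, 3) = 0"
      using k(1)[OF qi(3)] by (simp add: lessThan_4)
    moreover have "{..1} = {0, 1::nat}" "{..2} = {0, 1, 2::nat}" "{..3} = {0, 1, 2, 3::nat}" by auto
    ultimately show ?thesis using qi(1)
      by (cases rule: less_4_cases[OF qi(2)]) (simp_all add: g_def prev_side_def)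
  qed
  define g' where "g' s = g s - g (mate S s)" for s
  have anti: "g' t = - g' s" if "(s, t) \<in> glue S" for s t
    using glue_mate[OF that] glue_mate[OF glue_sym[OF that]] by (simp add: g'_def)
  have closed: "(\<Sum>c \<in> corners_at S v. g' (prev_side c)) = 0"
    if v: "v \<in> surface_vertices S - surface_boundary S" for v
  proof -
    have "(\<Sum>c \<in> corners_at S v. g' (prev_side c)) =
        (\<Sum>c \<in> corners_at S v. g (prev_side c)) - (\<Sum>c \<in> corners_at S v. g (turn S c))"
      by (simp add: g'_def turn_def sum_subtractf)
    also have "\<dots> = - (\<Sum>c \<in> corners_at S v. g c - g (prev_side c))"
      using sum_corners_turn[of v g] v by (simp add: sum_subtractf)
    also have "\<dots> = - (\<Sum>c \<in> corners_at S v. k c)"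
      by (intro arg_cong[of _ _ uminus] sum.cong) (simp_all add: g corners_at_eq)
    also have "\<dots> = 0" using k(2)[of v] v x y by auto
    finally show ?thesis .
  qed
  obtain n :: "'s \<Rightarrow> int" where n: "\<And>s t. (s, t) \<in> glue S \<Longrightarrow> g' s = n (fst t) - n (fst s)"
    using exact_on_squares[of g', OF anti closed] by auto
  define G where "G c = g c + n (fst c)" for c
  have G: "G (mate S s) = G s" if "s \<in> Domain (glue S)" for s
    using n[OF mate_glue[OF that]] by (simp add: G_def g'_def)
  have w_mate: "w (mate S s) = - w s" if s: "s \<in> Domain (glue S)" for s
  proof -
    have gl: "(s, mate S s) \<in> glue S" using mate_glue[OF s] .
    show ?thesis using w[OF glue_in_sides(1)[OF gl]] w[OF glue_in_sides(2)[OF gl]] vert_glue[OF gl] by simp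
  qed
  have reindex: "(\<Sum>c \<in> sides S. f (prev_side c)) = (\<Sum>c \<in> sides S. f c)" for f :: "'s side \<Rightarrow> int"
    by (rule sum.reindex_bij_witness[of _ next_side prev_side]) (auto simp: fst_side)
  have pair: "(\<Sum>s \<in> Domain (glue S). G s * w s) = (\<Sum>s \<in> Domain (glue S). G (mate S s) * w (mate S s))"
    by (rule sum.reindex_bij_witness[of _ "mate S" "mate S"]) (auto simp: mate_mate mate_in_Domain)
  also have "\<dots> = - (\<Sum>s \<in> Domain (glue S). G s * w s)"
    unfolding sum_negf[symmetric] by (rule sum.cong) (simp_all add: G w_mate)
  finally have zero: "(\<Sum>s \<in> Domain (glue S). G s * w s) = 0" by simp
  have "h x - h y = (\<Sum>v \<in> surface_vertices S. h v * (of_bool (v = x) - of_bool (v = y)))"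
  proof -
    have "(\<Sum>v \<in> surface_vertices S. h v * of_bool (v = z)) = h z" if "z \<in> surface_vertices S" for z
    proof -
      have "(\<Sum>v \<in> surface_vertices S. h v * of_bool (v = z)) = (\<Sum>v \<in> surface_vertices S. if v = z then h v else 0)"
        by (intro sum.cong) auto
      then show ?thesis using that finite_vertices by simp
    qed
    then show ?thesis using x y by (simp add: right_diff_distrib sum_subtractf)
  qed
  also have "\<dots> = (\<Sum>v \<in> surface_vertices S. \<Sum>c \<in> corners_at S v. h (vert c) * k c)"
    by (intro sum.cong refl) (simp add: k(2)[symmetric] sum_distrib_left corners_at_eq)
  also have "\<dots> = (\<Sum>c \<in> sides S. h (vert c) * k c)" by (rule sum_sides_by_vertex[symmetric])
  also have "\<dots> = (\<Sum>c \<in> sides S. h (vert c) * G c) - (\<Sum>c \<in> sides S. h (vert c) * G (prev_side c))"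
    unfolding sum_subtractf[symmetric]
    by (intro sum.cong refl) (simp add: g[symmetric] G_def algebra_simps)
  also have "(\<Sum>c \<in> sides S. h (vert c) * G (prev_side c)) =
      (\<Sum>c \<in> sides S. h (vert (next_side (prev_side c))) * G (prev_side c))"
    by (intro sum.cong refl) simp
  also have "\<dots> = (\<Sum>c \<in> sides S. h (vert (next_side c)) * G c)"
    by (rule reindex)
  also have "(\<Sum>c \<in> sides S. h (vert c) * G c) - \<dots> = - (\<Sum>c \<in> sides S. G c * w c)"
    unfolding sum_subtractf[symmetric] sum_negf[symmetric]
    by (intro sum.cong refl) (simp add: w[symmetric] algebra_simps)
  also have "(\<Sum>c \<in> sides S. G c * w c) = (\<Sum>s \<in> Domain (glue S). G s * w s)"
    by (rule sum.mono_neutral_right) (use finite_sides Domain_glue_sides w0 in auto)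
  finally show ?thesis using zero by simp
qed

text \<open>
  Side \<open>c\<close> runs from corner \<open>c\<close> to corner \<open>next_side c\<close>, and whatever leaves the square through \<open>c\<close> has the latter
  on its left. So \<open>w\<close> is a flow out of the squares, and \<open>h\<close> increases by the flow from right to left.
\<close>

definition height_of :: "('s side \<Rightarrow> int) \<Rightarrow> (('s \<times> complex) set \<Rightarrow> int) \<Rightarrow> bool" where
  "height_of w h \<longleftrightarrow> (\<forall>c \<in> sides S. h (vert (next_side c)) - h (vert c) = w c) \<and>
     (\<forall>v \<in> surface_vertices S \<inter> surface_boundary S. h v = 0)"

lemma height_exists:
  assumes anti: "\<And>s t. (s, t) \<in> glue S \<Longrightarrow> w t = - w s"
    and closed: "\<And>q. q \<in> squares S \<Longrightarrow> (\<Sum>i<4. w (q, i)) = 0"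
    and w0: "\<And>c. c \<in> sides S - Domain (glue S) \<Longrightarrow> w c = 0"
  shows "\<exists>h. height_of w h"
proof (cases "squares S = {}")
  case True
  then show ?thesis by (auto simp: height_of_def surface_vertices_eq sides_def)
next
  case False
  then obtain b where b: "b \<in> surface_vertices S" "b \<in> surface_boundary S"
    using boundary_vertex_exists by blast
  obtain h where h: "\<And>c. c \<in> sides S \<Longrightarrow> h (vert (next_side c)) - h (vert c) = w c"
    using exact_on_vertices[OF simply_connected, of w, OF anti closed] by metis
  have "height_of w (\<lambda>v. h v - h b)"
    unfolding height_of_def using h constant_on_boundary[of h w _ b, OF h w0 _ _ b] by auto
  then show ?thesis by blast
qed

text \<open>
  Two height functions have a constant difference, which vanishes on the nonempty boundary.
\<close>

lemma height_unique:
  assumes "height_of w h" "height_of w h'" "v \<in> surface_vertices S"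
  shows "h v = h' v"
proof -
  obtain d where d: "d \<in> sides S" "v = vert d" using assms(3) unfolding surface_vertices_eq by blast
  then have "squares S \<noteq> {}" using fst_side by blast
  then obtain b where b: "b \<in> surface_vertices S" "b \<in> surface_boundary S"
    using boundary_vertex_exists by blast
  then obtain c where c: "c \<in> sides S" "b = vert c" unfolding surface_vertices_eq by blast
  show ?thesis unfolding d(2)
    using simply_connected c(1) d(1)
  proof (induction rule: vertices_induct)
    case base
    then show ?case using b c(2) assms(1,2) unfolding height_of_def by auto
  next
    case (step c)
    then have "h (vert (next_side c)) - h (vert c) = h' (vert (next_side c)) - h' (vert c)"
      using assms(1,2) step(1) unfolding height_of_def by metis
    then show ?case using step(2) by linarith
  qed
qed

end

section \<open>Tilings and flows across sides\<close>

context simply_connected_surface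
begin

definition edge_across :: "'s side \<Rightarrow> 's set" where
  "edge_across s = {fst s, fst (mate S s)}"

definition crossed :: "'s set set \<Rightarrow> 's side \<Rightarrow> bool" where
  "crossed K s \<longleftrightarrow> s \<in> Domain (glue S) \<and> edge_across s \<in> K"

lemma edge_across_glue: "(s, t) \<in> glue S \<Longrightarrow> edge_across s = {fst s, fst t}"
  by (simp add: edge_across_def glue_mate)

lemma edge_across_mate: "s \<in> Domain (glue S) \<Longrightarrow> edge_across (mate S s) = edge_across s"
  by (simp add: edge_across_def mate_mate insert_commute)

lemma fst_mate_neq: "s \<in> Domain (glue S) \<Longrightarrow> fst (mate S s) \<noteq> fst s"
  using glue_black mate_glue by metis

lemma crossed_mate: "s \<in> Domain (glue S) \<Longrightarrow> crossed K (mate S s) \<longleftrightarrow> crossed K s"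
  by (simp add: crossed_def edge_across_mate mate_in_Domain)

text \<open>
  As two squares share at most one side, edges of the dual graph and pairs of pasted sides correspond.
\<close>

lemma edge_across_inj:
  assumes "s \<in> Domain (glue S)" "s' \<in> Domain (glue S)" "fst s = fst s'" "edge_across s = edge_across s'"
  shows "s = s'"
proof -
  have "fst (mate S s) = fst (mate S s')"
    using assms(3,4) fst_mate_neq[OF assms(1)] fst_mate_neq[OF assms(2)]
    unfolding edge_across_def by (auto simp: doubleton_eq_iff)
  then show ?thesis using glued_once mate_glue assms(1,2,3) by metis
qed

lemma edge_across_eqD:
  assumes "s \<in> Domain (glue S)" "s' \<in> Domain (glue S)" "edge_across s' = edge_across s"
  shows "s' = s \<or> s' = mate S s"
proof -
  have "fst s' \<in> edge_across s" using assms(3) unfolding edge_across_def by auto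
  then consider "fst s' = fst s" | "fst s' = fst (mate S s)" unfolding edge_across_def by auto
  then show ?thesis
  proof cases
    case 1
    then show ?thesis using edge_across_inj[OF assms(2,1)] assms(3) by simp
  next
    case 2
    then show ?thesis
      using edge_across_inj[OF assms(2) mate_in_Domain[OF assms(1)]] assms(3) edge_across_mate[OF assms(1)] by simp
  qed
qed

lemma dual_edge_side:
  assumes "e \<in> dual_edges S" "q \<in> e"
  obtains s where "s \<in> Domain (glue S)" "fst s = q" "edge_across s = e"
proof -
  obtain a b i j where e: "e = {a, b}" "((a, i), (b, j)) \<in> glue S"
    using assms(1) unfolding dual_edges_def by blast
  show ?thesis
  proof (cases "q = a")
    case True
    then show ?thesis using that[of "(a, i)"] e edge_across_glue[OF e(2)] by auto
  next
    case False
    then have "fst (b, j) = q" using assms(2) e(1) by auto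
    moreover have "(b, j) \<in> Domain (glue S)" using glue_sym[OF e(2)] by blast
    moreover have "edge_across (b, j) = e"
      using edge_across_glue[OF glue_sym[OF e(2)]] e(1) by (simp add: insert_commute)
    ultimately show ?thesis using that by blast
  qed
qed

lemma dual_edge_subset: "e \<in> dual_edges S \<Longrightarrow> q \<in> e \<Longrightarrow> q \<in> squares S"
  using dual_edge_side glue_in_sides(1) fst_side by (metis DomainE)

lemma finite_dual_edges: "finite (dual_edges S)"
proof -
  have "dual_edges S \<subseteq> Pow (squares S)" using dual_edge_subset by blast
  then show ?thesis using finite_squares finite_subset by blast
qed

lemma sum_crossed:
  assumes "K \<subseteq> dual_edges S" "q \<in> squares S"
  shows "(\<Sum>i<4. of_bool (crossed K (q, i))) = int (card {e \<in> K. q \<in> e})"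
proof -
  let ?I = "{i \<in> {..<4}. crossed K (q, i)}"
  have inj: "inj_on (\<lambda>i. edge_across (q, i)) ?I"
  proof (rule inj_onI)
    fix i j assume "i \<in> ?I" "j \<in> ?I" "edge_across (q, i) = edge_across (q, j)"
    then have "(q, i) = (q, j)" by (intro edge_across_inj) (auto simp: crossed_def)
    then show "i = j" by simp
  qed
  have image: "(\<lambda>i. edge_across (q, i)) ` ?I = {e \<in> K. q \<in> e}"
  proof
    show "(\<lambda>i. edge_across (q, i)) ` ?I \<subseteq> {e \<in> K. q \<in> e}"
      by (auto simp: crossed_def) (simp add: edge_across_def)
    show "{e \<in> K. q \<in> e} \<subseteq> (\<lambda>i. edge_across (q, i)) ` ?I"
    proof
      fix e assume e: "e \<in> {e \<in> K. q \<in> e}"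
      then obtain s where s: "s \<in> Domain (glue S)" "fst s = q" "edge_across s = e"
        using dual_edge_side assms(1) by blast
      then have "s = (q, snd s)" by auto
      moreover have "snd s < 4" using s(1) Domain_glue_sides side_lt_4 by blast
      ultimately show "e \<in> (\<lambda>i. edge_across (q, i)) ` ?I"
        using s e by (intro image_eqI[of _ _ "snd s"]) (auto simp: crossed_def)
    qed
  qed
  have "card {e \<in> K. q \<in> e} = card ?I" using card_image[OF inj] unfolding image .
  moreover have "?I = {..<4} \<inter> {i. crossed K (q, i)}" by blast
  ultimately show ?thesis using sum_of_bool_eq[of "{..<4::nat}" "\<lambda>i. crossed K (q, i)"] by (simp only:) simp
qed

text \<open>
  The net flow out of a square when the edges of \<open>K\<close> are traversed from black to white and those of \<open>K'\<close> from
  white to black.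
\<close>

definition edge_flow :: "'s set set \<Rightarrow> 's set set \<Rightarrow> 's side \<Rightarrow> int" where
  "edge_flow K K' s = colour_sign (fst s) * (of_bool (crossed K s) - of_bool (crossed K' s))"

lemma edge_flow_glue: "(s, t) \<in> glue S \<Longrightarrow> edge_flow K K' t = - edge_flow K K' s"
  using crossed_mate[of s] glue_mate[of s t] colour_sign_glue[of s t] unfolding edge_flow_def by auto

lemma edge_flow_boundary: "s \<in> sides S - Domain (glue S) \<Longrightarrow> edge_flow K K' s = 0"
  by (simp add: edge_flow_def crossed_def)

lemma edge_flow_height_exists:
  assumes "K \<subseteq> dual_edges S" "K' \<subseteq> dual_edges S"
    and "\<And>q. q \<in> squares S \<Longrightarrow> card {e \<in> K. q \<in> e} = card {e \<in> K'. q \<in> e}"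
  shows "\<exists>h. height_of (edge_flow K K') h"
proof (rule height_exists)
  show "(\<Sum>i<4. edge_flow K K' (q, i)) = 0" if "q \<in> squares S" for q
    using sum_crossed[OF assms(1) that] sum_crossed[OF assms(2) that] assms(3)[OF that]
    by (simp add: edge_flow_def sum_distrib_left[symmetric] sum_subtractf)
qed (use edge_flow_glue edge_flow_boundary in auto)

lemma tiling_edges: "domino_tiling S T \<Longrightarrow> T \<subseteq> dual_edges S"
  by (simp add: domino_tiling_def)

lemma tiling_unique:
  assumes "domino_tiling S T" "d \<in> T" "e \<in> T" "q \<in> d" "q \<in> e"
  shows "d = e"
proof -
  have "q \<in> squares S" using assms tiling_edges dual_edge_subset by blast
  then show ?thesis using assms unfolding domino_tiling_def by blast
qed

lemma tiling_card:
  assumes "domino_tiling S T" "q \<in> squares S"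
  shows "card {e \<in> T. q \<in> e} = 1"
proof -
  obtain d where "d \<in> T" "q \<in> d" using assms unfolding domino_tiling_def by blast
  then have "{e \<in> T. q \<in> e} = {d}" using tiling_unique[OF assms(1)] by blast
  then show ?thesis by simp
qed

end

section \<open>The components of the complement of a curve\<close>

lemma segment_midpoint_iff:
  "z \<in> closed_segment 0 (side_midpoint 0) \<longleftrightarrow> Re z = 0 \<and> - 1/2 \<le> Im z \<and> Im z \<le> 0"
  "z \<in> closed_segment 0 (side_midpoint (Suc 0)) \<longleftrightarrow> Im z = 0 \<and> 0 \<le> Re z \<and> Re z \<le> 1/2"
  "z \<in> closed_segment 0 (side_midpoint 2) \<longleftrightarrow> Re z = 0 \<and> 0 \<le> Im z \<and> Im z \<le> 1/2"
  "z \<in> closed_segment 0 (side_midpoint 3) \<longleftrightarrow> Im z = 0 \<and> - 1/2 \<le> Re z \<and> Re z \<le> 0"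
proof -
  have *: "z \<in> closed_segment 0 w \<longleftrightarrow> (\<exists>u. 0 \<le> u \<and> u \<le> 1 \<and> Re z = u * Re w \<and> Im z = u * Im w)" for w
    by (auto simp: closed_segment_def complex_eq_iff)
  show "z \<in> closed_segment 0 (side_midpoint 0) \<longleftrightarrow> Re z = 0 \<and> - 1/2 \<le> Im z \<and> Im z \<le> 0"
    unfolding * side_point_explicit by (auto intro!: exI[of _ "- 2 * Im z"])
  show "z \<in> closed_segment 0 (side_midpoint (Suc 0)) \<longleftrightarrow> Im z = 0 \<and> 0 \<le> Re z \<and> Re z \<le> 1/2"
    unfolding * side_point_explicit by (auto intro!: exI[of _ "2 * Re z"])
  show "z \<in> closed_segment 0 (side_midpoint 2) \<longleftrightarrow> Re z = 0 \<and> 0 \<le> Im z \<and> Im z \<le> 1/2"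
    unfolding * side_point_explicit by (auto intro!: exI[of _ "2 * Im z"])
  show "z \<in> closed_segment 0 (side_midpoint 3) \<longleftrightarrow> Im z = 0 \<and> - 1/2 \<le> Re z \<and> Re z \<le> 0"
    unfolding * side_point_explicit by (auto intro!: exI[of _ "- 2 * Re z"])
qed

lemma side_point_on_segment:
  assumes "i < 4" "k < 4" "t \<in> {0..1}" "side_point i t \<in> closed_segment 0 (side_midpoint k)"
  shows "k = i \<and> t = 1/2"
  using assms
  by (cases rule: less_4_cases[OF assms(1)]; cases rule: less_4_cases[OF assms(2)];
      simp only: segment_midpoint_iff One_nat_def; auto simp: side_point_explicit)

text \<open>
  The quarter of the square that contains corner \<open>k\<close>. Adjacent quadrants meet in the segments of which
  cycles are composed.
\<close>

definition quadrant :: "nat \<Rightarrow> complex set" where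
  "quadrant k = {z \<in> unit_square. 0 \<le> Re (corner k) * Re z \<and> 0 \<le> Im (corner k) * Im z}"

lemma quadrant_iff:
  "z \<in> quadrant 0 \<longleftrightarrow> z \<in> unit_square \<and> Re z \<le> 0 \<and> Im z \<le> 0"
  "z \<in> quadrant (Suc 0) \<longleftrightarrow> z \<in> unit_square \<and> 0 \<le> Re z \<and> Im z \<le> 0"
  "z \<in> quadrant 2 \<longleftrightarrow> z \<in> unit_square \<and> 0 \<le> Re z \<and> 0 \<le> Im z"
  "z \<in> quadrant 3 \<longleftrightarrow> z \<in> unit_square \<and> Re z \<le> 0 \<and> 0 \<le> Im z"
  by (auto simp: quadrant_def side_point_explicit)

lemma closed_quadrant: "closed (quadrant k)"
proof -
  have "quadrant k = unit_square \<inter> {z. 0 \<le> Re (corner k) * Re z} \<inter> {z. 0 \<le> Im (corner k) * Im z}"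
    by (auto simp: quadrant_def)
  then show ?thesis
    by (auto intro!: closed_Int unit_square_closed closed_Collect_le continuous_intros)
qed

lemma quadrant_subset: "quadrant k \<subseteq> unit_square"
  by (auto simp: quadrant_def)

lemma unit_square_quadrants: "z \<in> unit_square \<Longrightarrow> \<exists>k<4. z \<in> quadrant k"
proof -
  assume z: "z \<in> unit_square"
  consider "Re z \<le> 0" "Im z \<le> 0" | "0 \<le> Re z" "Im z \<le> 0" | "0 \<le> Re z" "0 \<le> Im z" | "Re z \<le> 0" "0 \<le> Im z"
    by linarith
  then show ?thesis
    by cases (use z quadrant_iff in \<open>auto intro: exI[of _ 0] exI[of _ "Suc 0"] exI[of _ 2] exI[of _ 3]\<close>)
qed

lemma quadrants_meet:
  assumes "k < 4" "l < 4" "k \<noteq> l" "z \<in> quadrant k" "z \<in> quadrant l"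
  shows "z = 0 \<or> l = (k + 1) mod 4 \<and> z \<in> closed_segment 0 (side_midpoint k) \<or>
         k = (l + 1) mod 4 \<and> z \<in> closed_segment 0 (side_midpoint l)"
  using assms
  by (cases rule: less_4_cases[OF assms(1)]; cases rule: less_4_cases[OF assms(2)])
     (simp_all add: quadrant_iff segment_midpoint_iff complex_eq_iff unit_square_def abs_le_iff)

lemma side_point_quadrant:
  assumes "i < 4" "k < 4" "t \<in> {0..1}"
  shows "side_point i t \<in> quadrant k \<longleftrightarrow> k = i \<and> t \<le> 1/2 \<or> k = (i + 1) mod 4 \<and> 1/2 \<le> t"
proof -
  have u: "side_point i t \<in> unit_square" using side_point_in_unit_square assms by blast
  then show ?thesis using assms
    by (cases rule: less_4_cases[OF assms(1)]; cases rule: less_4_cases[OF assms(2)])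
       (auto simp: quadrant_iff side_point_explicit)
qed

context simply_connected_surface
begin

text \<open>
  The preimage of the cycle curve in the squares before pasting.
\<close>

definition on_curve :: "'s set set \<Rightarrow> 's \<times> complex \<Rightarrow> bool" where
  "on_curve K = (\<lambda>(q, z). \<exists>i<4. crossed K (q, i) \<and> z \<in> closed_segment 0 (side_midpoint i))"

lemma cycle_curve_eq: "cycle_curve S K = paste S ` {x. on_curve K x}"
proof
  show "cycle_curve S K \<subseteq> paste S ` {x. on_curve K x}"
  proof
    fix p assume "p \<in> cycle_curve S K"
    then obtain q i r j z where p: "p = paste S (q, z)" "((q, i), (r, j)) \<in> glue S" "{q, r} \<in> K"
      "z \<in> closed_segment 0 (side_midpoint i)"
      unfolding cycle_curve_def by blast
    then have "on_curve K (q, z)"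
      unfolding on_curve_def crossed_def using glue_in_sides(1)[OF p(2)] edge_across_glue[OF p(2)]
      by (auto simp: sides_def intro!: exI[of _ i])
    then show "p \<in> paste S ` {x. on_curve K x}" using p(1) by blast
  qed
  show "paste S ` {x. on_curve K x} \<subseteq> cycle_curve S K"
  proof clarify
    fix q z assume "on_curve K (q, z)"
    then obtain i where i: "(q, i) \<in> Domain (glue S)" "edge_across (q, i) \<in> K"
      "z \<in> closed_segment 0 (side_midpoint i)"
      unfolding on_curve_def crossed_def by auto
    obtain r j where rj: "mate S (q, i) = (r, j)" by fastforce
    then have "((q, i), (r, j)) \<in> glue S" using mate_glue[OF i(1)] by simp
    moreover have "{q, r} \<in> K" using i(2) rj by (simp add: edge_across_def)
    ultimately show "paste S (q, z) \<in> cycle_curve S K"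
      unfolding cycle_curve_def using i(3) by blast
  qed
qed

lemma on_curve_side_iff:
  assumes "(q, i) \<in> sides S" "t \<in> {0..1}"
  shows "on_curve K (q, side_point i t) \<longleftrightarrow> crossed K (q, i) \<and> t = 1/2"
proof
  assume "on_curve K (q, side_point i t)"
  then show "crossed K (q, i) \<and> t = 1/2"
    using side_point_on_segment[of i _ t] assms unfolding on_curve_def sides_def by blast
next
  assume *: "crossed K (q, i) \<and> t = 1/2"
  then have t: "t = 1/2" ..
  have "side_point i t \<in> closed_segment 0 (side_midpoint i)" unfolding t by simp
  then show "on_curve K (q, side_point i t)"
    using * assms(1) unfolding on_curve_def sides_def by blast
qed

lemma on_curve_glue:
  assumes "((q, i), (r, j)) \<in> glue S" "t \<in> {0..1}"
  shows "on_curve K (q, side_point i t) \<longleftrightarrow> on_curve K (r, side_point j (1 - t))"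
proof -
  have "crossed K (r, j) \<longleftrightarrow> crossed K (q, i)"
    using crossed_mate[of "(q, i)" K] glue_mate[OF assms(1)] assms(1) by auto
  then show ?thesis
    using on_curve_side_iff[OF glue_in_sides(1)[OF assms(1)], of t K]
      on_curve_side_iff[OF glue_in_sides(2)[OF assms(1)], of "1 - t" K] assms(2) by auto
qed

lemma paste_in_curve_iff: "paste S x \<in> cycle_curve S K \<longleftrightarrow> on_curve K x"
proof
  assume "paste S x \<in> cycle_curve S K"
  then obtain y where y: "on_curve K y" "paste S y = paste S x" unfolding cycle_curve_eq by auto
  show "on_curve K x"
    by (rule paste_invariant[OF sym_glue y(2), of "on_curve K", OF y(1)]) (use on_curve_glue in blast)
qed (auto simp: cycle_curve_eq)

abbreviation complement_of_curve :: "'s set set \<Rightarrow> ('s \<times> complex) set topology" where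
  "complement_of_curve K \<equiv> subtopology (surface S) (topspace (surface S) - cycle_curve S K)"

lemma uncrossed_side_connected:
  assumes c: "c \<in> sides S" "\<not> crossed K c" and t: "t \<in> {0..1}"
  shows "connected_component_of (complement_of_curve K) (vert c) (paste S (fst c, side_point (snd c) t))"
proof -
  let ?p = "\<lambda>u. paste S (fst c, side_point (snd c) (u * t))"
  have ut: "u * t \<in> {0..1}" if "u \<in> {0..1}" for u using t that by (auto intro: mult_le_one)
  have p: "pathin (surface S) ?p"
  proof (rule pathin_paste[OF fst_side[OF c(1)]])
    show "continuous_on {0..1} (\<lambda>u. side_point (snd c) (u * t))"
      unfolding side_point_def Complex_eq by (intro continuous_intros)
    show "side_point (snd c) (u * t) \<in> unit_square" if "u \<in> {0..1}" for u
      using side_point_in_unit_square[OF side_lt_4[OF c(1)] ut[OF that]] .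
  qed
  have "?p u \<notin> cycle_curve S K" if "u \<in> {0..1}" for u
    using on_curve_side_iff[of "fst c" "snd c" "u * t" K] c ut[OF that] by (simp add: paste_in_curve_iff)
  with p have "pathin (complement_of_curve K) ?p"
    unfolding pathin_def continuous_map_in_subtopology
    using continuous_map_image_subset_topspace by fastforce
  then have "path_component_of (complement_of_curve K) (?p 0) (?p 1)"
    unfolding path_component_of_def by blast
  then have "connected_component_of (complement_of_curve K) (?p 0) (?p 1)"
    using path_component_subset_connected_component_of[of "complement_of_curve K" "?p 0"] by blast
  then show ?thesis by (simp add: vertex_of_def)
qed

text \<open>
  For each truth value \<open>b\<close> the quadrants of the corners where \<open>P\<close> has the value \<open>b\<close>, together with the curve, form a
  closed set \<open>E b\<close>. These two sets cover the surface and meet in the curve only: quadrants with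
  different values of \<open>P\<close> in the same square are separated by segments of the curve. So they
  separate the complement of the curve.
\<close>

lemma vertices_in_component:
  assumes P: "\<And>c. c \<in> sides S \<Longrightarrow> \<not> crossed K c \<Longrightarrow> P (vert (next_side c)) \<longleftrightarrow> P (vert c)"
    and c: "c \<in> sides S" and d: "d \<in> sides S"
    and con: "connected_component_of (complement_of_curve K) (vert c) (vert d)"
  shows "P (vert c) \<longleftrightarrow> P (vert d)"
proof -
  let ?X = "complement_of_curve K"
  define A where "A b = (\<lambda>(q, z). on_curve K (q, z) \<or> (\<exists>k<4. z \<in> quadrant k \<and> P (vert (q, k)) = b))" for b
  have A_glue: "A b (r, side_point j (1 - t))"
    if g: "((q, i), (r, j)) \<in> glue S" and t: "t \<in> {0..1}" and Aq: "A b (q, side_point i t)" for q i r j t b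
  proof (cases "on_curve K (q, side_point i t)")
    case True
    then show ?thesis using on_curve_glue[OF g t] by (simp add: A_def)
  next
    case False
    have ij: "i < 4" "j < 4" using glue_in_sides[OF g] by (auto simp: sides_def)
    obtain k where k: "k < 4" "side_point i t \<in> quadrant k" "P (vert (q, k)) = b"
      using Aq False by (auto simp: A_def)
    have v: "vert (q, i) = vert (r, (j + 1) mod 4)" "vert (q, (i + 1) mod 4) = vert (r, j)"
      using vert_glue[OF g] by (simp_all add: next_side_def)
    have t': "1 - t \<in> {0..1}" using t by simp
    consider "k = i" "t \<le> 1/2" | "k = (i + 1) mod 4" "1/2 \<le> t"
      using k(2) side_point_quadrant[OF ij(1) k(1) t] by blast
    then show ?thesis
    proof cases
      case 1
      have "side_point j (1 - t) \<in> quadrant ((j + 1) mod 4)"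
        using side_point_quadrant[OF ij(2) _ t', of "(j + 1) mod 4"] 1(2) by simp
      then show ?thesis using k(3) 1(1) v(1) unfolding A_def
        by (auto intro!: exI[of _ "(j + 1) mod 4"])
    next
      case 2
      have "side_point j (1 - t) \<in> quadrant j"
        using side_point_quadrant[OF ij(2) ij(2) t'] 2(2) by simp
      then show ?thesis using k(3) 2(1) v(2) ij(2) unfolding A_def by auto
    qed
  qed
  have A_paste: "A b y" if "paste S x = paste S y" "A b x" for x y b
    by (rule paste_invariant[OF sym_glue that(1), of "A b", OF that(2)]) (rule A_glue)
  define E where "E b = paste S ` {x \<in> topspace (pieces S). A b x}" for b
  have E_iff: "paste S x \<in> E b \<longleftrightarrow> A b x" if x: "x \<in> topspace (pieces S)" for x b
  proof
    assume "paste S x \<in> E b"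
    then obtain y where "A b y" "paste S y = paste S x" unfolding E_def by auto
    then show "A b x" using A_paste by blast
  qed (use x E_def in auto)
  have closedE: "closedin (surface S) (E b)" for b
  proof -
    define C where "C q = (\<Union>i\<in>{i\<in>{..<4}. crossed K (q, i)}. closed_segment 0 (side_midpoint i)) \<union>
        (\<Union>k\<in>{k\<in>{..<4}. P (vert (q, k)) = b}. quadrant k)" for q
    have seg: "closed_segment 0 (side_midpoint i) \<subseteq> unit_square" if "i < 4" for i
      using side_point_in_unit_square[OF that, of "1/2"]
      by (intro closed_segment_subset unit_square_convex) (auto simp: unit_square_def)
    have "closed (C q) \<and> C q \<subseteq> unit_square" for q
    proof
      show "closed (C q)" unfolding C_def
        by (rule closed_Un; rule closed_UN) (simp_all add: closed_quadrant)
      show "C q \<subseteq> unit_square" unfolding C_def using seg quadrant_subset by blast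
    qed
    then have "closedin (pieces S) (Sigma (squares S) C)" by (intro closedin_pieces_Sigma) auto
    moreover have "{x \<in> topspace (pieces S). paste S x \<in> E b} = Sigma (squares S) C"
    proof -
      have "{x \<in> topspace (pieces S). paste S x \<in> E b} = {x \<in> topspace (pieces S). A b x}"
        using E_iff by (metis (lifting))
      also have "\<dots> = Sigma (squares S) C"
        unfolding topspace_pieces A_def on_curve_def C_def using seg by (auto simp: quadrant_def)
      finally show ?thesis .
    qed
    moreover have "E b \<subseteq> topspace (surface S)" unfolding E_def topspace_surface by blast
    moreover from this have "closedin (pieces S) {x \<in> topspace (pieces S). paste S x \<in> E b} \<longleftrightarrow>
        closedin (surface S) (E b)"
      using quotient_map_paste[of S] unfolding quotient_map_closedin by simp
    ultimately show ?thesis by (simp only:)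
  qed
  obtain W where W: "connectedin ?X W" "vert c \<in> W" "vert d \<in> W"
    using con unfolding connected_component_of_def by blast
  have W_sub: "W \<subseteq> topspace (surface S) - cycle_curve S K"
    using connectedin_subset_topspace[OF W(1)] by auto
  define E' where "E' b = E b \<inter> (topspace (surface S) - cycle_curve S K)" for b
  have closedE': "closedin ?X (E' b)" for b
    using closedE[of b] unfolding E'_def closedin_subtopology by blast
  have cover: "W \<subseteq> E' True \<union> E' False"
  proof
    fix p assume p: "p \<in> W"
    then obtain q z where qz: "(q, z) \<in> topspace (pieces S)" "p = paste S (q, z)"
      using W_sub unfolding topspace_surface by auto
    then obtain k where "k < 4" "z \<in> quadrant k" using unit_square_quadrants by (auto simp: topspace_pieces)
    then have "A True (q, z) \<or> A False (q, z)" unfolding A_def by auto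
    then show "p \<in> E' True \<union> E' False" using E_iff[OF qz(1)] qz(2) p W_sub unfolding E'_def by blast
  qed
  have disj: "p \<notin> E' False" if p: "p \<in> E' True" for p
  proof
    assume "p \<in> E' False"
    with p obtain q z where qz: "(q, z) \<in> topspace (pieces S)" "p = paste S (q, z)" "p \<notin> cycle_curve S K"
      "p \<in> E True" "p \<in> E False"
      unfolding E'_def topspace_surface by auto
    then have A: "A True (q, z)" "A False (q, z)" "\<not> on_curve K (q, z)" and q: "q \<in> squares S"
      using E_iff[OF qz(1)] paste_in_curve_iff by (auto simp: topspace_pieces)
    then obtain k l where kl: "k < 4" "z \<in> quadrant k" "P (vert (q, k))"
      "l < 4" "z \<in> quadrant l" "\<not> P (vert (q, l))" unfolding A_def by auto
    have side: "P (vert (q, (i + 1) mod 4)) \<longleftrightarrow> P (vert (q, i))"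
      if "i < 4" "z \<in> closed_segment 0 (side_midpoint i)" for i
      using P[of "(q, i)"] A(3) that q by (auto simp: on_curve_def sides_def next_side_def)
    consider "z = 0" | "l = (k + 1) mod 4" "z \<in> closed_segment 0 (side_midpoint k)"
      | "k = (l + 1) mod 4" "z \<in> closed_segment 0 (side_midpoint l)"
      using quadrants_meet[of k l z] kl by blast
    then show False
    proof cases
      case 1
      then have "P (vert (q, (i + 1) mod 4)) \<longleftrightarrow> P (vert (q, i))" if "i < 4" for i
        using side[OF that] by simp
      then have step: "fst (next_side x) = q \<and> P (vert (next_side x))" if "x \<in> sides S" "fst x = q \<and> P (vert x)" for x
        using that side_lt_4[OF that(1)] by (cases x) (simp add: next_side_def)
      have "fst (q, l) = q \<and> P (vert (q, l))"
        by (rule square_corners_induct[of "(q, k)" "(q, l)" "\<lambda>x. fst x = q \<and> P (vert x)"])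
           (use kl q step in \<open>auto simp: sides_def\<close>)
      then show ?thesis using kl by simp
    qed (use side kl in auto)
  qed
  have in_E: "vert e \<in> E' (P (vert e))" if "e \<in> sides S" "vert e \<in> W" for e
  proof -
    have "corner (snd e) \<in> quadrant (snd e)"
      using side_point_quadrant[of "snd e" "snd e" 0] side_lt_4[OF that(1)] by simp
    then have "A (P (vert e)) (fst e, corner (snd e))"
      unfolding A_def using side_lt_4[OF that(1)] by auto
    moreover have "(fst e, corner (snd e)) \<in> topspace (pieces S)"
      using side_point_in_unit_square[OF side_lt_4[OF that(1)], of 0] fst_side[OF that(1)]
      by (simp add: topspace_pieces)
    ultimately have "paste S (fst e, corner (snd e)) \<in> E (P (vert e))" using E_iff by blast
    then show ?thesis using that(2) W_sub unfolding E'_def vertex_of_def by blast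
  qed
  show ?thesis
  proof (rule ccontr)
    assume "P (vert c) \<noteq> P (vert d)"
    then have "E' True \<inter> W \<noteq> {}" "E' False \<inter> W \<noteq> {}"
      using in_E[OF c W(2)] in_E[OF d W(3)] W by (cases "P (vert c)"; cases "P (vert d)"; auto)+
    moreover have "E' True \<inter> E' False \<inter> W = {}" using disj by blast
    ultimately show False
      using W(1) closedE' cover unfolding connectedin_closedin by blast
  qed
qed

lemma vertex_off_curve: "c \<in> sides S \<Longrightarrow> vert c \<in> topspace (complement_of_curve K)"
proof -
  assume c: "c \<in> sides S"
  have "\<not> on_curve K (fst c, corner (snd c))"
    using on_curve_side_iff[of "fst c" "snd c" 0] c by simp
  then have "vert c \<notin> cycle_curve S K" unfolding vertex_of_def paste_in_curve_iff .
  moreover have "vert c \<in> topspace (surface S)"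
    unfolding vertex_of_def topspace_surface topspace_pieces
    using side_point_in_unit_square[OF side_lt_4[OF c], of 0] fst_side[OF c] by simp
  ultimately show ?thesis by simp
qed

lemma vertex_enclosed_iff:
  assumes "c \<in> sides S"
  shows "vert c \<in> enclosed_region S K \<longleftrightarrow>
    \<not> (\<exists>y \<in> surface_boundary S. connected_component_of (complement_of_curve K) (vert c) y)"
  using vertex_off_curve[OF assms, of K] unfolding enclosed_region_def Let_def by auto

text \<open>
  The component of the vertex is a union of pieces of nonzero height, while a boundary point
  would connect it to a boundary vertex, where the height vanishes.
\<close>

lemma nonzero_height_enclosed:
  assumes w: "\<And>c. c \<in> sides S \<Longrightarrow> \<not> crossed K c \<Longrightarrow> w c = 0"
    and h: "height_of w h" and c: "c \<in> sides S" "h (vert c) \<noteq> 0"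
  shows "vert c \<in> enclosed_region S K"
  unfolding vertex_enclosed_iff[OF c(1)]
proof
  assume "\<exists>y \<in> surface_boundary S. connected_component_of (complement_of_curve K) (vert c) y"
  then obtain q i t where y: "(q, i) \<in> sides S" "(q, i) \<notin> Domain (glue S)" "t \<in> {0..1}"
    "connected_component_of (complement_of_curve K) (vert c) (paste S (q, side_point i t))"
    unfolding surface_boundary_def by blast
  have "\<not> crossed K (q, i)" using y(2) by (simp add: crossed_def)
  then have "connected_component_of (complement_of_curve K) (vert (q, i)) (paste S (q, side_point i t))"
    using uncrossed_side_connected[OF y(1) _ y(3), of K] by simp
  then have "connected_component_of (complement_of_curve K) (vert c) (vert (q, i))"
    by (rule connected_component_of_trans[OF y(4) iffD1[OF connected_component_of_sym]])
  moreover have "h (vert (next_side d)) \<noteq> 0 \<longleftrightarrow> h (vert d) \<noteq> 0" if "d \<in> sides S" "\<not> crossed K d" for d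
  proof -
    have "h (vert (next_side d)) - h (vert d) = 0" using h w[OF that] that(1) unfolding height_of_def by simp
    then show ?thesis by simp
  qed
  ultimately have "h (vert (q, i)) \<noteq> 0"
    using vertices_in_component[of K "\<lambda>v. h v \<noteq> 0" c "(q, i)"] c y(1) by blast
  moreover have "vert (q, i) \<in> surface_boundary S"
    using vert_in_boundary_iff[OF y(1)] y(1,2) by blast
  moreover have "vert (q, i) \<in> surface_vertices S" using vertex_of_in_surface_vertices[OF y(1)] .
  ultimately show False using h unfolding height_of_def by blast
qed

end

section \<open>The cycles of two tilings\<close>

context simply_connected_surface
begin

text \<open>
  Being joined by a path of sides that are not crossed by \<open>K\<close>.
\<close>

definition linked :: "'s set set \<Rightarrow> ('s \<times> complex) set \<Rightarrow> ('s \<times> complex) set \<Rightarrow> bool" where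
  "linked K = (\<lambda>u v. \<exists>c \<in> sides S. \<not> crossed K c \<and> {u, v} = {vert c, vert (next_side c)})\<^sup>*\<^sup>*"

lemma linked_refl: "linked K v v"
  by (simp add: linked_def)

lemma linked_trans: "linked K u v \<Longrightarrow> linked K v w \<Longrightarrow> linked K u w"
  unfolding linked_def by (rule rtranclp_trans)

lemma linked_sym: "linked K u v \<Longrightarrow> linked K v u"
  unfolding linked_def
proof (induction rule: rtranclp_induct)
  case (step y z)
  then have "\<exists>c \<in> sides S. \<not> crossed K c \<and> {z, y} = {vert c, vert (next_side c)}"
    by (simp add: insert_commute)
  then show ?case using step.IH by (rule converse_rtranclp_into_rtranclp)
qed simp

lemma linked_side: "c \<in> sides S \<Longrightarrow> \<not> crossed K c \<Longrightarrow> linked K (vert c) (vert (next_side c))"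
  unfolding linked_def by (rule r_into_rtranclp) blast

lemma linked_height:
  assumes "linked K u v" and "\<And>c. c \<in> sides S \<Longrightarrow> \<not> crossed K c \<Longrightarrow> w c = 0" and "height_of w h"
  shows "h u = h v"
  using assms(1) unfolding linked_def
proof (induction rule: rtranclp_induct)
  case (step y z)
  then obtain c where c: "c \<in> sides S" "\<not> crossed K c" "{y, z} = {vert c, vert (next_side c)}" by blast
  then have "h (vert (next_side c)) = h (vert c)"
    using assms(2)[OF c(1,2)] assms(3) unfolding height_of_def by fastforce
  then have "h y = h z" using c(3) by (auto simp: doubleton_eq_iff)
  then show ?case using step by simp
qed simp

lemma linked_component:
  assumes "linked K (vert c) v" "c \<in> sides S"
  shows "connected_component_of (complement_of_curve K) (vert c) v"
  using assms(1) unfolding linked_def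
proof (induction rule: rtranclp_induct)
  case base
  then show ?case using vertex_off_curve[OF assms(2)] connected_component_of_refl by metis
next
  case (step y z)
  then obtain d where d: "d \<in> sides S" "\<not> crossed K d" "{y, z} = {vert d, vert (next_side d)}" by blast
  have "paste S (fst d, side_point (snd d) 1) = vert (next_side d)"
    using side_point_1'[OF side_lt_4[OF d(1)]] by (simp add: vertex_of_def next_side_def)
  then have "connected_component_of (complement_of_curve K) (vert d) (vert (next_side d))"
    using uncrossed_side_connected[OF d(1,2), of 1] by simp
  then have "connected_component_of (complement_of_curve K) y z"
    using d(3) connected_component_of_sym by (metis doubleton_eq_iff)
  with step.IH show ?case by (rule connected_component_of_trans)
qed

lemma linked_around_square:
  assumes c: "c \<in> sides S" and d: "d \<in> sides S" "fst d = fst c" "d \<noteq> c"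
    and un: "\<And>x. x \<in> sides S \<Longrightarrow> fst x = fst c \<Longrightarrow> x \<noteq> c \<Longrightarrow> x \<noteq> d \<Longrightarrow> \<not> crossed K x"
  shows "linked K (vert (next_side c)) (vert d)"
proof -
  let ?n = "next_side :: 's side \<Rightarrow> 's side"
  have in_sides: "?n c \<in> sides S" "?n (?n c) \<in> sides S" using c by (simp_all add: fst_side)
  note dist = next_side_cycle(2)[OF c]
  show ?thesis
  proof (cases rule: same_square_cases[OF c d(1,2)])
    case 1 then show ?thesis using d(3) by simp
  next
    case 2 then show ?thesis by (simp add: linked_refl)
  next
    case 3
    then have "\<not> crossed K (?n c)" using un[OF in_sides(1)] dist by auto
    then show ?thesis using linked_side[OF in_sides(1)] 3 by simp
  next
    case 4
    then have "\<not> crossed K (?n c)" "\<not> crossed K (?n (?n c))" 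
      using un[OF in_sides(1)] un[OF in_sides(2)] dist 4 by auto
    then show ?thesis using linked_side[OF in_sides(1)] linked_side[OF in_sides(2)] 4 linked_trans by metis
  qed
qed

end

locale two_tilings = simply_connected_surface S black
  for S :: "'s square_complex" and black +
  fixes T T' :: "'s set set"
  assumes tilings: "domino_tiling S T" "domino_tiling S T'"
begin

definition difference :: "'s set set" where
  "difference = (T - T') \<union> (T' - T)"

definition meeting :: "('s set \<times> 's set) set" where
  "meeting = {(d, e). d \<in> difference \<and> e \<in> difference \<and> d \<inter> e \<noteq> {}}"

lemma tiling_cycles_eq: "tiling_cycles T T' = difference // meeting\<^sup>*"
  by (simp add: tiling_cycles_def difference_def meeting_def Let_def)

text \<open>
  Cycles are classes of an equivalence relation, so each of their edges represents them.
\<close>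

lemma cycle_eq:
  assumes "C \<in> tiling_cycles T T'" "e \<in> C"
  shows "C = meeting\<^sup>* `` {e}"
proof -
  obtain d where d: "C = meeting\<^sup>* `` {d}" using assms(1) unfolding tiling_cycles_eq quotient_def by blast
  have "sym meeting" by (auto simp: sym_def meeting_def)
  then have "sym (meeting\<^sup>*)" by (rule sym_rtrancl)
  then have "(e, d) \<in> meeting\<^sup>*" "(d, e) \<in> meeting\<^sup>*" using assms(2) d by (auto dest: symD)
  then show ?thesis unfolding d by (auto intro: rtrancl_trans)
qed

lemma cycle_subset:
  assumes "C \<in> tiling_cycles T T'"
  shows "C \<subseteq> difference"
proof
  fix e assume e: "e \<in> C"
  obtain d where d: "d \<in> difference" "C = meeting\<^sup>* `` {d}"
    using assms(1) unfolding tiling_cycles_eq quotient_def by blast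
  then have "(d, e) \<in> meeting\<^sup>*" using e by simp
  then show "e \<in> difference" using d(1) by (cases rule: rtranclE) (auto simp: meeting_def)
qed

lemma cycle_nonempty: "C \<in> tiling_cycles T T' \<Longrightarrow> C \<noteq> {}"
  unfolding tiling_cycles_eq quotient_def by auto

lemma cycle_of_edge:
  assumes "e \<in> difference"
  shows "\<exists>C \<in> tiling_cycles T T'. \<forall>C' \<in> tiling_cycles T T'. e \<in> C' \<longleftrightarrow> C' = C"
proof (intro bexI ballI)
  show "meeting\<^sup>* `` {e} \<in> tiling_cycles T T'" using assms unfolding tiling_cycles_eq quotient_def by blast
  show "e \<in> C' \<longleftrightarrow> C' = meeting\<^sup>* `` {e}" if "C' \<in> tiling_cycles T T'" for C'
    using cycle_eq[OF that] by auto
qed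

lemma cycle_closed:
  assumes "C \<in> tiling_cycles T T'" "e \<in> C" "e' \<in> difference" "e \<inter> e' \<noteq> {}"
  shows "e' \<in> C"
proof -
  have "(e, e') \<in> meeting" using assms cycle_subset unfolding meeting_def by blast
  then show ?thesis using cycle_eq[OF assms(1,2)] by auto
qed

lemma cycle_induct:
  assumes C: "C \<in> tiling_cycles T T'" and "e \<in> C" "e' \<in> C" "P e"
    and step: "\<And>d d'. d \<in> C \<Longrightarrow> d' \<in> C \<Longrightarrow> d \<inter> d' \<noteq> {} \<Longrightarrow> P d \<Longrightarrow> P d'"
  shows "P e'"
proof -
  have "(e, e') \<in> meeting\<^sup>*" using cycle_eq[OF C \<open>e \<in> C\<close>] \<open>e' \<in> C\<close> by blast
  then have "P e' \<and> e' \<in> C"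
  proof (induction rule: rtrancl_induct)
    case (step y z)
    then have "z \<in> difference" "y \<inter> z \<noteq> {}" by (auto simp: meeting_def)
    then have "z \<in> C" using cycle_closed[OF C] step by blast
    then show ?case using assms(5)[of y z] step \<open>y \<inter> z \<noteq> {}\<close> by blast
  qed (use assms in auto)
  then show ?thesis ..
qed

lemma finite_cycles: "finite (tiling_cycles T T')"
proof -
  have "finite difference"
    using tiling_edges[OF tilings(1)] tiling_edges[OF tilings(2)] finite_dual_edges finite_subset
    unfolding difference_def by blast
  moreover have "tiling_cycles T T' \<subseteq> Pow difference" using cycle_subset by blast
  ultimately show ?thesis by (meson finite_Pow_iff finite_subset)
qed

text \<open>
  If the edges of \<open>T\<close> and \<open>T'\<close> at \<open>q\<close> differ, both belong to the difference and meet in \<open>q\<close>, so they are in the same cycle.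
\<close>

lemma cycle_card:
  assumes C: "C \<in> tiling_cycles T T'" and q: "q \<in> squares S"
  shows "card {e \<in> T \<inter> C. q \<in> e} = card {e \<in> T' \<inter> C. q \<in> e}"
proof -
  obtain d where d: "d \<in> T" "q \<in> d" using tilings(1) q unfolding domino_tiling_def by blast
  obtain d' where d': "d' \<in> T'" "q \<in> d'" using tilings(2) q unfolding domino_tiling_def by blast
  have u: "{e \<in> T \<inter> C. q \<in> e} = (if d \<in> C then {d} else {})"
  proof -
    have "e = d" if "e \<in> T" "q \<in> e" for e
      using tiling_unique[OF tilings(1) that(1) d(1) that(2) d(2)] .
    then have "{e \<in> T \<inter> C. q \<in> e} \<subseteq> {d}" by blast
    then have "{e \<in> T \<inter> C. q \<in> e} = {} \<or> {e \<in> T \<inter> C. q \<in> e} = {d}"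
      by (rule subset_singletonD)
    moreover have "d \<in> {e \<in> T \<inter> C. q \<in> e} \<longleftrightarrow> d \<in> C" using d by simp
    ultimately show ?thesis by (metis singletonI empty_iff)
  qed
  have u': "{e \<in> T' \<inter> C. q \<in> e} = (if d' \<in> C then {d'} else {})"
  proof -
    have "e = d'" if "e \<in> T'" "q \<in> e" for e
      using tiling_unique[OF tilings(2) that(1) d'(1) that(2) d'(2)] .
    then have "{e \<in> T' \<inter> C. q \<in> e} \<subseteq> {d'}" by blast
    then have "{e \<in> T' \<inter> C. q \<in> e} = {} \<or> {e \<in> T' \<inter> C. q \<in> e} = {d'}"
      by (rule subset_singletonD)
    moreover have "d' \<in> {e \<in> T' \<inter> C. q \<in> e} \<longleftrightarrow> d' \<in> C" using d' by simp
    ultimately show ?thesis by (metis singletonI empty_iff)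
  qed
  have "d \<in> C \<longleftrightarrow> d' \<in> C"
  proof
    assume "d \<in> C"
    then have "d \<notin> T'" using cycle_subset[OF C] d unfolding difference_def by blast
    then have "d' \<notin> T" using tiling_unique[OF tilings(1) d(1) _ d(2) d'(2)] d'(1) by metis
    then have "d' \<in> difference" using d' unfolding difference_def by blast
    then show "d' \<in> C" using cycle_closed[OF C \<open>d \<in> C\<close>] d d' by blast
  next
    assume "d' \<in> C"
    then have "d' \<notin> T" using cycle_subset[OF C] d' unfolding difference_def by blast
    then have "d \<notin> T'" using tiling_unique[OF tilings(2) d'(1) _ d'(2) d(2)] d(1) by metis
    then have "d \<in> difference" using d unfolding difference_def by blast
    then show "d \<in> C" using cycle_closed[OF C \<open>d' \<in> C\<close>] d d' by blast
  qed
  then show ?thesis unfolding u u' by simp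
qed

definition cycle_flow :: "'s set set \<Rightarrow> 's side \<Rightarrow> int" where
  "cycle_flow C = edge_flow (T \<inter> C) (T' \<inter> C)"

lemma cycle_height_exists:
  assumes "C \<in> tiling_cycles T T'"
  shows "\<exists>h. height_of (cycle_flow C) h"
  unfolding cycle_flow_def
  by (rule edge_flow_height_exists)
     (use tiling_edges tilings cycle_card[OF assms] in blast)+

lemma cycle_flow_glue: "(s, t) \<in> glue S \<Longrightarrow> cycle_flow C t = - cycle_flow C s"
  unfolding cycle_flow_def by (rule edge_flow_glue)

lemma cycle_flow_mate: "s \<in> Domain (glue S) \<Longrightarrow> cycle_flow C (mate S s) = - cycle_flow C s"
  using cycle_flow_glue mate_glue by blast

lemma cycle_flow_uncrossed: "\<not> crossed C s \<Longrightarrow> cycle_flow C s = 0"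
  unfolding cycle_flow_def edge_flow_def crossed_def by auto

lemma cycle_flow_crossed:
  assumes "C \<in> tiling_cycles T T'" "crossed C s"
  shows "cycle_flow C s = (if edge_across s \<in> T then colour_sign (fst s) else - colour_sign (fst s))"
proof -
  have "edge_across s \<in> difference" using assms cycle_subset unfolding crossed_def by blast
  then show ?thesis using assms(2) unfolding cycle_flow_def edge_flow_def crossed_def difference_def by auto
qed

lemma cycle_flow_1_iff:
  assumes "C \<in> tiling_cycles T T'" "crossed C s"
  shows "cycle_flow C s = 1 \<longleftrightarrow> (edge_across s \<in> T \<longleftrightarrow> black (fst s))"
    "cycle_flow C s = 1 \<or> cycle_flow C s = - 1"
  using cycle_flow_crossed[OF assms] by (auto simp: colour_sign_def)

text \<open>
  Of the two edges one belongs to \<open>T\<close> and the other one to \<open>T'\<close>, so the cycle enters the square through one of the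
  two sides and leaves it through the other one.
\<close>

lemma cycle_through_square:
  assumes C: "C \<in> tiling_cycles T T'" and e: "e1 \<in> C" "e2 \<in> C" "e1 \<noteq> e2" and q: "q \<in> e1" "q \<in> e2"
  obtains x1 x2 where "x1 \<in> Domain (glue S)" "x2 \<in> Domain (glue S)" "fst x1 = q" "fst x2 = q" "x1 \<noteq> x2"
    "edge_across x1 = e1" "edge_across x2 = e2" "cycle_flow C x2 = - cycle_flow C x1"
    "cycle_flow C x1 = 1 \<or> cycle_flow C x1 = - 1"
    "\<forall>x \<in> sides S. fst x = q \<longrightarrow> x \<noteq> x1 \<longrightarrow> x \<noteq> x2 \<longrightarrow> \<not> crossed C x"
proof -
  have D: "d \<in> T \<or> d \<in> T'" "d \<in> T \<longleftrightarrow> d \<notin> T'" "d \<in> dual_edges S" if "d \<in> C" for d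
    using that cycle_subset[OF C] tiling_edges[OF tilings(1)] tiling_edges[OF tilings(2)]
    unfolding difference_def by blast+
  obtain x1 where x1: "x1 \<in> Domain (glue S)" "fst x1 = q" "edge_across x1 = e1"
    using dual_edge_side[OF D(3)[OF e(1)] q(1)] by blast
  obtain x2 where x2: "x2 \<in> Domain (glue S)" "fst x2 = q" "edge_across x2 = e2"
    using dual_edge_side[OF D(3)[OF e(2)] q(2)] by blast
  have uniq: "d = d'" if "d \<in> C" "d' \<in> C" "q \<in> d" "q \<in> d'" "d \<in> T \<longleftrightarrow> d' \<in> T" for d d'
    using that D(2)[of d] D(2)[of d'] tiling_unique[OF tilings(1)] tiling_unique[OF tilings(2)] by metis
  have T: "e1 \<in> T \<longleftrightarrow> e2 \<notin> T" using uniq[OF e(1,2) q] e(3) by blast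
  have cr: "crossed C x1" "crossed C x2" using x1 x2 e by (simp_all add: crossed_def)
  show ?thesis
  proof (rule that[OF x1(1) x2(1) x1(2) x2(2) _ x1(3) x2(3)])
    show "x1 \<noteq> x2" using x1 x2 e(3) by auto
    show "cycle_flow C x2 = - cycle_flow C x1"
      using cycle_flow_crossed[OF C cr(1)] cycle_flow_crossed[OF C cr(2)] x1 x2 T by simp
    show "cycle_flow C x1 = 1 \<or> cycle_flow C x1 = - 1" using cycle_flow_1_iff(2)[OF C cr(1)] .
    show "\<forall>x \<in> sides S. fst x = q \<longrightarrow> x \<noteq> x1 \<longrightarrow> x \<noteq> x2 \<longrightarrow> \<not> crossed C x"
    proof (intro ballI impI notI)
      fix x assume x: "x \<in> sides S" "fst x = q" "x \<noteq> x1" "x \<noteq> x2" and "crossed C x"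
      then have *: "x \<in> Domain (glue S)" "edge_across x \<in> C" by (auto simp: crossed_def)
      moreover have "q \<in> edge_across x" using x(2) by (auto simp: edge_across_def)
      ultimately have "edge_across x = e1 \<or> edge_across x = e2"
        using uniq[of "edge_across x" e1] uniq[of "edge_across x" e2] e q T by blast
      then show False using edge_across_inj[OF *(1) x1(1)] edge_across_inj[OF *(1) x2(1)] x x1 x2 by metis
    qed
  qed
qed

text \<open>
  Following the cycle through a square, the vertices to its left are joined along the left part of the boundary of
  the square, and likewise on the right. The sides \<open>s\<close> with \<open>cycle_flow C s = 1\<close> are the ones through which the cycle
  leaves a square; \<open>vert s\<close> is the vertex to the right and \<open>vert (next_side s)\<close> the one to the left.
\<close>

lemma cycle_sides_linked:
  assumes C: "C \<in> tiling_cycles T T'" and s: "s \<in> Domain (glue S)" "cycle_flow C s = 1"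
    and s': "s' \<in> Domain (glue S)" "cycle_flow C s' = 1"
  shows "linked C (vert s) (vert s') \<and> linked C (vert (next_side s)) (vert (next_side s'))"
proof -
  have in_C: "edge_across x \<in> C" if "x \<in> Domain (glue S)" "cycle_flow C x = 1" for x
    using cycle_flow_uncrossed[of C x] that unfolding crossed_def by fastforce
  define P where "P e \<longleftrightarrow> (\<forall>x \<in> Domain (glue S). cycle_flow C x = 1 \<longrightarrow> edge_across x = e \<longrightarrow>
      linked C (vert s) (vert x) \<and> linked C (vert (next_side s)) (vert (next_side x)))" for e
  have same: "x = y" if "x \<in> Domain (glue S)" "y \<in> Domain (glue S)" "edge_across x = edge_across y"
    "cycle_flow C x = 1" "cycle_flow C y = 1" for x y
  proof -
    have "x = y \<or> x = mate S y" using edge_across_eqD[OF that(2,1)] that(3) by simp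
    then show ?thesis using cycle_flow_mate[OF that(2), of C] that(4,5) by auto
  qed
  have "P (edge_across s')"
  proof (rule cycle_induct[OF C in_C[OF s] in_C[OF s']])
    show "P (edge_across s)" unfolding P_def
    proof (intro ballI impI)
      fix x assume "x \<in> Domain (glue S)" "cycle_flow C x = 1" "edge_across x = edge_across s"
      then have "x = s" using same s by blast
      then show "linked C (vert s) (vert x) \<and> linked C (vert (next_side s)) (vert (next_side x))"
        by (simp add: linked_refl)
    qed
    fix e1 e2 assume e: "e1 \<in> C" "e2 \<in> C" "e1 \<inter> e2 \<noteq> {}" and P1: "P e1"
    show "P e2"
    proof (cases "e1 = e2")
      case True then show ?thesis using P1 by simp
    next
      case False
      obtain q where q: "q \<in> e1" "q \<in> e2" using e(3) by blast
      obtain x1 x2 where x: "x1 \<in> Domain (glue S)" "x2 \<in> Domain (glue S)" "fst x1 = q" "fst x2 = q" "x1 \<noteq> x2"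
        "edge_across x1 = e1" "edge_across x2 = e2" "cycle_flow C x2 = - cycle_flow C x1"
        "cycle_flow C x1 = 1 \<or> cycle_flow C x1 = - 1"
        "\<forall>x \<in> sides S. fst x = q \<longrightarrow> x \<noteq> x1 \<longrightarrow> x \<noteq> x2 \<longrightarrow> \<not> crossed C x"
        by (rule cycle_through_square[OF C e(1,2) False q])
      have xs: "x1 \<in> sides S" "x2 \<in> sides S" using x(1,2) Domain_glue_sides by blast+
      have around1: "linked C (vert (next_side x1)) (vert x2)"
        by (rule linked_around_square[OF xs]) (use x(3,4,5,10) in auto)
      have around2: "linked C (vert (next_side x2)) (vert x1)"
        by (rule linked_around_square[OF xs(2,1)]) (use x(3,4,5,10) in auto)
      show ?thesis unfolding P_def
      proof (intro ballI impI)
        fix y assume y: "y \<in> Domain (glue S)" "cycle_flow C y = 1" "edge_across y = e2"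
        from x(9) show "linked C (vert s) (vert y) \<and> linked C (vert (next_side s)) (vert (next_side y))"
        proof
          assume 1: "cycle_flow C x1 = 1"
          have m: "y = mate S x2"
            using same[OF y(1) mate_in_Domain[OF x(2)]] y cycle_flow_mate[OF x(2), of C] 1 x(7,8)
              edge_across_mate[OF x(2)] by simp
          have v: "vert x2 = vert (next_side y)" "vert (next_side x2) = vert y"
            using vert_glue[OF mate_glue[OF x(2)]] m by simp_all
          have l: "linked C (vert s) (vert x1)" "linked C (vert (next_side s)) (vert (next_side x1))"
            using P1 x(1,6) 1 unfolding P_def by blast+
          show ?thesis
            using linked_trans[OF l(1) linked_sym[OF around2]] linked_trans[OF l(2) around1]
            unfolding v by blast
        next
          assume 1: "cycle_flow C x1 = - 1"
          have m: "y = x2" using same[OF y(1) x(2)] y 1 x(7,8) by simp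
          let ?m = "mate S x1"
          have v: "vert ?m = vert (next_side x1)" "vert (next_side ?m) = vert x1"
            using vert_glue[OF mate_glue[OF x(1)]] by simp_all
          have "linked C (vert s) (vert ?m) \<and> linked C (vert (next_side s)) (vert (next_side ?m))"
            using P1 mate_in_Domain[OF x(1)] cycle_flow_mate[OF x(1), of C] edge_across_mate[OF x(1)] x(6) 1
            unfolding P_def by simp
          then have l: "linked C (vert s) (vert (next_side x1))" "linked C (vert (next_side s)) (vert x1)"
            unfolding v by blast+
          show ?thesis
            using linked_trans[OF l(1) around1] linked_trans[OF l(2) linked_sym[OF around2]]
            unfolding m by blast
        qed
      qed
    qed
  qed
  then show ?thesis using s' unfolding P_def by blast
qed

lemma cycle_has_side:
  assumes C: "C \<in> tiling_cycles T T'"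
  obtains s where "s \<in> Domain (glue S)" "cycle_flow C s = 1"
proof -
  obtain e where e: "e \<in> C" using cycle_nonempty[OF C] by blast
  then have "e \<in> dual_edges S"
    using cycle_subset[OF C] tiling_edges[OF tilings(1)] tiling_edges[OF tilings(2)]
    unfolding difference_def by blast
  moreover from this obtain q where "q \<in> e" unfolding dual_edges_def by blast
  ultimately obtain x where x: "x \<in> Domain (glue S)" "edge_across x = e" using dual_edge_side by metis
  then have "cycle_flow C x = 1 \<or> cycle_flow C x = - 1"
    using cycle_flow_1_iff(2)[OF C, of x] e by (simp add: crossed_def)
  then show ?thesis
    using that[OF x(1)] that[OF mate_in_Domain[OF x(1)]] cycle_flow_mate[OF x(1), of C] by auto
qed

text \<open>
  A path of sides from a vertex to the cycle stays uncrossed until it meets an end of a crossed side.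
\<close>

lemma vertex_linked_to_cycle:
  assumes C: "C \<in> tiling_cycles T T'" and s: "s \<in> Domain (glue S)" "cycle_flow C s = 1"
    and c: "c \<in> sides S"
  shows "linked C (vert s) (vert c) \<or> linked C (vert (next_side s)) (vert c)"
proof -
  have "s \<in> sides S" using s Domain_glue_sides by blast
  from simply_connected this c show ?thesis
  proof (induction rule: vertices_induct)
    case base then show ?case by (simp add: linked_refl)
  next
    case (step c)
    show ?case
    proof (cases "crossed C c")
      case False
      then show ?thesis using step(2) linked_trans[OF _ linked_side[OF step(1) False]] by blast
    next
      case True
      then have dom: "c \<in> Domain (glue S)" by (simp add: crossed_def)
      from cycle_flow_1_iff(2)[OF C True] show ?thesis
      proof
        assume "cycle_flow C c = 1"
        then show ?thesis using cycle_sides_linked[OF C s dom] by blast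
      next
        assume "cycle_flow C c = - 1"
        then have "cycle_flow C (mate S c) = 1" using cycle_flow_mate[OF dom] by simp
        then have "linked C (vert s) (vert (mate S c))"
          using cycle_sides_linked[OF C s mate_in_Domain[OF dom]] by blast
        then show ?thesis using vert_glue(2)[OF mate_glue[OF dom]] by simp
      qed
    qed
  qed
qed

lemma counterclockwise_iff:
  assumes C: "C \<in> tiling_cycles T T'"
  shows "counterclockwise S black T C \<longleftrightarrow>
    (\<forall>s \<in> Domain (glue S). cycle_flow C s = 1 \<longrightarrow> vert (next_side s) \<in> enclosed_region S C)"
proof -
  have flow: "cycle_flow C (q, i) = 1 \<longleftrightarrow> (q, r) \<in> cycle_arcs black T C" if g: "((q, i), (r, j)) \<in> glue S" for q i r j
  proof (cases "crossed C (q, i)")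
    case True
    moreover have "q \<noteq> r" using fst_mate_neq[of "(q, i)"] g glue_mate[OF g] by auto
    ultimately show ?thesis
      using cycle_flow_1_iff(1)[OF C True] edge_across_glue[OF g] by (simp add: cycle_arcs_def crossed_def)
  next
    case False
    then show ?thesis
      using cycle_flow_uncrossed[OF False] edge_across_glue[OF g] g
      by (auto simp: cycle_arcs_def crossed_def)
  qed
  have v: "vert (next_side (q, i)) = paste S (q, corner ((i + 1) mod 4))" for q i
    by (simp add: vertex_of_def next_side_def)
  show ?thesis
  proof
    assume ccw: "counterclockwise S black T C"
    show "\<forall>s \<in> Domain (glue S). cycle_flow C s = 1 \<longrightarrow> vert (next_side s) \<in> enclosed_region S C"
    proof (intro ballI impI)
      fix s assume s: "s \<in> Domain (glue S)" "cycle_flow C s = 1"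
      obtain q i r j where qr: "s = (q, i)" "((q, i), (r, j)) \<in> glue S" using s(1) by (metis DomainE prod.exhaust)
      then have "(q, r) \<in> cycle_arcs black T C" using flow s(2) by simp
      then show "vert (next_side s) \<in> enclosed_region S C"
        using ccw qr unfolding counterclockwise_def v[symmetric] by blast
    qed
  next
    assume *: "\<forall>s \<in> Domain (glue S). cycle_flow C s = 1 \<longrightarrow> vert (next_side s) \<in> enclosed_region S C"
    show "counterclockwise S black T C"
      unfolding counterclockwise_def v[symmetric]
    proof clarify
      fix q r i j assume "(q, r) \<in> cycle_arcs black T C" and g: "((q, i), (r, j)) \<in> glue S"
      then have "cycle_flow C (q, i) = 1" using flow by simp
      then show "vert (next_side (q, i)) \<in> enclosed_region S C" using * g by blast
    qed
  qed
qed

text \<open>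
  The height takes one value on the vertices linked to the left of the cycle and a value smaller by one on those
  linked to its right. One of them is zero, as the boundary lies on one side. The vertices on the other side
  are the enclosed ones, and the cycle is counterclockwise if and only if they are to the left.
\<close>

lemma cycle_height:
  assumes C: "C \<in> tiling_cycles T T'" and h: "height_of (cycle_flow C) h" and v: "v \<in> surface_vertices S"
  shows "h v = of_bool (counterclockwise S black T C \<and> v \<in> enclosed_region S C) -
    of_bool (\<not> counterclockwise S black T C \<and> v \<in> enclosed_region S C)"
proof -
  note un = cycle_flow_uncrossed[of C]
  obtain s where s: "s \<in> Domain (glue S)" "cycle_flow C s = 1" using cycle_has_side[OF C] by blast
  have ss: "s \<in> sides S" using s Domain_glue_sides by blast
  have jump: "h (vert (next_side x)) = h (vert x) + 1" if "x \<in> Domain (glue S)" "cycle_flow C x = 1" for x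
    using h that Domain_glue_sides unfolding height_of_def by fastforce
  have val: "h (vert c) = h (vert s) \<and> linked C (vert s) (vert c) \<or>
      h (vert c) = h (vert s) + 1 \<and> linked C (vert (next_side s)) (vert c)" if "c \<in> sides S" for c
  proof -
    have same: "h u = h u'" if "linked C u u'" for u u'
      using linked_height[OF that, of "cycle_flow C" h] un h by blast
    from vertex_linked_to_cycle[OF C s that] show ?thesis
      using same[of "vert s" "vert c"] same[of "vert (next_side s)" "vert c"] jump[OF s] by auto
  qed
  have "squares S \<noteq> {}" using fst_side[OF ss] by blast
  then obtain b where b: "b \<in> sides S" "vert b \<in> surface_boundary S"
    using boundary_vertex_exists unfolding surface_vertices_eq by blast
  have hb: "h (vert b) = 0"
    using h b vertex_of_in_surface_vertices unfolding height_of_def by blast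
  have enc: "vert c \<in> enclosed_region S C \<longleftrightarrow> h (vert c) \<noteq> 0" if c: "c \<in> sides S" for c
  proof
    assume "h (vert c) \<noteq> 0"
    then show "vert c \<in> enclosed_region S C"
      using nonzero_height_enclosed[of C "cycle_flow C" h c] un h c by blast
  next
    assume e: "vert c \<in> enclosed_region S C"
    show "h (vert c) \<noteq> 0"
    proof
      assume "h (vert c) = 0"
      then have "linked C (vert c) (vert b)"
        using val[OF c] val[OF b(1)] hb linked_trans[OF linked_sym, of C _ "vert c" "vert b"] by auto
      then have "connected_component_of (complement_of_curve C) (vert c) (vert b)"
        by (rule linked_component[OF _ c])
      then show False using e b(2) unfolding vertex_enclosed_iff[OF c] by blast
    qed
  qed
  have next_in: "next_side x \<in> sides S" if "x \<in> Domain (glue S)" for x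
  proof -
    have "x \<in> sides S" using that Domain_glue_sides by blast
    then show ?thesis by (simp add: fst_side)
  qed
  obtain c where c: "c \<in> sides S" "v = vert c" using v unfolding surface_vertices_eq by blast
  show ?thesis
  proof (cases "h (vert s) = 0")
    case True
    have "counterclockwise S black T C"
      unfolding counterclockwise_iff[OF C]
    proof (intro ballI impI)
      fix x assume x: "x \<in> Domain (glue S)" "cycle_flow C x = 1"
      have "h (vert x) = 0 \<or> h (vert x) = 1" using val[of x] x(1) Domain_glue_sides True by auto
      then show "vert (next_side x) \<in> enclosed_region S C"
        unfolding enc[OF next_in[OF x(1)]] using jump[OF x] by auto
    qed
    then show ?thesis using enc[OF c(1)] val[OF c(1)] True c(2) by auto
  next
    case False
    then have m: "h (vert s) = - 1" using val[OF b(1)] hb by auto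
    then have "vert (next_side s) \<notin> enclosed_region S C"
      using enc[OF next_in[OF s(1)]] jump[OF s] by simp
    then have "\<not> counterclockwise S black T C" unfolding counterclockwise_iff[OF C] using s by blast
    then show ?thesis using enc[OF c(1)] val[OF c(1)] m c(2) by auto
  qed
qed

lemma edge_flow_sum_cycles:
  "edge_flow T T' s = (\<Sum>C \<in> tiling_cycles T T'. cycle_flow C s)"
proof (cases "s \<in> Domain (glue S)")
  case False
  then show ?thesis by (simp add: cycle_flow_def edge_flow_def crossed_def)
next
  case True
  let ?e = "edge_across s"
  let ?f = "\<lambda>C. of_bool (?e \<in> T \<inter> C) - of_bool (?e \<in> T' \<inter> C) :: int"
  have "(\<Sum>C \<in> tiling_cycles T T'. ?f C) = of_bool (?e \<in> T) - of_bool (?e \<in> T')"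
  proof (cases "?e \<in> difference")
    case True
    then obtain C0 where C0: "C0 \<in> tiling_cycles T T'" "\<And>C. C \<in> tiling_cycles T T' \<Longrightarrow> ?e \<in> C \<longleftrightarrow> C = C0"
      using cycle_of_edge by metis
    have "(\<Sum>C \<in> tiling_cycles T T'. ?f C) =
        (\<Sum>C \<in> tiling_cycles T T'. if C = C0 then of_bool (?e \<in> T) - of_bool (?e \<in> T') else 0)"
      using C0(2) by (intro sum.cong refl) simp
    then show ?thesis using C0(1) finite_cycles by simp
  next
    case False
    then have "?e \<notin> C" if "C \<in> tiling_cycles T T'" for C using cycle_subset[OF that] by blast
    then have "(\<Sum>C \<in> tiling_cycles T T'. ?f C) = 0" by (intro sum.neutral) simp
    then show ?thesis using False unfolding difference_def by auto
  qed
  then have "colour_sign (fst s) * (of_bool (?e \<in> T) - of_bool (?e \<in> T')) =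
      (\<Sum>C \<in> tiling_cycles T T'. colour_sign (fst s) * ?f C)"
    by (simp only: sum_distrib_left[symmetric])
  then show ?thesis using True unfolding cycle_flow_def edge_flow_def crossed_def by simp
qed

lemma nu_eq_height:
  assumes h: "height_of (edge_flow T T') h" and v: "v \<in> surface_vertices S"
  shows "nu S black T T' v = nat \<bar>h v\<bar>"
proof -
  let ?\<C> = "tiling_cycles T T'"
  have count: "(\<Sum>C \<in> ?\<C>. of_bool (P C)) = int (card {C \<in> ?\<C>. P C})" for P :: "'s set set \<Rightarrow> bool"
    unfolding of_bool_def sum.inter_filter[OF finite_cycles, symmetric] by simp
  obtain H where H: "\<And>C. C \<in> ?\<C> \<Longrightarrow> height_of (cycle_flow C) (H C)"
    using cycle_height_exists by metis
  have "height_of (edge_flow T T') (\<lambda>v. \<Sum>C \<in> ?\<C>. H C v)"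
    unfolding height_of_def
  proof (intro conjI ballI)
    fix c assume "c \<in> sides S"
    then show "(\<Sum>C \<in> ?\<C>. H C (vert (next_side c))) - (\<Sum>C \<in> ?\<C>. H C (vert c)) = edge_flow T T' c"
      using H unfolding edge_flow_sum_cycles height_of_def sum_subtractf[symmetric]
      by (intro sum.cong) auto
  next
    fix u assume "u \<in> surface_vertices S \<inter> surface_boundary S"
    then show "(\<Sum>C \<in> ?\<C>. H C u) = 0"
      using H unfolding height_of_def by (intro sum.neutral) blast
  qed
  then have "h v = (\<Sum>C \<in> ?\<C>. H C v)" using height_unique[OF h _ v] by blast
  also have "\<dots> = (\<Sum>C \<in> ?\<C>. of_bool (counterclockwise S black T C \<and> v \<in> enclosed_region S C) -
    of_bool (\<not> counterclockwise S black T C \<and> v \<in> enclosed_region S C))"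
    using cycle_height[OF _ H v] by (intro sum.cong) auto
  also have "\<dots> = int (nu_pos S black T T' v) - int (nu_neg S black T T' v)"
    unfolding nu_pos_def nu_neg_def sum_subtractf
    by (simp only: count)
  finally show ?thesis by (simp add: nu_def)
qed

end

section \<open>Flips\<close>

context simply_connected_surface
begin

lemma two_by_two_turn:
  assumes "two_by_two S a b c d"
  obtains x where "x \<in> sides S" "prev_side x \<in> Domain (glue S)" "prev_side (turn S x) \<in> Domain (glue S)"
    "prev_side (turn S (turn S x)) \<in> Domain (glue S)" "prev_side (turn S (turn S (turn S x))) \<in> Domain (glue S)"
    "turn S (turn S (turn S (turn S x))) = x" "fst x = a" "fst (turn S x) = b"
    "fst (turn S (turn S x)) = c" "fst (turn S (turn S (turn S x))) = d" "distinct [a, b, c, d]"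
proof -
  obtain i j k l where g: "((a, (i + 3) mod 4), (b, j)) \<in> glue S" "((b, (j + 3) mod 4), (c, k)) \<in> glue S"
    "((c, (k + 3) mod 4), (d, l)) \<in> glue S" "((d, (l + 3) mod 4), (a, i)) \<in> glue S"
    and dist: "distinct [a, b, c, d]"
    using assms unfolding two_by_two_def by blast
  have p: "prev_side (q, n) = (q, (n + 3) mod 4)" for q :: 's and n by (simp add: prev_side_def)
  have t: "turn S (a, i) = (b, j)" "turn S (b, j) = (c, k)" "turn S (c, k) = (d, l)" "turn S (d, l) = (a, i)"
    unfolding turn_def p using g by (simp_all add: glue_mate)
  show ?thesis
    by (rule that[of "(a, i)"]) (use g dist glue_in_sides(2)[OF g(4)] in \<open>auto simp: t p\<close>)
qed

text \<open>
  A closed cycle of turns exhausts the corners at its vertex and leaves no unpasted side there.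
\<close>

lemma closed_turn_cycle:
  fixes x :: "'s side"
  defines "x1 \<equiv> turn S x" and "x2 \<equiv> turn S (turn S x)" and "x3 \<equiv> turn S (turn S (turn S x))"
  assumes x: "x \<in> sides S" and p: "prev_side x \<in> Domain (glue S)" "prev_side x1 \<in> Domain (glue S)"
      "prev_side x2 \<in> Domain (glue S)" "prev_side x3 \<in> Domain (glue S)" and closed: "turn S x3 = x"
  shows "x1 \<in> sides S" "x2 \<in> sides S" "x3 \<in> sides S"
    "corners_at S (vert x) = {x, x1, x2, x3}" "vert x \<notin> surface_boundary S"
proof -
  have t: "turn S x = x1" "turn S x1 = x2" "turn S x2 = x3" "turn S x3 = x"
    using closed by (simp_all add: x1_def x2_def x3_def)
  note v1 = vert_turn[OF x p(1), unfolded t]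
  note v2 = vert_turn[OF v1(2) p(2), unfolded t]
  note v3 = vert_turn[OF v2(2) p(3), unfolded t]
  note v4 = vert_turn[OF v3(2) p(4), unfolded t]
  show in_sides: "x1 \<in> sides S" "x2 \<in> sides S" "x3 \<in> sides S" using v1 v2 v3 by blast+
  let ?A = "{x, x1, x2, x3}"
  have A: "y \<in> sides S \<and> prev_side y \<in> Domain (glue S) \<and> vert y = vert x \<and> y \<in> Domain (glue S)" if "y \<in> ?A" for y
    using that x in_sides p v1 v2 v3 v4 by auto
  have all: "y \<in> ?A" if y: "y \<in> sides S" "vert y = vert x" for y
  proof (rule vert_induct[of x y "\<lambda>y. y \<in> ?A"])
    fix s u assume g: "(s, u) \<in> glue S"
    show "next_side u \<in> ?A" if "s \<in> ?A"
    proof -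
      have "\<exists>z \<in> ?A. turn S z = s" using that t by auto
      then obtain z where z: "z \<in> ?A" "turn S z = s" by blast
      have "next_side u \<in> sides S" "prev_side (next_side u) \<in> Domain (glue S)"
        using glue_in_sides[OF g] glue_sym[OF g] by (auto simp: fst_side)
      moreover have "turn S (next_side u) = s" using turn_next_side[OF glue_sym[OF g]] .
      ultimately have "z = next_side u" using turn_inj[of z "next_side u"] A[OF z(1)] z(2) by simp
      then show ?thesis using z(1) by simp
    qed
    show "u \<in> ?A" if "next_side s \<in> ?A"
    proof -
      have "turn S (next_side s) \<in> ?A" using that t by auto
      then show ?thesis unfolding turn_next_side[OF g] .
    qed
  qed (use x y in auto)
  show "corners_at S (vert x) = ?A"
  proof (intro set_eqI iffI)
    show "y \<in> ?A" if "y \<in> corners_at S (vert x)" for y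
      using that by (intro all) (simp_all add: corners_at_eq)
    show "y \<in> corners_at S (vert x)" if "y \<in> ?A" for y
      using A[OF that] by (simp add: corners_at_eq)
  qed
  show "vert x \<notin> surface_boundary S"
  proof
    assume "vert x \<in> surface_boundary S"
    then obtain y where y: "y \<in> sides S" "vert y = vert x" "y \<notin> Domain (glue S) \<or> prev_side y \<notin> Domain (glue S)"
      using vert_in_boundary_iff[OF x] by blast
    show False using A[OF all[OF y(1,2)]] y(3) by simp
  qed
qed

lemma flip_is_tiling:
  assumes T: "domino_tiling S T" and square: "two_by_two S a b c d" and dom: "{a, b} \<in> T" "{c, d} \<in> T"
  shows "domino_tiling S (T - {{a, b}, {c, d}} \<union> {{b, c}, {d, a}})"
    "{b, c} \<notin> T" "{d, a} \<notin> T"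
proof -
  have dist: "distinct [a, b, c, d]" using square by (simp add: two_by_two_def)
  show not_in: "{b, c} \<notin> T" "{d, a} \<notin> T"
    using tiling_unique[OF T dom(1), of "{b, c}" b] tiling_unique[OF T dom(1), of "{d, a}" a] dist
    by (auto simp: doubleton_eq_iff)
  let ?T = "T - {{a, b}, {c, d}} \<union> {{b, c}, {d, a}}"
  have "{b, c} \<in> dual_edges S" "{d, a} \<in> dual_edges S"
    using square dist unfolding two_by_two_def dual_edges_def by auto
  then have sub: "?T \<subseteq> dual_edges S" using tiling_edges[OF T] by blast
  have uniq: "e = e'" if e: "e \<in> ?T" "e' \<in> ?T" "q \<in> e" "q \<in> e'" for e e' q
  proof (cases "q \<in> {a, b, c, d}")
    case True
    have old: "f \<in> {{b, c}, {d, a}}" if f: "f \<in> ?T" "q \<in> f" for f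
    proof (rule ccontr)
      assume "f \<notin> {{b, c}, {d, a}}"
      then have "f \<in> T" "f \<noteq> {a, b}" "f \<noteq> {c, d}" using f by auto
      then show False
        using True f(2) tiling_unique[OF T dom(1), of f q] tiling_unique[OF T dom(2), of f q] by auto
    qed
    show ?thesis using old[OF e(1,3)] old[OF e(2,4)] e(3,4) dist by auto
  next
    case False
    then have "e \<in> T" "e' \<in> T" using e by auto
    then show ?thesis using tiling_unique[OF T] e by blast
  qed
  have ex: "\<exists>e \<in> ?T. q \<in> e" if q: "q \<in> squares S" for q
  proof (cases "q \<in> {a, b, c, d}")
    case True then show ?thesis by auto
  next
    case False
    obtain e where "e \<in> T" "q \<in> e" using T q unfolding domino_tiling_def by blast
    then show ?thesis using False by auto
  qed
  show "domino_tiling S ?T"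
    unfolding domino_tiling_def
  proof (intro conjI ballI sub)
    fix q assume "q \<in> squares S"
    then obtain e where e: "e \<in> ?T" "q \<in> e" by (rule bexE[OF ex])
    show "\<exists>!e. e \<in> ?T \<and> q \<in> e"
    proof (rule ex1I[of _ e])
      show "e \<in> ?T \<and> q \<in> e" using e by (rule conjI)
      show "e' = e" if "e' \<in> ?T \<and> q \<in> e'" for e'
        using uniq[of e' e q] that e by blast
    qed
  qed
qed

text \<open>
  The four edges in the \<open>2 \<times> 2\<close> square cross the four sides at its center. Before the flip those of \<open>T\<close> lead
  from black to white, and the new edges are counted from white to black, so all four sides at
  the center are crossed in the same rotational sense.
\<close>

lemma flip_height:
  assumes T: "domino_tiling S T" and square: "two_by_two S a b c d" and dom: "{a, b} \<in> T" "{c, d} \<in> T"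
  defines "T1 \<equiv> T - {{a, b}, {c, d}} \<union> {{b, c}, {d, a}}"
  assumes x: "x \<in> sides S" "prev_side x \<in> Domain (glue S)" "prev_side (turn S x) \<in> Domain (glue S)"
    "prev_side (turn S (turn S x)) \<in> Domain (glue S)" "prev_side (turn S (turn S (turn S x))) \<in> Domain (glue S)"
    "turn S (turn S (turn S (turn S x))) = x" "fst x = a" "fst (turn S x) = b"
    "fst (turn S (turn S x)) = c" "fst (turn S (turn S (turn S x))) = d"
  shows "height_of (edge_flow T T1) (\<lambda>u. colour_sign a * of_bool (u = vert x))"
proof -
  define x1 where "x1 = turn S x"
  define x2 where "x2 = turn S x1"
  define x3 where "x3 = turn S x2"
  note x_def' = x1_def x2_def x3_def
  have fst_x: "fst x = a" "fst x1 = b" "fst x2 = c" "fst x3 = d" using x by (simp_all add: x_def')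
  have p: "prev_side x \<in> Domain (glue S)" "prev_side x1 \<in> Domain (glue S)"
    "prev_side x2 \<in> Domain (glue S)" "prev_side x3 \<in> Domain (glue S)"
    using x by (simp_all add: x_def')
  note cyc = closed_turn_cycle[OF x(1-6), folded x1_def, folded x2_def, folded x3_def]
  have m: "mate S (prev_side x) = x1" "mate S (prev_side x1) = x2" "mate S (prev_side x2) = x3"
    "mate S (prev_side x3) = x"
    using x(6) by (simp_all add: x_def' turn_def)
  have dist: "distinct [a, b, c, d]" using square by (simp add: two_by_two_def)
  note new = flip_is_tiling(2,3)[OF T square dom]
  have edges: "edge_across (prev_side x) = {a, b}" "edge_across (prev_side x1) = {b, c}"
    "edge_across (prev_side x2) = {c, d}" "edge_across (prev_side x3) = {d, a}"
    using fst_x m by (simp_all add: edge_across_def)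
  have mate_edges: "edge_across x1 = {a, b}" "edge_across x2 = {b, c}"
    "edge_across x3 = {c, d}" "edge_across x = {d, a}"
    using edge_across_mate[OF p(1)] edge_across_mate[OF p(2)] edge_across_mate[OF p(3)]
      edge_across_mate[OF p(4)] unfolding m edges by simp_all
  have edge_iff: "edge_across s = {a, b} \<longleftrightarrow> s = prev_side x \<or> s = x1"
    "edge_across s = {b, c} \<longleftrightarrow> s = prev_side x1 \<or> s = x2"
    "edge_across s = {c, d} \<longleftrightarrow> s = prev_side x2 \<or> s = x3"
    "edge_across s = {d, a} \<longleftrightarrow> s = prev_side x3 \<or> s = x"
    if s: "s \<in> Domain (glue S)" for s
  proof -
    note eqD = edge_across_eqD[OF p(1) s, unfolded m edges] edge_across_eqD[OF p(2) s, unfolded m edges]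
      edge_across_eqD[OF p(3) s, unfolded m edges] edge_across_eqD[OF p(4) s, unfolded m edges]
    show "edge_across s = {a, b} \<longleftrightarrow> s = prev_side x \<or> s = x1"
      by (rule iffI, erule eqD(1)) (elim disjE; simp only: edges mate_edges)
    show "edge_across s = {b, c} \<longleftrightarrow> s = prev_side x1 \<or> s = x2"
      by (rule iffI, erule eqD(2)) (elim disjE; simp only: edges mate_edges)
    show "edge_across s = {c, d} \<longleftrightarrow> s = prev_side x2 \<or> s = x3"
      by (rule iffI, erule eqD(3)) (elim disjE; simp only: edges mate_edges)
    show "edge_across s = {d, a} \<longleftrightarrow> s = prev_side x3 \<or> s = x"
      by (rule iffI, erule eqD(4)) (elim disjE; simp only: edges mate_edges)
  qed
  have sign: "colour_sign b = - colour_sign a" "colour_sign c = colour_sign a" "colour_sign d = - colour_sign a"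
    using colour_sign_glue[OF mate_glue[OF p(1)]] colour_sign_glue[OF mate_glue[OF p(2)]]
      colour_sign_glue[OF mate_glue[OF p(3)]] unfolding m by (simp_all add: fst_x)
  have glued: "x \<in> Domain (glue S)" "x1 \<in> Domain (glue S)" "x2 \<in> Domain (glue S)" "x3 \<in> Domain (glue S)"
    using mate_in_Domain[OF p(1)] mate_in_Domain[OF p(2)] mate_in_Domain[OF p(3)] mate_in_Domain[OF p(4)]
    unfolding m by auto
  have xs: "x \<in> sides S" "x1 \<in> sides S" "x2 \<in> sides S" "x3 \<in> sides S" using cyc x(1) by auto
  have prev_neq: "prev_side y \<noteq> y" if "y \<in> sides S" for y
  proof -
    have "snd y < 4" using side_lt_4[OF that] .
    then have "(snd y + 3) mod 4 \<noteq> snd y" by (cases rule: less_4_cases) simp_all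
    then show ?thesis by (metis prev_side_def snd_conv)
  qed
  have d8: "distinct [x, x1, x2, x3, prev_side x, prev_side x1, prev_side x2, prev_side x3]"
  proof -
    have neq: "y \<noteq> z" if "fst y \<noteq> fst z" for y z :: "'s side" using that by auto
    have "distinct [x, x1, x2, x3]" "distinct [prev_side x, prev_side x1, prev_side x2, prev_side x3]"
      using dist fst_x by (auto intro!: neq)
    moreover have "y \<noteq> prev_side z" if "y \<in> {x, x1, x2, x3}" "z \<in> {x, x1, x2, x3}" for y z
    proof (cases "fst y = fst z")
      case True
      then have "y = z" using that dist fst_x by auto
      moreover have "z \<in> sides S" using that(2) xs by auto
      ultimately show ?thesis using prev_neq[of z] by metis
    next
      case False then show ?thesis by (intro neq) simp
    qed
    ultimately show ?thesis by simp
  qed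
  have v: "vert s = vert x \<longleftrightarrow> s \<in> {x, x1, x2, x3}" if "s \<in> sides S" for s
    using cyc(4) that unfolding corners_at_eq by blast
  have vn: "vert (next_side s) = vert x \<longleftrightarrow> s \<in> {prev_side x, prev_side x1, prev_side x2, prev_side x3}"
    if s: "s \<in> sides S" for s
  proof -
    have "next_side s = y \<longleftrightarrow> s = prev_side y" if "y \<in> sides S" for y
      using prev_next_side[OF s] next_prev_side[OF that] by metis
    then show ?thesis using v[of "next_side s"] s xs by (simp add: fst_side)
  qed
  have diff: "colour_sign a * of_bool (vert (next_side s) = vert x) - colour_sign a * of_bool (vert s = vert x) =
      edge_flow T T1 s" if s: "s \<in> sides S" for s
  proof (cases "s \<in> Domain (glue S)")
    case False
    then have "s \<notin> {x, x1, x2, x3}" "s \<notin> {prev_side x, prev_side x1, prev_side x2, prev_side x3}"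
      using glued p by blast+
    then show ?thesis using v[OF s] vn[OF s] edge_flow_boundary s False by simp
  next
    case True
    have ne: "{a, b} \<noteq> {b, c}" "{a, b} \<noteq> {d, a}" "{c, d} \<noteq> {b, c}" "{c, d} \<noteq> {d, a}" "{a, b} \<noteq> {c, d}" "{b, c} \<noteq> {d, a}"
      using dist by (auto simp: doubleton_eq_iff)
    have "of_bool (crossed T s) - of_bool (crossed T1 s) =
      (of_bool (edge_across s = {a, b}) + of_bool (edge_across s = {c, d}) -
       of_bool (edge_across s = {b, c}) - of_bool (edge_across s = {d, a}) :: int)"
    proof (cases "edge_across s \<in> {{a, b}, {c, d}, {b, c}, {d, a}}")
      case True
      then show ?thesis using \<open>s \<in> Domain (glue S)\<close> ne dom new unfolding crossed_def T1_def by auto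
    next
      case False
      then show ?thesis unfolding crossed_def T1_def by auto
    qed
    then have flow: "edge_flow T T1 s = colour_sign (fst s) *
      (of_bool (s = prev_side x \<or> s = x1) + of_bool (s = prev_side x2 \<or> s = x3) -
       of_bool (s = prev_side x1 \<or> s = x2) - of_bool (s = prev_side x3 \<or> s = x))"
      unfolding edge_flow_def edge_iff[OF True] by simp
    consider "s \<in> {prev_side x, prev_side x1, prev_side x2, prev_side x3}" | "s \<in> {x, x1, x2, x3}"
      | "s \<notin> {prev_side x, prev_side x1, prev_side x2, prev_side x3}" "s \<notin> {x, x1, x2, x3}" by blast
    then show ?thesis
    proof cases
      case 1
      then have "s \<notin> {x, x1, x2, x3}" using d8 by auto
      with 1 show ?thesis using d8 unfolding flow v[OF s] vn[OF s]
        by (auto simp: fst_x sign)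
    next
      case 2
      then have "s \<notin> {prev_side x, prev_side x1, prev_side x2, prev_side x3}" using d8 by auto
      with 2 show ?thesis using d8 unfolding flow v[OF s] vn[OF s]
        by (auto simp: fst_x sign)
    next
      case 3
      then show ?thesis unfolding flow v[OF s] vn[OF s] by simp
    qed
  qed
  show ?thesis unfolding height_of_def using diff cyc(5) by auto
qed

lemma flip_graph_height:
  assumes "(T, T1) \<in> flip_graph S"
  shows "\<exists>v \<in> surface_vertices S. \<exists>e. \<bar>e\<bar> = 1 \<and> height_of (edge_flow T T1) (\<lambda>u. e * of_bool (u = v))"
proof -
  obtain a b c d where T: "domino_tiling S T" and square: "two_by_two S a b c d"
    and dom: "{a, b} \<in> T" "{c, d} \<in> T" and T1: "T1 = T - {{a, b}, {c, d}} \<union> {{b, c}, {d, a}}"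
    using assms unfolding flip_graph_def flip_def by blast
  obtain x where x: "x \<in> sides S" "prev_side x \<in> Domain (glue S)" "prev_side (turn S x) \<in> Domain (glue S)"
    "prev_side (turn S (turn S x)) \<in> Domain (glue S)" "prev_side (turn S (turn S (turn S x))) \<in> Domain (glue S)"
    "turn S (turn S (turn S (turn S x))) = x" "fst x = a" "fst (turn S x) = b"
    "fst (turn S (turn S x)) = c" "fst (turn S (turn S (turn S x))) = d"
    by (rule two_by_two_turn[OF square])
  have "height_of (edge_flow T T1) (\<lambda>u. colour_sign a * of_bool (u = vert x))"
    unfolding T1 by (rule flip_height[OF T square dom x])
  moreover have "\<bar>colour_sign a\<bar> = 1" by (simp add: colour_sign_def)
  ultimately show ?thesis using vertex_of_in_surface_vertices[OF x(1)] by blast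
qed

lemma flip_graph_sym:
  assumes "(T, T1) \<in> flip_graph S"
  shows "(T1, T) \<in> flip_graph S"
proof -
  obtain a b c d where T: "domino_tiling S T" "domino_tiling S T1" and square: "two_by_two S a b c d"
    and dom: "{a, b} \<in> T" "{c, d} \<in> T" and T1: "T1 = T - {{a, b}, {c, d}} \<union> {{b, c}, {d, a}}"
    using assms unfolding flip_graph_def flip_def by blast
  have square': "two_by_two S b c d a" using square unfolding two_by_two_def by auto
  have "T = T1 - {{b, c}, {d, a}} \<union> {{c, d}, {a, b}}"
    using flip_is_tiling(2,3)[OF T(1) square dom] dom unfolding T1 by blast
  then have "flip S T1 T" unfolding flip_def using square' T1 by blast
  then show ?thesis using T unfolding flip_graph_def by blast
qed

section \<open>The distance of two tilings\<close>

lemma tiling_height_exists: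
  assumes "domino_tiling S T" "domino_tiling S T'"
  shows "\<exists>h. height_of (edge_flow T T') h"
  by (rule edge_flow_height_exists)
     (use assms in \<open>simp_all add: tiling_edges tiling_card\<close>)

text \<open>
  Thurston's height function: along a side that is not crossed by a domino the height increases by
  one if the square to the left is black. A crossed side gets \<open>-3\<close> in place of \<open>1\<close>, which makes the sum
  around a square vanish.
\<close>

lemma single_tiling_height:
  assumes "domino_tiling S T"
  shows "\<exists>g. \<forall>c \<in> sides S. g (vert (next_side c)) - g (vert c) =
           colour_sign (fst c) * (1 - 4 * of_bool (crossed T c))"
proof (rule exact_on_vertices[OF simply_connected])
  show "colour_sign (fst t) * (1 - 4 * of_bool (crossed T t)) =
      - (colour_sign (fst s) * (1 - 4 * of_bool (crossed T s)))" if "(s, t) \<in> glue S" for s t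
    using crossed_mate[of s T] glue_mate[OF that] colour_sign_glue[OF that] that by auto
  show "(\<Sum>i<4. colour_sign (fst (q, i)) * (1 - 4 * of_bool (crossed T (q, i)))) = 0"
    if q: "q \<in> squares S" for q
  proof -
    have "(\<Sum>i<4. colour_sign (fst (q, i)) * (1 - 4 * of_bool (crossed T (q, i)))) =
        colour_sign q * (4 - 4 * (\<Sum>i<4. of_bool (crossed T (q, i))))"
      by (simp only: fst_conv sum_distrib_left[symmetric] sum_subtractf) simp
    also have "\<dots> = 0"
      unfolding sum_crossed[OF tiling_edges[OF assms] q] tiling_card[OF assms q] by simp
    finally show ?thesis .
  qed
qed

text \<open>
  Let \<open>h\<close> be maximal at \<open>v\<close>, and among these vertices let the height \<open>g\<close> of \<open>T\<close> be minimal at \<open>v\<close>. On a side that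
  starts at \<open>v\<close> in a white square and is not crossed by \<open>T\<close>, \<open>g\<close> decreases by one, while \<open>h\<close> does not decrease; this
  contradicts the choice of \<open>v\<close>. So both such sides are crossed by dominos of \<open>T\<close>.
\<close>

lemma flip_at_maximum:
  assumes T: "domino_tiling S T" and T': "domino_tiling S T'"
    and h: "height_of (edge_flow T T') h" and pos: "\<exists>v \<in> surface_vertices S. 0 < h v"
  shows "\<exists>T1. \<exists>v \<in> surface_vertices S. (T, T1) \<in> flip_graph S \<and> 0 < h v \<and>
           height_of (edge_flow T T1) (\<lambda>u. of_bool (u = v))"
proof -
  let ?V = "surface_vertices S"
  obtain g where g: "\<And>c. c \<in> sides S \<Longrightarrow> g (vert (next_side c)) - g (vert c) =
      colour_sign (fst c) * (1 - 4 * of_bool (crossed T c))"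
    using single_tiling_height[OF T] by blast
  obtain v0 where v0: "v0 \<in> ?V" "0 < h v0" using pos by blast
  define M where "M = Max (h ` ?V)"
  have M: "h u \<le> M" if "u \<in> ?V" for u
    unfolding M_def using finite_vertices that by (intro Max_ge) auto
  have "M \<in> h ` ?V" unfolding M_def using finite_vertices v0(1) by (intro Max_in) auto
  then have ne: "{u \<in> ?V. h u = M} \<noteq> {}" by auto
  have "\<exists>v \<in> {u \<in> ?V. h u = M}. \<forall>u \<in> {u \<in> ?V. h u = M}. g v \<le> g u"
  proof -
    let ?G = "g ` {u \<in> ?V. h u = M}"
    have "finite ?G" using finite_vertices by simp
    then have "Min ?G \<in> ?G" "\<And>y. y \<in> ?G \<Longrightarrow> Min ?G \<le> y" using ne by (auto intro: Min_in)
    then show ?thesis by (metis (no_types, lifting) imageE imageI)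
  qed
  then obtain v where v: "v \<in> ?V" "h v = M" and min: "\<And>u. u \<in> ?V \<Longrightarrow> h u = M \<Longrightarrow> g v \<le> g u" by blast
  have hv: "0 < h v" using M[OF v0(1)] v0(2) v(2) by linarith
  have int: "v \<notin> surface_boundary S" using h v(1) hv unfolding height_of_def by force
  have white: "crossed T y" if y: "y \<in> sides S" "vert y = v" "colour_sign (fst y) = - 1" for y
  proof (rule ccontr)
    assume "\<not> crossed T y"
    then have "g (vert (next_side y)) = g v - 1" using g[OF y(1)] y by simp
    moreover have "h (vert (next_side y)) - h v = of_bool (crossed T' y)"
      using h y \<open>\<not> crossed T y\<close> unfolding height_of_def by (auto simp: edge_flow_def)
    then have "h (vert (next_side y)) \<ge> h v" by (simp add: of_bool_def split: if_splits)
    moreover have "vert (next_side y) \<in> ?V"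
      using y(1) by (intro vertex_of_in_surface_vertices) (simp add: fst_side)
    ultimately show False using min[of "vert (next_side y)"] M[of "vert (next_side y)"] v(2) by simp
  qed
  obtain c where c: "c \<in> sides S" "vert c = v" using v(1) int interior_vertex_cases by blast
  obtain x where x: "x \<in> sides S" "vert x = v" "colour_sign (fst x) = 1"
  proof (cases "colour_sign (fst c) = 1")
    case True then show ?thesis using c that by blast
  next
    case False
    then have m: "colour_sign (fst c) = - 1" by (simp add: colour_sign_def split: if_splits)
    have "turn S c \<in> sides S" "vert (turn S c) = v"
      using vert_turn[OF c(1)] interior_corner_glued[OF c(1)] c int by auto
    moreover have "colour_sign (fst (turn S c)) = 1" using interior_vertex_cycle(4)[OF c int] m by simp
    ultimately show ?thesis using that by blast
  qed
  define x1 where "x1 = turn S x"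
  define x2 where "x2 = turn S x1"
  define x3 where "x3 = turn S x2"
  note cyc = interior_vertex_cycle[OF x(1,2) int, folded x1_def, folded x2_def, folded x3_def]
  have corner: "y \<in> sides S" "vert y = v" if "y \<in> {x, x1, x2, x3}" for y
    using that cyc(1) unfolding corners_at_eq by blast+
  have p: "prev_side y \<in> Domain (glue S)" if "y \<in> {x, x1, x2, x3}" for y
    using interior_corner_glued(2)[OF corner(1)[OF that]] corner(2)[OF that] int by simp
  have glue: "(prev_side x, x1) \<in> glue S" "(prev_side x1, x2) \<in> glue S" "(prev_side x2, x3) \<in> glue S"
    "(prev_side x3, x) \<in> glue S"
    using mate_glue[OF p[of x]] mate_glue[OF p[of x1]] mate_glue[OF p[of x2]] mate_glue[OF p[of x3]]
      cyc(3) by (simp_all add: x1_def x2_def x3_def turn_def)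
  have neq: "fst y \<noteq> fst z" if "y \<in> {x, x1, x2, x3}" "z \<in> {x, x1, x2, x3}" "y \<noteq> z" for y z
    using square_corners_distinct[OF corner(1)[OF that(1)] corner(1)[OF that(2)]] corner(2) that by metis
  let ?a = "fst x" let ?b = "fst x1" let ?c = "fst x2" let ?d = "fst x3"
  have dist: "distinct [?a, ?b, ?c, ?d]" using cyc(2) neq by simp
  have prev: "prev_side y = (fst y, (snd y + 3) mod 4)" for y :: "'s side" by (simp add: prev_side_def)
  have square: "two_by_two S ?a ?b ?c ?d"
    unfolding two_by_two_def using dist glue[unfolded prev]
    by (intro conjI exI[of _ "snd x"] exI[of _ "snd x1"] exI[of _ "snd x2"] exI[of _ "snd x3"]) simp_all
  have dom: "{?a, ?b} \<in> T" "{?c, ?d} \<in> T"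
  proof -
    have "crossed T x1" "crossed T x3" using white corner cyc(4,6) x(3) by simp_all
    moreover have "edge_across x1 = {?a, ?b}" "edge_across x3 = {?c, ?d}"
      using edge_across_glue[OF glue_sym[OF glue(1)]] edge_across_glue[OF glue_sym[OF glue(3)]]
      by (simp_all add: insert_commute)
    ultimately show "{?a, ?b} \<in> T" "{?c, ?d} \<in> T" by (simp_all add: crossed_def)
  qed
  define T1 where "T1 = T - {{?a, ?b}, {?c, ?d}} \<union> {{?b, ?c}, {?d, ?a}}"
  have "(T, T1) \<in> flip_graph S"
    using T flip_is_tiling(1)[OF T square dom] square dom
    unfolding flip_graph_def flip_def T1_def by blast
  moreover have "height_of (edge_flow T T1) (\<lambda>u. colour_sign ?a * of_bool (u = vert x))"
    unfolding T1_def
    by (rule flip_height[OF T square dom x(1)])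
       (use p cyc(3) in \<open>simp_all add: x1_def x2_def x3_def\<close>)
  ultimately show ?thesis using v(1) hv x(2,3) by auto
qed

text \<open>
  The height functions agree on all vertices, so the choice made here is immaterial.
\<close>

definition weight :: "'s set set \<Rightarrow> 's set set \<Rightarrow> nat" where
  "weight T T' = (\<Sum>v \<in> surface_vertices S. nat \<bar>(SOME h. height_of (edge_flow T T') h) v\<bar>)"

lemma weight_eq:
  assumes "height_of (edge_flow T T') h"
  shows "weight T T' = (\<Sum>v \<in> surface_vertices S. nat \<bar>h v\<bar>)"
proof -
  have "height_of (edge_flow T T') (SOME h. height_of (edge_flow T T') h)" using assms by (rule someI[where P = "height_of (edge_flow T T')"])
  then show ?thesis unfolding weight_def using height_unique[OF _ assms] by (intro sum.cong) auto
qed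

lemma height_of_add:
  assumes h: "height_of (edge_flow T T') h" and h': "height_of (edge_flow T' T'') h'"
  shows "height_of (edge_flow T T'') (\<lambda>v. h v + h' v)"
  unfolding height_of_def
proof (intro conjI ballI)
  fix c assume "c \<in> sides S"
  then have "h (vert (next_side c)) - h (vert c) = edge_flow T T' c"
    "h' (vert (next_side c)) - h' (vert c) = edge_flow T' T'' c"
    using h h' unfolding height_of_def by simp_all
  moreover have "edge_flow T T' c + edge_flow T' T'' c = edge_flow T T'' c"
    by (simp add: edge_flow_def algebra_simps)
  ultimately show "h (vert (next_side c)) + h' (vert (next_side c)) - (h (vert c) + h' (vert c)) = edge_flow T T'' c"
    by linarith
qed (use h h' in \<open>simp add: height_of_def\<close>)

lemma height_of_reverse:
  assumes h: "height_of (edge_flow T T') h"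
  shows "height_of (edge_flow T' T) (\<lambda>v. - h v)"
  unfolding height_of_def
proof (intro conjI ballI)
  fix c assume "c \<in> sides S"
  then have "h (vert (next_side c)) - h (vert c) = edge_flow T T' c"
    using h unfolding height_of_def by simp
  moreover have "edge_flow T' T c = - edge_flow T T' c"
    by (simp add: edge_flow_def algebra_simps)
  ultimately show "- h (vert (next_side c)) - - h (vert c) = edge_flow T' T c"
    by linarith
qed (use h in \<open>simp add: height_of_def\<close>)

lemma weight_commute:
  assumes "domino_tiling S T" "domino_tiling S T'"
  shows "weight T T' = weight T' T"
proof -
  obtain h where "height_of (edge_flow T T') h" using tiling_height_exists[OF assms] by blast
  then show ?thesis using weight_eq[of T T' h] weight_eq[OF height_of_reverse, of T T' h] by simp
qed

lemma weight_flip: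
  assumes "(T, T1) \<in> flip_graph S" "domino_tiling S T'"
  shows "weight T T' \<le> weight T1 T' + 1"
proof -
  have T1: "domino_tiling S T1" using assms(1) by (simp add: flip_graph_def)
  obtain v e where v: "v \<in> surface_vertices S" "\<bar>e\<bar> = 1" "height_of (edge_flow T T1) (\<lambda>u. e * of_bool (u = v))"
    using flip_graph_height[OF assms(1)] by blast
  obtain h where h: "height_of (edge_flow T1 T') h" using tiling_height_exists[OF T1 assms(2)] by blast
  have "weight T T' = (\<Sum>u \<in> surface_vertices S. nat \<bar>e * of_bool (u = v) + h u\<bar>)"
    by (rule weight_eq[OF height_of_add[OF v(3) h]])
  also have "\<dots> \<le> (\<Sum>u \<in> surface_vertices S. (if u = v then 1 else 0) + nat \<bar>h u\<bar>)"
    using v(2) by (intro sum_mono) auto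
  also have "\<dots> = 1 + weight T1 T'"
    unfolding sum.distrib weight_eq[OF h] using finite_vertices v(1) by simp
  finally show ?thesis by simp
qed

lemma weight_0_imp_eq:
  assumes T: "domino_tiling S T" and T': "domino_tiling S T'" and "weight T T' = 0"
  shows "T = T'"
proof -
  obtain h where h: "height_of (edge_flow T T') h" using tiling_height_exists[OF T T'] by blast
  then have zero: "h v = 0" if "v \<in> surface_vertices S" for v
    using assms(3) weight_eq[OF h] finite_vertices that by simp
  have iff: "edge_across s \<in> T \<longleftrightarrow> edge_across s \<in> T'" if s: "s \<in> Domain (glue S)" for s
  proof -
    have ss: "s \<in> sides S" using s Domain_glue_sides by blast
    have "edge_flow T T' s = h (vert (next_side s)) - h (vert s)" using h ss unfolding height_of_def by simp
    also have "\<dots> = 0"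
      using zero vertex_of_in_surface_vertices[OF ss] vertex_of_in_surface_vertices[of "next_side s"] ss
      by (simp add: fst_side)
    finally show ?thesis using s by (auto simp: edge_flow_def crossed_def colour_sign_def split: if_splits)
  qed
  have "e \<in> T \<longleftrightarrow> e \<in> T'" if e: "e \<in> dual_edges S" for e
  proof -
    obtain q where "q \<in> e" using e unfolding dual_edges_def by blast
    then obtain s where "s \<in> Domain (glue S)" "edge_across s = e" using dual_edge_side[OF e] by metis
    then show ?thesis using iff by blast
  qed
  then show ?thesis using tiling_edges[OF T] tiling_edges[OF T'] by blast
qed

lemma weight_le_length:
  assumes "(T, T') \<in> flip_graph S ^^ n" "domino_tiling S T'"
  shows "weight T T' \<le> n"
  using assms
proof (induction n arbitrary: T)
  case 0
  then have "height_of (edge_flow T T') (\<lambda>_. 0)" by (simp add: height_of_def edge_flow_def)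
  then show ?case using weight_eq by fastforce
next
  case (Suc n)
  then obtain T1 where "(T, T1) \<in> flip_graph S" "(T1, T') \<in> flip_graph S ^^ n" by (meson relpow_Suc_D2)
  then show ?case using Suc weight_flip[of T T1 T'] by fastforce
qed

lemma flip_towards:
  assumes T: "domino_tiling S T" and T': "domino_tiling S T'"
    and h: "height_of (edge_flow T T') h" and pos: "\<exists>v \<in> surface_vertices S. 0 < h v"
  shows "\<exists>T1. (T, T1) \<in> flip_graph S \<and> domino_tiling S T1 \<and> weight T T' = Suc (weight T1 T')"
proof -
  obtain T1 v where *: "v \<in> surface_vertices S" "(T, T1) \<in> flip_graph S" "0 < h v"
    "height_of (edge_flow T T1) (\<lambda>u. of_bool (u = v))"
    using flip_at_maximum[OF T T' h pos] by blast
  have T1: "domino_tiling S T1" using *(2) by (simp add: flip_graph_def)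
  have "height_of (edge_flow T1 T') (\<lambda>u. - of_bool (u = v) + h u)"
    by (rule height_of_add[OF height_of_reverse[OF *(4)] h])
  then have "weight T1 T' = (\<Sum>u \<in> surface_vertices S. nat \<bar>- of_bool (u = v) + h u\<bar>)" by (rule weight_eq)
  then have "Suc (weight T1 T') = (\<Sum>u \<in> surface_vertices S. (if u = v then 1 else 0) + nat \<bar>- of_bool (u = v) + h u\<bar>)"
    unfolding sum.distrib using finite_vertices *(1) by simp
  also have "\<dots> = (\<Sum>u \<in> surface_vertices S. nat \<bar>h u\<bar>)"
    using *(3) by (intro sum.cong) auto
  also have "\<dots> = weight T T'" using weight_eq[OF h] by simp
  finally show ?thesis using *(2) T1 by metis
qed

text \<open>
  Where the height of the pair is negative, the height of the reversed pair is positive, and a flip of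
  \<open>T'\<close> decreases the weight.
\<close>

lemma flip_path_of_length_weight:
  assumes "domino_tiling S T" "domino_tiling S T'" "weight T T' = n"
  shows "(T, T') \<in> flip_graph S ^^ n"
  using assms
proof (induction n arbitrary: T T')
  case 0
  then show ?case using weight_0_imp_eq by simp
next
  case (Suc n)
  obtain h where h: "height_of (edge_flow T T') h" using tiling_height_exists Suc.prems by blast
  have "\<exists>v \<in> surface_vertices S. h v \<noteq> 0"
  proof (rule ccontr)
    assume "\<not> ?thesis"
    then have "weight T T' = 0" unfolding weight_eq[OF h] by simp
    then show False using Suc.prems by simp
  qed
  then consider "\<exists>v \<in> surface_vertices S. 0 < h v" | "\<exists>v \<in> surface_vertices S. 0 < - h v" by force
  then show ?case
  proof cases
    case 1
    then obtain T1 where "(T, T1) \<in> flip_graph S" "domino_tiling S T1" "weight T T' = Suc (weight T1 T')"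
      using flip_towards[OF Suc.prems(1,2) h] by blast
    moreover from this have "(T1, T') \<in> flip_graph S ^^ n" using Suc.prems by (intro Suc.IH) simp_all
    ultimately show ?thesis by (blast intro: relpow_Suc_I2)
  next
    case 2
    then obtain T1 where T1: "(T', T1) \<in> flip_graph S" "domino_tiling S T1" "weight T' T = Suc (weight T1 T)"
      using flip_towards[OF Suc.prems(2,1) height_of_reverse[OF h]] by blast
    then have "weight T T1 = n"
      using Suc.prems weight_commute[of T T1] weight_commute[of T T'] by simp
    then have "(T, T1) \<in> flip_graph S ^^ n" using Suc.prems(1) T1(2) by (intro Suc.IH)
    then show ?thesis using flip_graph_sym[OF T1(1)] by (rule relpow_Suc_I)
  qed
qed

lemma flip_distance_eq_weight:
  assumes "domino_tiling S T" "domino_tiling S T'"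
  shows "graph_dist (flip_graph S) T T' = enat (weight T T')"
  unfolding graph_dist_def
proof (rule antisym)
  show "(INF n \<in> {n. (T, T') \<in> flip_graph S ^^ n}. enat n) \<le> enat (weight T T')"
    using flip_path_of_length_weight[OF assms refl] by (intro INF_lower) simp
  show "enat (weight T T') \<le> (INF n \<in> {n. (T, T') \<in> flip_graph S ^^ n}. enat n)"
    using weight_le_length[OF _ assms(2)] by (intro INF_greatest) simp
qed

end

theorem theoremA:
  fixes S :: "'s square_complex"
    and black :: "'s \<Rightarrow> bool"
    and T T' :: "'s set set"
  assumes "square_tiled_surface S"
    and "simply_connected_space (surface S)"
    and "interior_vertices_have_four_squares S"
    and "chessboard_coloring S black"
    and "domino_tiling S T"
    and "domino_tiling S T'"
  shows "graph_dist (flip_graph S) T T' = enat (\<Sum>v \<in> surface_vertices S. nu S black T T' v)"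
proof -
  interpret two_tilings S black T T'
    using assms by unfold_locales auto
  obtain h where h: "height_of (edge_flow T T') h" using tiling_height_exists[OF tilings] by blast
  have "weight T T' = (\<Sum>v \<in> surface_vertices S. nu S black T T' v)"
    unfolding weight_eq[OF h] using nu_eq_height[OF h] by (intro sum.cong) auto
  then show ?thesis using flip_distance_eq_weight[OF tilings] by simp
qed

end
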